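(* Let $\mathcal H$ and $\mathcal K$ be complex Hilbert spaces of arbitrary dimensions, let $T\in\mathcal B(\mathcal H,\mathcal K)$ and let $T=U|T|$ be its polar decomposition. Then the following statements are equivalent. (1) $T\in\mathcal{AN}_{(p,k)}(\mathcal H,\mathcal K)$ for every $p\in[1,\infty)$ and for every $k\in\mathbb N$. (2) $T\in\mathcal{AN}_{(p,k)}(\mathcal H,\mathcal K)$ for some $p\in[1,\infty)$ and for some $k\in\mathbb N$. (3) $|T|$ is of the form $|T|=\alpha I+K+F$, where $\alpha\ge0$, $K$ is a positive compact operator and $F$ is a self-adjoint finite-rank operator.
   Context: For a positive $A\in\mathcal B(\mathcal H)$ define $\lambda_j(A)$ as follows. The essential spectrum $\sigma_e(A)$ is the set of points of $\sigma(A)$ that are accumulation points of $\sigma(A)$ or eigenvalues of infinite multiplicity. Let $\mu=\sup\sigma(A)$. If $\mu\in\sigma_e(A)$, put $\lambda_j(A)=\mu$ for $j=1,\dots,\operatorname{rank}(A)$. Otherwise $\mu$ is an eigenvalue of finite multiplicity $m$; put $\lambda_j(A)=\mu$ for $1\le j\le m$ and $\lambda_{m+j}(A)=\lambda_j(A_1)$ for $1\le j\le\operatorname{rank}(A_1)$, where $A_1=A-\mu P_{E_\mu}$ and $P_{E_\mu}$ is the orthogonal projection onto the eigenspace of $\mu$. If $\operatorname{rank}(A)<\infty$, put $\lambda_j(A)=0$ for $j>\operatorname{rank}(A)$. For $T\in\mathcal B(\mathcal H,\mathcal K)$, with $|T|=\sqrt{T^*T}$, the s-numbers are $s_j(T)=\lambda_j(|T|)$.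 For $p\in[1,\infty)$ and $k\in\mathbb N$, the $(p,k)$-singular norm is $\|T\|_{(p,k)}=\left(\sum_{j=1}^ks_j(T)^p\right)^{1/p}$. $T\in\mathcal B(\mathcal H,\mathcal K)$ is $(p,k)$-norming, written $T\in\mathcal N_{(p,k)}(\mathcal H,\mathcal K)$, if there are orthonormal $x_1,\dots,x_k\in\mathcal H$ with $\|T\|_{(p,k)}^p=\sum_{j=1}^k\|Tx_j\|^p$; if $\dim\mathcal H=r<k$, the requirement is instead that there are orthonormal $x_1,\dots,x_r\in\mathcal H$ with $\|T\|_{(p,k)}^p=\sum_{j=1}^r\|Tx_j\|^p$. $T$ is absolutely $(p,k)$-norming, written $T\in\mathcal{AN}_{(p,k)}(\mathcal H,\mathcal K)$, if for every nontrivial (nonzero; $\mathcal M=\mathcal H$ allowed) closed subspace $\mathcal M\subseteq\mathcal H$ the restriction $T|_{\mathcal M}:\mathcal M\to\mathcal K$ is $(p,k)$-norming. *)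

theory Defs
  imports "HOL-Analysis.Analysis"
begin

section \<open>Complex Hilbert spaces\<close>

text \<open>
  The underlying real Hilbert space (norm, topology, completeness) comes from the library classes;
  the complex inner product is linear in its first argument and its real part is the real inner
  product, so that the norm of x is the square root of (cinner x x).
\<close>

class complex_hilbert = real_inner + complete_space +
  fixes scaleC :: "complex \<Rightarrow> 'a \<Rightarrow> 'a"  (infixr \<open>*\<^sub>C\<close> 75)
    and cinner :: "'a \<Rightarrow> 'a \<Rightarrow> complex"
  assumes scaleC_add_right: "a *\<^sub>C (x + y) = a *\<^sub>C x + a *\<^sub>C y"
    and scaleC_add_left: "(a + b) *\<^sub>C x = a *\<^sub>C x + b *\<^sub>C x"
    and scaleC_scaleC: "a *\<^sub>C (b *\<^sub>C x) = (a * b) *\<^sub>C x"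
    and scaleR_scaleC: "r *\<^sub>R x = complex_of_real r *\<^sub>C x"
    and cinner_commute: "cinner y x = cnj (cinner x y)"
    and cinner_add_left: "cinner (x + y) z = cinner x z + cinner y z"
    and cinner_scaleC_left: "cinner (a *\<^sub>C x) y = a * cinner x y"
    and inner_eq_Re_cinner: "inner x y = Re (cinner x y)"

lemma scaleC_one: "1 *\<^sub>C (x :: 'a::complex_hilbert) = x"
  using scaleR_scaleC[of 1 x] by simp

global_interpretation complex_vector:
  vector_space "scaleC :: complex \<Rightarrow> 'a \<Rightarrow> 'a::complex_hilbert"
  by unfold_locales
    (simp_all add: scaleC_add_right scaleC_add_left scaleC_scaleC scaleC_one)

text \<open>\<open>complex_vector.dim\<close> is 0 on infinite-dimensional spaces, so finite dimensionality is
  always tested separately.\<close>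

definition finite_dim :: "'a::complex_hilbert set \<Rightarrow> bool" where
  "finite_dim V \<longleftrightarrow> (\<exists>B. finite B \<and> V \<subseteq> complex_vector.span B)"

definition closed_csubspace :: "'a::complex_hilbert set \<Rightarrow> bool" where
  "closed_csubspace M \<longleftrightarrow> complex_vector.subspace M \<and> closed M"

definition orthonormal_upto :: "nat \<Rightarrow> (nat \<Rightarrow> 'a::complex_hilbert) \<Rightarrow> bool" where
  "orthonormal_upto n x \<longleftrightarrow>
     (\<forall>i\<in>{1..n}. \<forall>j\<in>{1..n}. cinner (x i) (x j) = (if i = j then 1 else 0))"


section \<open>Bounded operators between closed subspaces\<close>

text \<open>
  A closed subspace M is a Hilbert space in its own right. Below, M and N are closed subspaces, and
  an operator from M to N is an extensional function (\<open>undefined\<close> outside M), so that equality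
  of operators is equality of functions. Adjoints, spectra, ranks and so on are
  relative to these carriers. The whole space is the carrier UNIV.
\<close>

definition bounded_ops ::
    "'a::complex_hilbert set \<Rightarrow> 'b::complex_hilbert set \<Rightarrow> ('a \<Rightarrow> 'b) set" where
  "bounded_ops M N = {T \<in> M \<rightarrow>\<^sub>E N.
     (\<forall>x\<in>M. \<forall>y\<in>M. T (x + y) = T x + T y) \<and>
     (\<forall>a. \<forall>x\<in>M. T (a *\<^sub>C x) = a *\<^sub>C T x) \<and>
     (\<exists>C. \<forall>x\<in>M. norm (T x) \<le> C * norm x)}"

definition adj ::
    "'a::complex_hilbert set \<Rightarrow> 'b::complex_hilbert set \<Rightarrow> ('a \<Rightarrow> 'b) \<Rightarrow> 'b \<Rightarrow> 'a" where
  "adj M N T = (THE S. S \<in> bounded_ops N M \<and>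
     (\<forall>x\<in>M. \<forall>y\<in>N. cinner (T x) y = cinner x (S y)))"

definition self_adjoint_op :: "'a::complex_hilbert set \<Rightarrow> ('a \<Rightarrow> 'a) \<Rightarrow> bool" where
  "self_adjoint_op M A \<longleftrightarrow> A \<in> bounded_ops M M \<and> adj M M A = A"

definition positive_op :: "'a::complex_hilbert set \<Rightarrow> ('a \<Rightarrow> 'a) \<Rightarrow> bool" where
  "positive_op M A \<longleftrightarrow> A \<in> bounded_ops M M \<and> (\<forall>x\<in>M. cinner (A x) x \<in> \<real>\<^sub>\<ge>\<^sub>0)"

definition compact_op :: "'a::complex_hilbert set \<Rightarrow> ('a \<Rightarrow> 'a) \<Rightarrow> bool" where
  "compact_op M A \<longleftrightarrow> A \<in> bounded_ops M M \<and> compact (closure (A ` (M \<inter> cball 0 1)))"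

definition finite_rank :: "'a::complex_hilbert set \<Rightarrow> ('a \<Rightarrow> 'b::complex_hilbert) \<Rightarrow> bool" where
  "finite_rank M A \<longleftrightarrow> finite_dim (A ` M)"

text \<open>Only meaningful for operators of finite rank.\<close>

definition op_rank :: "'a::complex_hilbert set \<Rightarrow> ('a \<Rightarrow> 'b::complex_hilbert) \<Rightarrow> nat" where
  "op_rank M A = complex_vector.dim (A ` M)"

definition op_sqrt :: "'a::complex_hilbert set \<Rightarrow> ('a \<Rightarrow> 'a) \<Rightarrow> 'a \<Rightarrow> 'a" where
  "op_sqrt M A = (THE R. positive_op M R \<and> compose M R R = A)"

definition op_abs ::
    "'a::complex_hilbert set \<Rightarrow> 'b::complex_hilbert set \<Rightarrow> ('a \<Rightarrow> 'b) \<Rightarrow> 'a \<Rightarrow> 'a" where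
  "op_abs M N T = op_sqrt M (compose M (adj M N T) T)"

definition orth_proj :: "'a::complex_hilbert set \<Rightarrow> 'a \<Rightarrow> 'a" where
  "orth_proj E x = (THE y. y \<in> E \<and> (\<forall>z\<in>E. cinner (x - y) z = 0))"

definition op_kernel :: "'a::complex_hilbert set \<Rightarrow> ('a \<Rightarrow> 'b::complex_hilbert) \<Rightarrow> 'a set" where
  "op_kernel M T = {x\<in>M. T x = 0}"

definition partial_isometry ::
    "'a::complex_hilbert set \<Rightarrow> 'b::complex_hilbert set \<Rightarrow> ('a \<Rightarrow> 'b) \<Rightarrow> bool" where
  "partial_isometry M N U \<longleftrightarrow> U \<in> bounded_ops M N \<and>
     (\<forall>x\<in>M. (\<forall>z\<in>op_kernel M U. cinner x z = 0) \<longrightarrow> norm (U x) = norm x)"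

definition polar_decomposition ::
    "'a::complex_hilbert set \<Rightarrow> 'b::complex_hilbert set \<Rightarrow> ('a \<Rightarrow> 'b) \<Rightarrow> ('a \<Rightarrow> 'b) \<Rightarrow> bool" where
  "polar_decomposition M N T U \<longleftrightarrow> partial_isometry M N U \<and>
     op_kernel M U = op_kernel M T \<and> T = compose M U (op_abs M N T)"


section \<open>Spectrum and s-numbers\<close>

definition spectrum :: "'a::complex_hilbert set \<Rightarrow> ('a \<Rightarrow> 'a) \<Rightarrow> complex set" where
  "spectrum M A = {z. \<not> (\<exists>B\<in>bounded_ops M M. \<forall>x\<in>M.
     B (A x - z *\<^sub>C x) = x \<and> A (B x) - z *\<^sub>C B x = x)}"

definition eigenspace :: "'a::complex_hilbert set \<Rightarrow> ('a \<Rightarrow> 'a) \<Rightarrow> complex \<Rightarrow> 'a set" where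
  "eigenspace M A z = {x\<in>M. A x = z *\<^sub>C x}"

definition ess_spectrum :: "'a::complex_hilbert set \<Rightarrow> ('a \<Rightarrow> 'a) \<Rightarrow> complex set" where
  "ess_spectrum M A = {z \<in> spectrum M A.
     z islimpt spectrum M A \<or> \<not> finite_dim (eigenspace M A z)}"

text \<open>For positive operators the spectrum is real; this is its supremum as a real number.\<close>

definition spec_sup :: "'a::complex_hilbert set \<Rightarrow> ('a \<Rightarrow> 'a) \<Rightarrow> real" where
  "spec_sup M A = Sup {t. complex_of_real t \<in> spectrum M A}"

text \<open>
  The numbers \<open>op_lambda M A j\<close> for j = 1, 2, ... and a positive operator A on a nonzero
  carrier M; other arguments are junk. If the spectral supremum is not in the essential
  spectrum, it is an eigenvalue and \<open>m \<ge> 1\<close>; the case \<open>m = 0\<close> is there only to make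
  the recursion total.
\<close>

function op_lambda :: "'a::complex_hilbert set \<Rightarrow> ('a \<Rightarrow> 'a) \<Rightarrow> nat \<Rightarrow> real" where
  "op_lambda M A j =
    (let \<mu> = spec_sup M A;
         E = eigenspace M A (complex_of_real \<mu>);
         m = complex_vector.dim E
     in if finite_rank M A \<and> op_rank M A < j then 0
        else if complex_of_real \<mu> \<in> ess_spectrum M A then \<mu>
        else if j \<le> m \<or> m = 0 then \<mu>
        else op_lambda M (\<lambda>x\<in>M. A x - \<mu> *\<^sub>R orth_proj E x) (j - m))"
  by pat_completeness auto
termination
  by (relation "Wellfounded.measure (\<lambda>(M, A, j). j)") auto

declare op_lambda.simps [simp del]

definition s_number ::
    "'a::complex_hilbert set \<Rightarrow> 'b::complex_hilbert set \<Rightarrow> ('a \<Rightarrow> 'b) \<Rightarrow> nat \<Rightarrow> real" where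
  "s_number M N T j = op_lambda M (op_abs M N T) j"


section \<open>Norming and absolutely norming operators\<close>

definition pk_norm ::
    "real \<Rightarrow> nat \<Rightarrow> 'a::complex_hilbert set \<Rightarrow> 'b::complex_hilbert set \<Rightarrow> ('a \<Rightarrow> 'b) \<Rightarrow> real" where
  "pk_norm p k M N T = (\<Sum>j=1..k. s_number M N T j powr p) powr (1 / p)"

definition pk_norming ::
    "real \<Rightarrow> nat \<Rightarrow> 'a::complex_hilbert set \<Rightarrow> 'b::complex_hilbert set \<Rightarrow> ('a \<Rightarrow> 'b) \<Rightarrow> bool" where
  "pk_norming p k M N T \<longleftrightarrow> T \<in> bounded_ops M N \<and>
     (let n = (if finite_dim M \<and> complex_vector.dim M < k then complex_vector.dim M else k)
      in \<exists>x. (\<forall>j\<in>{1..n}. x j \<in> M) \<and> orthonormal_upto n x \<and>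
             pk_norm p k M N T powr p = (\<Sum>j=1..n. norm (T (x j)) powr p))"

definition abs_pk_norming ::
    "real \<Rightarrow> nat \<Rightarrow> 'a::complex_hilbert set \<Rightarrow> 'b::complex_hilbert set \<Rightarrow> ('a \<Rightarrow> 'b) \<Rightarrow> bool" where
  "abs_pk_norming p k H K T \<longleftrightarrow> T \<in> bounded_ops H K \<and>
     (\<forall>M. closed_csubspace M \<and> M \<subseteq> H \<and> M \<noteq> {0} \<longrightarrow> pk_norming p k M K (restrict T M))"

end

theory Submission
  imports Defs
begin

text \<open>
  Both implications go through the norm attainment of \<open>A = |T|\<close> on closed subspaces M.

  If T is absolutely (p,k)-norming, then T attains its norm on every M. Indeed, let \<open>\<mu>\<close> be the norm
  of \<open>R = |T\<^bsub>M\<^esub>|\<close>. If \<open>\<mu>\<close> is not in the essential spectrum of R, it is an isolated point of the spectrum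
  and hence an eigenvalue; if R has finite rank, \<open>\<mu>\<close> is an eigenvalue by compactness; otherwise all
  s-numbers equal \<open>\<mu>\<close>, and each of the k norms in the defining sum is at most \<open>\<mu>\<close>, so that all of
  them are \<open>\<mu>\<close>. Norm attainment on all invariant subspaces gives, by Zorn's lemma, an orthonormal
  basis of eigenvectors of A. Attainment on the closed span of suitable orthonormal sequences
  excludes a strictly increasing sequence of eigenvalues and two separated infinite clusters of
  eigenvalues. Hence there is a threshold \<open>\<alpha>\<close> with finitely many eigenvalues (counted with
  multiplicity) below it and finitely many above every \<open>\<gamma> > \<alpha>\<close>, and F and K are the diagonal
  operators with the negative and the positive parts of the eigenvalues of \<open>A - \<alpha>\<close>.

  Conversely, if \<open>A = \<alpha> + K + F\<close>, then \<open>R\<^sup>2\<close> is the compression of \<open>A\<^sup>2\<close> to M; so \<open>R\<^sup>2 - \<alpha>\<^sup>2\<close> is compact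
  and R is bounded below by \<open>\<alpha>\<close> on a subspace of finite codimension. These two properties make the norm of
  R an eigenvalue, and they survive the subtraction of \<open>\<mu> P\<close> when the eigenspace of \<open>\<mu>\<close> has finite dimension.
  So the recursion for the s-numbers only meets eigenvalues, and the corresponding
  orthonormal eigenvectors realize the (p,k)-norm.
\<close>

section \<open>Orthogonal projections and adjoints\<close>

text \<open>The modulus R of a restriction of T is not the compression of A; only the squares
  compress. So the form \<open>\<alpha> + K + F\<close> cannot be handed down to R, and two weaker
  properties are carried instead. Compactness of R^2 - \<alpha>^2 makes the norm of R an eigenvalue
  when it differs from \<alpha>, but would allow eigenvalues increasing to \<alpha>; the lower bound
  on a subspace of finite codimension excludes exactly that. No functional calculus is used:
  spectral facts are extracted from approximate null vectors of G^2 - c^2, for G = A - t with t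
  real, and from the factorization (G - c)(G + c). In the other direction the test subspaces need
  not be invariant under A. It is enough that an orthonormal sequence \<open>v\<close> has
  orthogonal images: on its closed span the square of the norm of A x is an average of the numbers
  \<open>\<tau> n\<close> with weights |(x, v n)|^2, and such an average stays below the supremum of
  a strictly increasing \<open>\<tau>\<close>. The exponent p enters only through the strict
  monotonicity of powers.\<close>

lemma cinner_add_right: "cinner x (y + z) = cinner x y + cinner x (z::'a::complex_hilbert)"
  by (metis cinner_add_left cinner_commute complex_cnj_add)

lemma cinner_scaleC_right: "cinner x (a *\<^sub>C y) = cnj a * cinner x (y::'a::complex_hilbert)"
  by (metis cinner_commute cinner_scaleC_left complex_cnj_mult)

lemma cinner_self: "cinner x x = complex_of_real ((norm (x::'a::complex_hilbert))\<^sup>2)"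
proof -
  have "Im (cinner x x) = 0"
    using arg_cong[OF cinner_commute[of x x], of Im] by simp
  then show ?thesis
    by (simp add: complex_eq_iff power2_norm_eq_inner inner_eq_Re_cinner)
qed

lemma norm_eq_1_if_cinner:
  assumes "cinner x x = 1"
  shows "norm (x::'a::complex_hilbert) = 1"
proof -
  have "complex_of_real ((norm x)\<^sup>2) = complex_of_real (1\<^sup>2)"
    using assms unfolding cinner_self by simp
  then show ?thesis
    unfolding of_real_eq_iff by (rule power2_eq_imp_eq) simp_all
qed

lemma norm_scaleC: "norm (a *\<^sub>C x) = cmod a * norm (x::'a::complex_hilbert)"
proof -
  have "complex_of_real ((norm (a *\<^sub>C x))\<^sup>2) = complex_of_real ((cmod a * norm x)\<^sup>2)"
    unfolding cinner_self[symmetric] cinner_scaleC_left cinner_scaleC_right power_mult_distrib of_real_mult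
      complex_norm_square by (simp add: mult.assoc)
  then show ?thesis
    by (simp flip: of_real_power)
qed

lemma Im_cinner: "Im (cinner x y) = inner x (\<i> *\<^sub>C (y::'a::complex_hilbert))"
  by (simp add: inner_eq_Re_cinner cinner_scaleC_right)

text \<open>Multiplying x by the unimodular \<open>u\<close> turns the real inner product with y
  into the modulus of the complex one, so the real Cauchy-Schwarz inequality applies.\<close>

lemma norm_cinner_le: "cmod (cinner x y) \<le> norm x * norm (y::'a::complex_hilbert)"
proof (cases "cinner x y = 0")
  case False
  define u where "u = cnj (cinner x y) / cmod (cinner x y)"
  have u: "cmod u = 1"
    using False by (simp add: u_def norm_divide)
  have "u * cinner x y = complex_of_real (cmod (cinner x y))"
    using False
    by (simp add: u_def complex_norm_square[symmetric] mult.commute[of "cnj _"] power2_eq_square)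
  then have "inner (u *\<^sub>C x) y = cmod (cinner x y)"
    by (simp add: inner_eq_Re_cinner cinner_scaleC_left)
  then show ?thesis
    using norm_cauchy_schwarz[of "u *\<^sub>C x" y] u by (simp add: norm_scaleC)
qed simp

text \<open>Conjugate linearity in the second argument is still real linearity, so the real theory
  supplies the rules for limits, continuity, differences and sums.\<close>

interpretation cinner: bounded_bilinear "cinner :: 'a::complex_hilbert \<Rightarrow> 'a \<Rightarrow> complex"
proof
  show "\<exists>K. \<forall>a b. norm (cinner a (b::'a)) \<le> norm a * norm b * K"
    by (intro exI[of _ 1]) (simp add: norm_cinner_le)
qed (simp_all add: cinner_add_left cinner_add_right scaleR_scaleC cinner_scaleC_left
    cinner_scaleC_right scaleR_conv_of_real)

interpretation scaleC: bounded_bilinear "scaleC :: complex \<Rightarrow> 'a::complex_hilbert \<Rightarrow> 'a"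
proof
  show "\<exists>K. \<forall>a b. norm (a *\<^sub>C (b::'a)) \<le> norm a * norm b * K"
    by (intro exI[of _ 1]) (simp add: norm_scaleC)
qed (simp_all add: scaleC_add_left scaleC_add_right scaleR_scaleC scaleC_scaleC
    scaleR_conv_of_real mult.commute)

lemma scaleC_minus_one: "(- 1) *\<^sub>C x = - (x::'a::complex_hilbert)"
  using scaleR_scaleC[of "-1" x] by simp

lemma cinner_eq_0_commute: "cinner x y = 0 \<longleftrightarrow> cinner y (x::'a::complex_hilbert) = 0"
  by (metis cinner_commute complex_cnj_zero)

lemma norm_add_cinner:
  "(norm (x + y))\<^sup>2 = (norm x)\<^sup>2 + 2 * Re (cinner x y) + (norm (y::'a::complex_hilbert))\<^sup>2"
  by (simp add: power2_norm_eq_inner inner_eq_Re_cinner[symmetric] inner_add_left inner_add_right inner_commute)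

lemma norm_diff_cinner:
  "(norm (x - y))\<^sup>2 = (norm x)\<^sup>2 - 2 * Re (cinner x y) + (norm (y::'a::complex_hilbert))\<^sup>2"
  by (simp add: power2_norm_eq_inner inner_eq_Re_cinner[symmetric] inner_diff_left inner_diff_right inner_commute)

lemma pythagoras_cinner:
  "cinner x y = 0 \<Longrightarrow> (norm (x + y))\<^sup>2 = (norm x)\<^sup>2 + (norm (y::'a::complex_hilbert))\<^sup>2"
  by (simp add: norm_add_cinner)

section \<open>Closed subspaces and orthogonal complements\<close>

lemma closed_csubspaceD:
  assumes "closed_csubspace M"
  shows "0 \<in> M" "\<And>x y. x \<in> M \<Longrightarrow> y \<in> M \<Longrightarrow> x + y \<in> M"
    "\<And>x y. x \<in> M \<Longrightarrow> y \<in> M \<Longrightarrow> x - y \<in> M" "\<And>a x. x \<in> M \<Longrightarrow> a *\<^sub>C x \<in> M"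
    "\<And>r x. x \<in> M \<Longrightarrow> r *\<^sub>R x \<in> M" "\<And>x. x \<in> M \<Longrightarrow> - x \<in> M" "closed M" "complex_vector.subspace M"
  using assms unfolding closed_csubspace_def
  by (auto simp: complex_vector.subspace_0 complex_vector.subspace_add complex_vector.subspace_diff
      complex_vector.subspace_scale scaleR_scaleC complex_vector.subspace_neg)

lemma closed_csubspace_UNIV: "closed_csubspace UNIV"
  by (simp add: closed_csubspace_def)

lemma closed_csubspace_Int:
  "closed_csubspace M \<Longrightarrow> closed_csubspace N \<Longrightarrow> closed_csubspace (M \<inter> N)"
  by (simp add: closed_csubspace_def closed_Int complex_vector.subspace_inter)

lemma closed_csubspace_closure_span: "closed_csubspace (closure (complex_vector.span S))"
  (is "closed_csubspace (closure ?V)")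
  unfolding closed_csubspace_def
proof (intro conjI complex_vector.subspaceI closed_closure)
  show "0 \<in> closure ?V"
    using closure_subset complex_vector.span_zero by blast
  fix x assume "x \<in> closure ?V"
  then obtain f where f: "\<And>n. f n \<in> ?V" "f \<longlonglongrightarrow> x"
    by (auto simp: closure_sequential)
  show "c *\<^sub>C x \<in> closure ?V" for c
  proof -
    have "\<And>n. c *\<^sub>C f n \<in> ?V" "(\<lambda>n. c *\<^sub>C f n) \<longlonglongrightarrow> c *\<^sub>C x"
      using f by (auto intro!: complex_vector.span_scale tendsto_intros scaleC.tendsto)
    then show ?thesis
      unfolding closure_sequential by (intro exI[of _ "\<lambda>n. c *\<^sub>C f n"] conjI allI)
  qed
  fix y assume "y \<in> closure ?V"
  then obtain g where g: "\<And>n. g n \<in> ?V" "g \<longlonglongrightarrow> y"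
    by (auto simp: closure_sequential)
  have "\<And>n. f n + g n \<in> ?V" "(\<lambda>n. f n + g n) \<longlonglongrightarrow> x + y"
    using f g by (auto intro!: complex_vector.span_add tendsto_intros)
  then show "x + y \<in> closure ?V"
    unfolding closure_sequential by (intro exI[of _ "\<lambda>n. f n + g n"] conjI allI)
qed

definition orth_compl :: "'a::complex_hilbert set \<Rightarrow> 'a set" where
  "orth_compl S = {x. \<forall>s\<in>S. cinner x s = 0}"

lemma orth_complI: "(\<And>s. s \<in> S \<Longrightarrow> cinner x s = 0) \<Longrightarrow> x \<in> orth_compl S"
  by (simp add: orth_compl_def)

lemma orth_complD: "x \<in> orth_compl S \<Longrightarrow> s \<in> S \<Longrightarrow> cinner x s = 0"
  "x \<in> orth_compl S \<Longrightarrow> s \<in> S \<Longrightarrow> cinner s x = 0"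
  by (simp_all add: orth_compl_def cinner_eq_0_commute)

lemma closed_csubspace_orth_compl: "closed_csubspace (orth_compl S)"
  unfolding closed_csubspace_def
proof
  show "complex_vector.subspace (orth_compl S)"
    by (rule complex_vector.subspaceI)
      (simp_all add: orth_compl_def cinner_add_left cinner_scaleC_left cinner.zero_left)
  have "orth_compl S = (\<Inter>s\<in>S. {x. cinner x s = 0})"
    by (auto simp: orth_compl_def)
  moreover have "closed {x. cinner x s = 0}" for s :: 'a
    by (intro closed_Collect_eq continuous_intros cinner.continuous_on)
  ultimately show "closed (orth_compl S)"
    by auto
qed

text \<open>The complement of the single vector x is a closed subspace; containing S, it contains
  the span of S and, in the next lemma, the closure.\<close>

lemma orth_compl_span: "orth_compl (complex_vector.span S) = orth_compl S"
proof (intro subset_antisym subsetI orth_complI)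
  fix x s assume "x \<in> orth_compl (complex_vector.span S)" "s \<in> S"
  then show "cinner x s = 0"
    using orth_complD complex_vector.span_base by blast
next
  fix x s assume x: "x \<in> orth_compl S" and s: "s \<in> complex_vector.span S"
  have "S \<subseteq> orth_compl {x}"
    using x by (auto intro!: orth_complI dest: orth_complD)
  then have "complex_vector.span S \<subseteq> orth_compl {x}"
    by (rule complex_vector.span_minimal) (rule closed_csubspaceD[OF closed_csubspace_orth_compl])
  then show "cinner x s = 0"
    using s by (auto dest: orth_complD)
qed

lemma orth_compl_closure: "orth_compl (closure S) = orth_compl S"
proof (intro subset_antisym subsetI orth_complI)
  fix x s assume "x \<in> orth_compl (closure S)" "s \<in> S"
  then show "cinner x s = 0"
    using orth_complD closure_subset by blast
next
  fix x s assume x: "x \<in> orth_compl S" and s: "s \<in> closure S"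
  have "S \<subseteq> orth_compl {x}"
    using x by (auto intro!: orth_complI dest: orth_complD)
  then have "closure S \<subseteq> orth_compl {x}"
    by (rule closure_minimal) (rule closed_csubspaceD[OF closed_csubspace_orth_compl])
  then show "cinner x s = 0"
    using s by (auto dest: orth_complD)
qed

text \<open>The classical projection theorem: a minimizing sequence for the distance to x converges,
  and first variation at the minimizer gives orthogonality.\<close>

lemma orth_proj_exists:
  assumes M: "closed_csubspace (M :: 'a::complex_hilbert set)"
  shows "\<exists>y\<in>M. \<forall>z\<in>M. cinner (x - y) z = 0"
proof -
  define d where "d = Inf ((\<lambda>y. (norm (x - y))\<^sup>2) ` M)"
  have bdd: "bdd_below ((\<lambda>y. (norm (x - y))\<^sup>2) ` M)"
    by (rule bdd_belowI2[of _ 0]) simp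
  have d_le: "d \<le> (norm (x - y))\<^sup>2" if "y \<in> M" for y
    unfolding d_def by (rule cINF_lower[OF bdd that])
  have "\<exists>y\<in>M. (norm (x - y))\<^sup>2 < d + 1 / Suc n" for n
  proof -
    have "Inf ((\<lambda>y. (norm (x - y))\<^sup>2) ` M) < d + 1 / Suc n"
      by (simp add: d_def)
    then show ?thesis
      using cINF_less_iff[OF _ bdd] closed_csubspaceD(1)[OF M] by blast
  qed
  then obtain y where y: "\<And>n. y n \<in> M" "\<And>n. (norm (x - y n))\<^sup>2 < d + 1 / Suc n"
    by metis
  \<comment> \<open>Parallelogram law: the midpoint of \<open>y m\<close> and \<open>y n\<close>
    lies in M, so its squared distance to x is at least \<open>d\<close>, which leaves little room
    for their difference.\<close>
  have dist: "(norm (y m - y n))\<^sup>2 \<le> 2 / Suc m + 2 / Suc n" for m n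
  proof -
    have "(1/2) *\<^sub>R (y m + y n) \<in> M"
      using y M by (blast intro: closed_csubspaceD)
    then have "d \<le> (norm (x - (1/2) *\<^sub>R (y m + y n)))\<^sup>2"
      by (rule d_le)
    moreover have "x - (1/2) *\<^sub>R (y m + y n) = (1/2) *\<^sub>R ((x - y m) + (x - y n))"
      by (simp add: algebra_simps flip: scaleR_left_distrib)
    ultimately have "4 * d \<le> (norm ((x - y m) + (x - y n)))\<^sup>2"
      by (simp add: power_mult_distrib power2_eq_square)
    moreover have "(norm ((x - y m) + (x - y n)))\<^sup>2 + (norm (y m - y n))\<^sup>2
        = 2 * (norm (x - y m))\<^sup>2 + 2 * (norm (x - y n))\<^sup>2"
      by (simp add: power2_norm_eq_inner algebra_simps inner_commute)
    ultimately show ?thesis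
      using y(2)[of m] y(2)[of n] by linarith
  qed
  have "Cauchy y"
  proof (rule metric_CauchyI)
    fix e :: real assume e: "0 < e"
    obtain N where N: "4 / Suc N < e\<^sup>2"
      using reals_Archimedean[of "e\<^sup>2 / 4"] e by (auto simp: field_simps)
    have "dist (y m) (y n) < e" if "m \<ge> N" "n \<ge> N" for m n
    proof -
      have "2 / real (Suc m) \<le> 2 / Suc N" "2 / real (Suc n) \<le> 2 / Suc N"
        using that by (auto intro!: divide_left_mono)
      then have "(norm (y m - y n))\<^sup>2 < e\<^sup>2"
        using dist[of m n] N by simp
      then show ?thesis
        using e by (simp add: dist_norm power2_less_imp_less)
    qed
    then show "\<exists>N. \<forall>m\<ge>N. \<forall>n\<ge>N. dist (y m) (y n) < e"
      by blast
  qed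
  then obtain l where l: "y \<longlonglongrightarrow> l"
    using Cauchy_convergent_iff convergent_def by blast
  have lM: "l \<in> M"
    using closed_sequentially[OF closed_csubspaceD(7)[OF M]] y(1) l by blast
  have "(norm (x - l))\<^sup>2 \<le> d"
  proof (rule LIMSEQ_le)
    show "(\<lambda>n. (norm (x - y n))\<^sup>2) \<longlonglongrightarrow> (norm (x - l))\<^sup>2"
      by (intro tendsto_intros l)
    show "(\<lambda>n. d + 1 / Suc n) \<longlonglongrightarrow> d"
      using tendsto_add[OF tendsto_const LIMSEQ_Suc[OF lim_1_over_n], of d] by simp
    show "\<exists>N. \<forall>n\<ge>N. (norm (x - y n))\<^sup>2 \<le> d + 1 / Suc n"
      using y(2) less_imp_le by blast
  qed
  then have min: "(norm (x - l))\<^sup>2 \<le> (norm (x - z))\<^sup>2" if "z \<in> M" for z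
    using d_le[OF that] by linarith
  have "cinner (x - l) z = 0" if z: "z \<in> M" for z
  proof (cases "z = 0")
    case False
    \<comment> \<open>The coefficient for which subtracting \<open>c *\<^sub>C z\<close> shortens x
      - l the most; the gain |c|^2 |z|^2 must be 0 because \<open>l\<close> is already a
      minimizer.\<close>
    define c where "c = cinner (x - l) z / complex_of_real ((norm z)\<^sup>2)"
    have nz: "(norm z)\<^sup>2 \<noteq> 0"
      using False by simp
    have cz: "c * complex_of_real ((norm z)\<^sup>2) = cinner (x - l) z"
      using nz by (simp add: c_def)
    have "(norm (x - l))\<^sup>2 \<le> (norm ((x - l) - c *\<^sub>C z))\<^sup>2"
      using min[of "l + c *\<^sub>C z"] lM z M by (simp add: closed_csubspaceD diff_diff_eq)
    also have "\<dots> = (norm (x - l))\<^sup>2 - 2 * Re (cinner (x - l) (c *\<^sub>C z)) + (norm (c *\<^sub>C z))\<^sup>2"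
      by (rule norm_diff_cinner)
    also have "cinner (x - l) (c *\<^sub>C z) = complex_of_real ((cmod c)\<^sup>2 * (norm z)\<^sup>2)"
      unfolding cinner_scaleC_right cz[symmetric] of_real_mult complex_norm_square by (simp add: mult_ac)
    finally have "(cmod c)\<^sup>2 * (norm z)\<^sup>2 \<le> 0"
      by (simp add: norm_scaleC power_mult_distrib mult.commute)
    then have "c = 0"
      using nz by (auto simp: mult_le_0_iff)
    then show ?thesis
      using cz by simp
  qed (simp add: cinner.zero_right)
  then show ?thesis
    using lM by blast
qed

lemma orth_proj_props:
  assumes M: "closed_csubspace (M :: 'a::complex_hilbert set)"
  shows orth_proj_mem: "orth_proj M x \<in> M"
    and orth_proj_orth: "z \<in> M \<Longrightarrow> cinner (x - orth_proj M x) z = 0"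
    and orth_proj_eqI: "y \<in> M \<Longrightarrow> (\<And>z. z \<in> M \<Longrightarrow> cinner (x - y) z = 0) \<Longrightarrow> orth_proj M x = y"
proof -
  have uniq: "y = y'" if "y \<in> M \<and> (\<forall>z\<in>M. cinner (x - y) z = 0)" "y' \<in> M \<and> (\<forall>z\<in>M. cinner (x - y') z = 0)" for y y'
  proof -
    have "y - y' \<in> M"
      using that M by (simp add: closed_csubspaceD)
    then have "cinner ((x - y') - (x - y)) (y - y') = 0"
      using that unfolding cinner.diff_left by simp
    then show ?thesis
      by (simp add: cinner_self)
  qed
  have ex1: "\<exists>!y. y \<in> M \<and> (\<forall>z\<in>M. cinner (x - y) z = 0)"
    using orth_proj_exists[OF M, of x] uniq by blast
  note * = theI'[OF ex1, folded orth_proj_def]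
  show "orth_proj M x \<in> M" "z \<in> M \<Longrightarrow> cinner (x - orth_proj M x) z = 0"
    using * by auto
  show "y \<in> M \<Longrightarrow> (\<And>z. z \<in> M \<Longrightarrow> cinner (x - y) z = 0) \<Longrightarrow> orth_proj M x = y"
    using * uniq by blast
qed

context
  fixes M :: "'a::complex_hilbert set"
  assumes M: "closed_csubspace M"
begin

lemma orth_proj_cinner: "z \<in> M \<Longrightarrow> cinner (orth_proj M x) z = cinner x z"
  using orth_proj_orth[OF M, of z x] by (simp add: cinner.diff_left)

lemma orth_proj_add: "orth_proj M (x + y) = orth_proj M x + orth_proj M y"
  by (rule orth_proj_eqI[OF M])
    (simp_all add: closed_csubspaceD[OF M] orth_proj_mem[OF M] cinner.diff_left cinner_add_left orth_proj_cinner)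

lemma orth_proj_diff: "orth_proj M (x - y) = orth_proj M x - orth_proj M y"
  by (rule orth_proj_eqI[OF M])
    (simp_all add: closed_csubspaceD[OF M] orth_proj_mem[OF M] cinner.diff_left cinner_add_left orth_proj_cinner)

lemma orth_proj_scaleC: "orth_proj M (c *\<^sub>C x) = c *\<^sub>C orth_proj M x"
  by (rule orth_proj_eqI[OF M])
    (simp_all add: closed_csubspaceD[OF M] orth_proj_mem[OF M] cinner.diff_left cinner_scaleC_left orth_proj_cinner)

lemma orth_proj_id: "x \<in> M \<Longrightarrow> orth_proj M x = x"
  by (rule orth_proj_eqI[OF M]) (simp_all add: cinner.zero_left)

lemma orth_proj_eq_0: "x \<in> orth_compl M \<Longrightarrow> orth_proj M x = 0"
  by (rule orth_proj_eqI[OF M]) (simp_all add: closed_csubspaceD[OF M] orth_complD)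

lemma diff_orth_proj_mem: "x - orth_proj M x \<in> orth_compl M"
  by (simp add: orth_complI orth_proj_orth[OF M])

lemma orth_proj_pythagoras: "(norm x)\<^sup>2 = (norm (orth_proj M x))\<^sup>2 + (norm (x - orth_proj M x))\<^sup>2"
  using pythagoras_cinner[of "orth_proj M x" "x - orth_proj M x"]
    orth_proj_orth[OF M orth_proj_mem[OF M], of x x] by (simp add: cinner_eq_0_commute)

lemma norm_orth_proj_le: "norm (orth_proj M x) \<le> norm x"
  by (rule power2_le_imp_le) (use orth_proj_pythagoras[of x] in simp_all)

lemma orth_proj_tendsto: "f \<longlonglongrightarrow> l \<Longrightarrow> (\<lambda>n. orth_proj M (f n)) \<longlonglongrightarrow> orth_proj M l"
proof -
  assume "f \<longlonglongrightarrow> l"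
  then have "(\<lambda>n. norm (f n - l)) \<longlonglongrightarrow> 0"
    by (simp add: LIM_zero tendsto_norm_zero)
  then have "(\<lambda>n. norm (orth_proj M (f n) - orth_proj M l)) \<longlonglongrightarrow> 0"
    by (rule Lim_null_comparison[rotated]) (simp add: norm_orth_proj_le flip: orth_proj_diff)
  then show ?thesis
    by (simp add: LIM_zero_iff tendsto_norm_zero_iff)
qed

text \<open>The form in which density and surjectivity are proved below: a vector of N minus its
  projection to M lies in N and in the complement of M, hence vanishes.\<close>

lemma subset_of_orth_compl_trivial:
  assumes N: "closed_csubspace N" and "N \<inter> orth_compl M \<subseteq> {0}" "M \<subseteq> N"
  shows "N \<subseteq> M"
proof
  fix x assume "x \<in> N"
  then have "x - orth_proj M x \<in> N \<inter> orth_compl M"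
    using assms orth_proj_mem[OF M] diff_orth_proj_mem by (blast intro: closed_csubspaceD)
  then show "x \<in> M"
    using assms orth_proj_mem[OF M, of x] by auto
qed

end

section \<open>Bounded operators, Riesz representation and adjoints\<close>

lemma bounded_opsD:
  assumes "T \<in> bounded_ops M N"
  shows "x \<in> M \<Longrightarrow> T x \<in> N" "x \<in> M \<Longrightarrow> y \<in> M \<Longrightarrow> T (x + y) = T x + T y"
    "x \<in> M \<Longrightarrow> T (a *\<^sub>C x) = a *\<^sub>C T x" "x \<in> M \<Longrightarrow> T (r *\<^sub>R x) = r *\<^sub>R T x"
    "x \<notin> M \<Longrightarrow> T x = undefined"
  using assms unfolding bounded_ops_def by (auto simp: scaleR_scaleC)

lemma bounded_ops_0:
  assumes "T \<in> bounded_ops M N" "closed_csubspace M"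
  shows "T 0 = 0"
  using bounded_opsD(3)[OF assms(1) closed_csubspaceD(1)[OF assms(2)], of 0] by simp

lemma bounded_ops_diff:
  assumes T: "T \<in> bounded_ops M N" and M: "closed_csubspace M" and "x \<in> M" "y \<in> M"
  shows "T (x - y) = T x - T y"
  using bounded_opsD(2)[OF T \<open>x \<in> M\<close>, of "(-1) *\<^sub>R y"] bounded_opsD(4)[OF T \<open>y \<in> M\<close>, of "-1"]
    closed_csubspaceD(5)[OF M \<open>y \<in> M\<close>, of "-1"] by simp

text \<open>The constant is enlarged to be strictly positive, so that later proofs can divide by it
  without treating the zero operator separately.\<close>

lemma bounded_ops_bound:
  assumes "T \<in> bounded_ops M N"
  obtains C where "0 < C" "\<And>x. x \<in> M \<Longrightarrow> norm (T x) \<le> C * norm x"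
proof -
  obtain C where C: "\<And>x. x \<in> M \<Longrightarrow> norm (T x) \<le> C * norm x"
    using assms unfolding bounded_ops_def by blast
  have "norm (T x) \<le> (\<bar>C\<bar> + 1) * norm x" if "x \<in> M" for x
    by (rule order_trans[OF C[OF that] mult_right_mono]) auto
  then show thesis
    using that[of "\<bar>C\<bar> + 1"] by simp
qed

lemma bounded_opsI:
  assumes "\<And>x. x \<in> M \<Longrightarrow> T x \<in> N" "\<And>x y. x \<in> M \<Longrightarrow> y \<in> M \<Longrightarrow> T (x + y) = T x + T y"
    "\<And>a x. x \<in> M \<Longrightarrow> T (a *\<^sub>C x) = a *\<^sub>C T x" "\<And>x. x \<in> M \<Longrightarrow> norm (T x) \<le> C * norm x"
    "\<And>x. x \<notin> M \<Longrightarrow> T x = undefined"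
  shows "T \<in> bounded_ops M N"
  unfolding bounded_ops_def
proof (intro CollectI conjI)
  show "\<exists>C. \<forall>x\<in>M. norm (T x) \<le> C * norm x"
    using assms(4) by blast
qed (use assms in \<open>auto simp: PiE_def extensional_def\<close>)

lemma bounded_ops_eqI:
  assumes "S \<in> bounded_ops M N" "T \<in> bounded_ops M N" "\<And>x. x \<in> M \<Longrightarrow> S x = T x"
  shows "S = T"
proof
  show "S x = T x" for x
    using bounded_opsD(5)[OF assms(1), of x] bounded_opsD(5)[OF assms(2), of x] assms(3) by force
qed

lemma bounded_ops_tendsto:
  assumes T: "T \<in> bounded_ops M N" and M: "closed_csubspace M"
    and f: "\<And>n. f n \<in> M" "f \<longlonglongrightarrow> l"
  shows "(\<lambda>n. T (f n)) \<longlonglongrightarrow> T l"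
proof -
  have l: "l \<in> M"
    using closed_sequentially[OF closed_csubspaceD(7)[OF M]] f by blast
  obtain C where C: "\<And>x. x \<in> M \<Longrightarrow> norm (T x) \<le> C * norm x"
    using bounded_ops_bound[OF T] by metis
  have "(\<lambda>n. C * norm (f n - l)) \<longlonglongrightarrow> 0"
    using f(2) by (intro tendsto_mult_right_zero) (simp add: LIM_zero tendsto_norm_zero)
  then have "(\<lambda>n. norm (T (f n) - T l)) \<longlonglongrightarrow> 0"
    by (rule Lim_null_comparison[rotated])
      (simp add: C closed_csubspaceD[OF M] f l flip: bounded_ops_diff[OF T M])
  then show ?thesis
    by (simp add: LIM_zero_iff tendsto_norm_zero_iff)
qed

lemma restrict_bounded_ops:
  assumes "T \<in> bounded_ops M N" "closed_csubspace M'" "M' \<subseteq> M"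
  shows "restrict T M' \<in> bounded_ops M' N"
proof -
  obtain C where "\<And>x. x \<in> M \<Longrightarrow> norm (T x) \<le> C * norm x"
    using bounded_ops_bound[OF assms(1)] by metis
  then show ?thesis
    using assms bounded_opsD[OF assms(1)]
    by (intro bounded_opsI[where C = C]) (auto simp: closed_csubspaceD subset_iff)
qed

lemma compose_bounded_ops:
  assumes T: "T \<in> bounded_ops M N" and S: "S \<in> bounded_ops N L" and M: "closed_csubspace M"
  shows "compose M S T \<in> bounded_ops M L"
proof -
  obtain C where C: "\<And>x. x \<in> M \<Longrightarrow> norm (T x) \<le> C * norm x"
    using bounded_ops_bound[OF T] by metis
  obtain D where D: "0 < D" "\<And>x. x \<in> N \<Longrightarrow> norm (S x) \<le> D * norm x"
    using bounded_ops_bound[OF S] by metis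
  have "norm (S (T x)) \<le> D * C * norm x" if "x \<in> M" for x
  proof -
    have "norm (S (T x)) \<le> D * norm (T x)"
      by (rule D(2)[OF bounded_opsD(1)[OF T that]])
    also have "\<dots> \<le> D * (C * norm x)"
      using D(1) by (intro mult_left_mono C[OF that]) simp
    finally show ?thesis
      by (simp add: mult.assoc)
  qed
  then show ?thesis
    using bounded_opsD[OF T] bounded_opsD[OF S]
    by (intro bounded_opsI[where C = "D * C"]) (simp_all add: compose_def closed_csubspaceD[OF M])
qed

text \<open>A nonzero functional is determined by its kernel \<open>V\<close> and one vector
  \<open>z\<close> of M orthogonal to \<open>V\<close>; the representing vector is a multiple of
  \<open>z\<close>.\<close>

lemma riesz_representation:
  assumes M: "closed_csubspace (M :: 'a::complex_hilbert set)"
    and add: "\<And>x y. x \<in> M \<Longrightarrow> y \<in> M \<Longrightarrow> f (x + y) = f x + f y"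
    and scale: "\<And>a x. x \<in> M \<Longrightarrow> f (a *\<^sub>C x) = a * f x"
    and bound: "\<And>x. x \<in> M \<Longrightarrow> cmod (f x) \<le> C * norm x"
  shows "\<exists>y\<in>M. \<forall>x\<in>M. f x = cinner x y"
proof (cases "\<forall>x\<in>M. f x = 0")
  case True
  then show ?thesis
    using closed_csubspaceD(1)[OF M] by (force simp: cinner.zero_right)
next
  case False
  then obtain w where w: "w \<in> M" "f w \<noteq> 0"
    by blast
  define V where "V = {x\<in>M. f x = 0}"
  have f0: "f 0 = 0"
    using scale[of 0 0] closed_csubspaceD(1)[OF M] by simp
  have diff: "f (x - y) = f x - f y" if "x \<in> M" "y \<in> M" for x y
    using add[of x "(-1) *\<^sub>C y"] scale[of y "-1"] that closed_csubspaceD(4)[OF M, of y "-1"]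
    by (simp add: scaleC_minus_one)
  have V: "closed_csubspace V"
    unfolding closed_csubspace_def
  proof
    show "complex_vector.subspace V"
      by (rule complex_vector.subspaceI) (auto simp: V_def f0 add scale closed_csubspaceD[OF M])
    show "closed V"
      unfolding closed_sequential_limits
    proof (intro allI impI, elim conjE)
      fix x l assume x: "\<forall>n. x n \<in> V" "x \<longlonglongrightarrow> l"
      then have l: "l \<in> M"
        using closed_sequentially[OF closed_csubspaceD(7)[OF M]] by (auto simp: V_def)
      have "cmod (f l) \<le> C * norm (l - x n)" for n
        using bound[of "l - x n"] diff[of l "x n"] x(1) l M by (simp add: V_def closed_csubspaceD)
      moreover have "(\<lambda>n. C * norm (l - x n)) \<longlonglongrightarrow> C * norm (l - l)"
        by (intro tendsto_intros x)
      ultimately have "cmod (f l) \<le> C * norm (l - l)"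
        by (intro LIMSEQ_le_const[where X = "\<lambda>n. C * norm (l - x n)"]) auto
      then show "l \<in> V"
        using l by (simp add: V_def)
    qed
  qed
  define z where "z = w - orth_proj V w"
  have PV: "orth_proj V w \<in> M" "f (orth_proj V w) = 0"
    using orth_proj_mem[OF V, of w] by (simp_all add: V_def)
  have z: "z \<in> M" "f z \<noteq> 0" "\<And>v. v \<in> V \<Longrightarrow> cinner v z = 0"
    using w PV closed_csubspaceD(3)[OF M] orth_complD(2)[OF diff_orth_proj_mem[OF V]]
    by (auto simp: z_def diff)
  then have nz: "z \<noteq> 0"
    using f0 by auto
  define y where "y = cnj (f z / (norm z)\<^sup>2) *\<^sub>C z"
  have "f x = cinner x y" if x: "x \<in> M" for x
  proof -
    \<comment> \<open>This combination is killed by f, so it is orthogonal to \<open>z\<close>, and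
      expanding that relation expresses \<open>f x\<close> through
      \<open>cinner x z\<close>.\<close>
    have "f z *\<^sub>C x - f x *\<^sub>C z \<in> V"
      using x z(1) by (simp add: V_def diff scale closed_csubspaceD[OF M])
    then have "f z * cinner x z = f x * complex_of_real ((norm z)\<^sup>2)"
      using z(3) by (fastforce simp: cinner.diff_left cinner_scaleC_left cinner_self)
    then show ?thesis
      using nz by (simp add: y_def cinner_scaleC_right field_simps)
  qed
  moreover have "y \<in> M"
    using z(1) by (simp add: y_def closed_csubspaceD[OF M])
  ultimately show ?thesis
    by blast
qed

lemma cinner_right_eqI:
  assumes "closed_csubspace M" "y \<in> M" "y' \<in> M" "\<And>x. x \<in> M \<Longrightarrow> cinner x y = cinner x y'"
  shows "y = y'"
proof -
  have "cinner (y - y') (y - y') = 0"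
    using assms(4)[of "y - y'"] closed_csubspaceD(3)[OF assms(1-3)] by (simp add: cinner.diff_right)
  then show ?thesis
    by (simp add: cinner_self)
qed

text \<open>Riesz applied to the functional x -> (T x, y) for each y gives the adjoint. Uniqueness
  has to be shown as well because \<open>adj\<close> is a definite description; restricting to N
  makes the candidate extensional.\<close>

lemma adj_props:
  assumes M: "closed_csubspace M" and N: "closed_csubspace N" and T: "T \<in> bounded_ops M N"
  shows adj_bounded_ops: "adj M N T \<in> bounded_ops N M"
    and cinner_adj: "x \<in> M \<Longrightarrow> y \<in> N \<Longrightarrow> cinner (T x) y = cinner x (adj M N T y)"
    and adj_eqI: "S \<in> bounded_ops N M \<Longrightarrow> (\<And>x y. x \<in> M \<Longrightarrow> y \<in> N \<Longrightarrow> cinner (T x) y = cinner x (S y))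
      \<Longrightarrow> adj M N T = S"
proof -
  obtain C where C: "\<And>x. x \<in> M \<Longrightarrow> norm (T x) \<le> C * norm x"
    using bounded_ops_bound[OF T] by metis
  have "\<exists>z\<in>M. \<forall>x\<in>M. cinner (T x) y = cinner x z" for y
  proof (rule riesz_representation[OF M])
    show "cmod (cinner (T x) y) \<le> (C * norm y) * norm x" if "x \<in> M" for x
      by (rule order_trans[OF norm_cinner_le])
        (use mult_right_mono[OF C[OF that], of "norm y"] in \<open>simp add: mult_ac\<close>)
  qed (simp_all add: bounded_opsD[OF T] cinner_add_left cinner_scaleC_left)
  then obtain s where s: "\<And>y. s y \<in> M" "\<And>x y. x \<in> M \<Longrightarrow> cinner (T x) y = cinner x (s y)"
    by metis
  define S where "S = restrict s N"
  have S: "S \<in> bounded_ops N M"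
  proof (rule bounded_opsI)
    fix x y assume "x \<in> N" "y \<in> N"
    then show "S (x + y) = S x + S y"
      by (intro cinner_right_eqI[OF M])
        (simp_all add: S_def s closed_csubspaceD[OF M] closed_csubspaceD[OF N] cinner_add_right flip: s(2))
  next
    fix a x assume "x \<in> N"
    then show "S (a *\<^sub>C x) = a *\<^sub>C S x"
      by (intro cinner_right_eqI[OF M])
        (simp_all add: S_def s closed_csubspaceD[OF M] closed_csubspaceD[OF N] cinner_scaleC_right flip: s(2))
  next
    fix x assume x: "x \<in> N"
    \<comment> \<open>Boundedness comes from testing the defining relation on \<open>s x\<close>
      itself and cancelling one factor \<open>norm (s x)\<close>.\<close>
    have "(norm (s x))\<^sup>2 = Re (cinner (T (s x)) x)"
      by (simp add: s cinner_self)
    also have "\<dots> \<le> cmod (cinner (T (s x)) x)"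
      by (rule complex_Re_le_cmod)
    also have "\<dots> \<le> C * norm (s x) * norm x"
      by (rule order_trans[OF norm_cinner_le mult_right_mono[OF C[OF s(1)]]]) simp
    finally have "norm (s x) * norm (s x) \<le> norm (s x) * (C * norm x)"
      by (simp add: power2_eq_square mult_ac)
    moreover have "0 \<le> norm (T (s x))" "norm (T (s x)) \<le> C * norm (s x)"
      using C[OF s(1)] by simp_all
    ultimately have "norm (s x) \<le> \<bar>C\<bar> * norm x"
    proof (cases "s x = 0")
      case False
      then have "norm (s x) \<le> C * norm x"
        using \<open>norm (s x) * norm (s x) \<le> _\<close> by simp
      also have "\<dots> \<le> \<bar>C\<bar> * norm x"
        by (intro mult_right_mono) auto
      finally show ?thesis .
    qed simp
    then show "norm (S x) \<le> \<bar>C\<bar> * norm x"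
      using x by (simp add: S_def)
  qed (simp_all add: S_def s)
  have SP: "S \<in> bounded_ops N M \<and> (\<forall>x\<in>M. \<forall>y\<in>N. cinner (T x) y = cinner x (S y))"
    using S s by (simp add: S_def)
  have uniq: "R = S" if "R \<in> bounded_ops N M \<and> (\<forall>x\<in>M. \<forall>y\<in>N. cinner (T x) y = cinner x (R y))" for R
  proof (rule bounded_ops_eqI)
    fix y assume "y \<in> N"
    then show "R y = S y"
      using that SP by (intro cinner_right_eqI[OF M]) (auto simp: bounded_opsD)
  qed (use that SP in auto)
  have eq: "adj M N T = S"
    unfolding adj_def by (rule the_equality) (fact SP, fact uniq)
  show "adj M N T \<in> bounded_ops N M" "x \<in> M \<Longrightarrow> y \<in> N \<Longrightarrow> cinner (T x) y = cinner x (adj M N T y)"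
    using SP eq by auto
  show "R \<in> bounded_ops N M \<Longrightarrow> (\<And>x y. x \<in> M \<Longrightarrow> y \<in> N \<Longrightarrow> cinner (T x) y = cinner x (R y))
      \<Longrightarrow> adj M N T = R" for R
    using eq uniq by auto
qed

section \<open>Positive operators and their square roots\<close>

definition symmetric_on :: "'a::complex_hilbert set \<Rightarrow> ('a \<Rightarrow> 'a) \<Rightarrow> bool" where
  "symmetric_on M A \<longleftrightarrow> (\<forall>x\<in>M. \<forall>y\<in>M. cinner (A x) y = cinner x (A y))"

lemma symmetric_onD: "symmetric_on M A \<Longrightarrow> x \<in> M \<Longrightarrow> y \<in> M \<Longrightarrow> cinner (A x) y = cinner x (A y)"
  by (simp add: symmetric_on_def)

lemma self_adjoint_op_iff:
  assumes M: "closed_csubspace M"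
  shows "self_adjoint_op M A \<longleftrightarrow> A \<in> bounded_ops M M \<and> symmetric_on M A"
proof
  assume "self_adjoint_op M A"
  then show "A \<in> bounded_ops M M \<and> symmetric_on M A"
    using cinner_adj[OF M M, of A] by (auto simp: self_adjoint_op_def symmetric_on_def)
next
  assume "A \<in> bounded_ops M M \<and> symmetric_on M A"
  then show "self_adjoint_op M A"
    using adj_eqI[OF M M, of A A] by (auto simp: self_adjoint_op_def symmetric_on_def)
qed

text \<open>Polarization: reality of the form at x + y relates the imaginary parts of (A x, y) and
  (A y, x), reality at x + i y their real parts.\<close>

lemma symmetric_on_if_real:
  assumes M: "closed_csubspace M" and A: "A \<in> bounded_ops M M"
    and re: "\<And>x. x \<in> M \<Longrightarrow> Im (cinner (A x) x) = 0"
  shows "symmetric_on M A"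
  unfolding symmetric_on_def
proof (intro ballI)
  fix x y assume xy: "x \<in> M" "y \<in> M"
  then have iy: "\<i> *\<^sub>C y \<in> M"
    by (simp add: closed_csubspaceD[OF M])
  have "Im (cinner (A x) y + cinner (A y) x) = 0"
    using re[of "x + y"] re[of x] re[of y] xy
    by (simp add: bounded_opsD[OF A] closed_csubspaceD[OF M] cinner_add_left cinner_add_right)
  moreover have "Im (cinner (A x) (\<i> *\<^sub>C y) + cinner (A (\<i> *\<^sub>C y)) x) = 0"
    using re[of "x + \<i> *\<^sub>C y"] re[of x] re[of "\<i> *\<^sub>C y"] xy iy
    by (simp add: bounded_opsD(2)[OF A] closed_csubspaceD[OF M] cinner_add_left cinner_add_right)
  ultimately have "cinner (A x) y = cnj (cinner (A y) x)"
    using xy by (simp add: complex_eq_iff bounded_opsD[OF A] cinner_scaleC_left cinner_scaleC_right)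
  then show "cinner (A x) y = cinner x (A y)"
    by (simp flip: cinner_commute)
qed

lemma positive_op_iff:
  assumes M: "closed_csubspace M"
  shows "positive_op M A \<longleftrightarrow> A \<in> bounded_ops M M \<and> symmetric_on M A \<and> (\<forall>x\<in>M. 0 \<le> inner (A x) x)"
proof
  assume L: "positive_op M A"
  then have *: "A \<in> bounded_ops M M" "\<And>x. x \<in> M \<Longrightarrow> Im (cinner (A x) x) = 0"
    "\<And>x. x \<in> M \<Longrightarrow> 0 \<le> Re (cinner (A x) x)"
    by (auto simp: positive_op_def complex_nonneg_Reals_iff)
  then show "A \<in> bounded_ops M M \<and> symmetric_on M A \<and> (\<forall>x\<in>M. 0 \<le> inner (A x) x)"
    using symmetric_on_if_real[OF M] by (auto simp: inner_eq_Re_cinner)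
next
  assume R: "A \<in> bounded_ops M M \<and> symmetric_on M A \<and> (\<forall>x\<in>M. 0 \<le> inner (A x) x)"
  have "Im (cinner (A x) x) = 0" if "x \<in> M" for x
    using symmetric_onD[of M A x x] cinner_commute[of "A x" x] R that
    by (metis Im_complex_of_real Reals_cnj_iff complex_is_Real_iff)
  then show "positive_op M A"
    using R by (auto simp: positive_op_def complex_nonneg_Reals_iff inner_eq_Re_cinner)
qed

lemma positive_opD:
  assumes "positive_op M A" "closed_csubspace M"
  shows "A \<in> bounded_ops M M" "symmetric_on M A" "x \<in> M \<Longrightarrow> 0 \<le> inner (A x) x"
    "x \<in> M \<Longrightarrow> y \<in> M \<Longrightarrow> inner (A x) y = inner x (A y)"
  using assms(1) unfolding positive_op_iff[OF assms(2)] by (auto simp: inner_eq_Re_cinner symmetric_on_def)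

section \<open>Cauchy-Schwarz for positive forms\<close>

lemma quadratic_nonneg_imp_discriminant:
  fixes a b c :: real
  assumes "\<And>t. 0 \<le> a + 2 * b * t + c * t\<^sup>2"
  shows "b\<^sup>2 \<le> a * c"
proof -
  have a: "0 \<le> a"
    using assms[of 0] by simp
  consider "0 < c" | "c = 0" "b = 0" | "c = 0" "b \<noteq> 0" | "c < 0"
    by linarith
  then show ?thesis
  proof cases
    case 1
    then show ?thesis
      using assms[of "- b / c"] by (simp add: field_simps power2_eq_square)
  next
    case 3
    then show ?thesis
      \<comment> \<open>With c = 0 the polynomial is affine, and at this point its value is
        -1.\<close>
      using assms[of "- (a + 1) / (2 * b)"] by (simp add: field_simps)
  next
    case 4
    \<comment> \<open>Adding the values at t and -t removes the linear term; this t is large enough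
      for the negative quadratic term to win.\<close>
    define t where "t = (1 + \<bar>b\<bar> + a) / (- c) + 1"
    have t: "t \<ge> 1" "(- c) * t \<ge> 1 + \<bar>b\<bar> + a"
      using 4 a by (auto simp: t_def field_simps)
    have "0 \<le> a + 2 * b * t + c * t\<^sup>2" "0 \<le> a + 2 * b * (- t) + c * (- t)\<^sup>2"
      by (rule assms)+
    then have "(- c) * t * t \<le> a"
      by (simp add: power2_eq_square)
    moreover have "(1 + \<bar>b\<bar> + a) * 1 \<le> (- c) * t * t"
      using t a by (intro mult_mono) auto
    ultimately show ?thesis
      by simp
  qed simp
qed

text \<open>Formulated for a bare real-linear map on M rather than for \<open>positive_op\<close>,
  since it is also applied to shifted squares and to \<mu> - A, which are written as plain functions
  and not made extensional.\<close>

lemma psd_props: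
  fixes Q :: "'a::complex_hilbert \<Rightarrow> 'a"
  assumes M: "closed_csubspace M" and QM: "\<And>x. x \<in> M \<Longrightarrow> Q x \<in> M"
    and lin: "\<And>x y t. x \<in> M \<Longrightarrow> y \<in> M \<Longrightarrow> Q (x + t *\<^sub>R y) = Q x + t *\<^sub>R Q y"
    and sym: "\<And>x y. x \<in> M \<Longrightarrow> y \<in> M \<Longrightarrow> inner (Q x) y = inner x (Q y)"
    and pos: "\<And>x. x \<in> M \<Longrightarrow> 0 \<le> inner (Q x) x"
  shows psd_cauchy_schwarz: "x \<in> M \<Longrightarrow> y \<in> M \<Longrightarrow> (inner (Q x) y)\<^sup>2 \<le> inner (Q x) x * inner (Q y) y"
    and psd_norm_le: "(\<And>x. x \<in> M \<Longrightarrow> norm (Q x) \<le> c * norm x) \<Longrightarrow> x \<in> M \<Longrightarrow> (norm (Q x))\<^sup>2 \<le> c * inner (Q x) x"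
proof -
  show cs: "(inner (Q x) y)\<^sup>2 \<le> inner (Q x) x * inner (Q y) y" if "x \<in> M" "y \<in> M" for x y
  proof (rule quadratic_nonneg_imp_discriminant)
    fix t
    have "0 \<le> inner (Q (x + t *\<^sub>R y)) (x + t *\<^sub>R y)"
      using that by (intro pos) (simp add: closed_csubspaceD[OF M])
    also have "\<dots> = inner (Q x) x + 2 * inner (Q x) y * t + inner (Q y) y * t\<^sup>2"
      using that sym[of y x]
      by (simp add: lin inner_add_left inner_add_right power2_eq_square algebra_simps inner_commute)
    finally show "0 \<le> \<dots>" .
  qed
  assume c: "\<And>x. x \<in> M \<Longrightarrow> norm (Q x) \<le> c * norm x" and x: "x \<in> M"
  show "(norm (Q x))\<^sup>2 \<le> c * inner (Q x) x"
  proof (cases "Q x = 0")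
    case False
    \<comment> \<open>Cauchy-Schwarz for the form with second argument \<open>Q x\<close> bounds |Q
      x|^4 by (Q x, x) (Q Q x, Q x); the last factor is at most c |Q x|^2, and one square
      cancels.\<close>
    have "inner (Q (Q x)) (Q x) \<le> norm (Q (Q x)) * norm (Q x)"
      by (rule norm_cauchy_schwarz)
    also have "\<dots> \<le> c * (norm (Q x))\<^sup>2"
      using mult_right_mono[OF c[OF QM[OF x]], of "norm (Q x)"] by (simp add: power2_eq_square mult_ac)
    finally have "inner (Q x) x * inner (Q (Q x)) (Q x) \<le> inner (Q x) x * (c * (norm (Q x))\<^sup>2)"
      using pos[OF x] by (rule mult_left_mono)
    moreover have "(norm (Q x))\<^sup>2 * (norm (Q x))\<^sup>2 \<le> inner (Q x) x * inner (Q (Q x)) (Q x)"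
      using cs[OF x QM[OF x]] by (simp add: power2_eq_square dot_square_norm)
    ultimately have "(norm (Q x))\<^sup>2 * (norm (Q x))\<^sup>2 \<le> (c * inner (Q x) x) * (norm (Q x))\<^sup>2"
      by (simp add: mult_ac)
    then show ?thesis
      by (rule mult_right_le_imp_le) (use False in simp)
  qed simp
qed

lemma positive_op_norm_sq_le:
  assumes M: "closed_csubspace M" and A: "positive_op M A"
    and "\<And>x. x \<in> M \<Longrightarrow> norm (A x) \<le> c * norm x" "x \<in> M"
  shows "(norm (A x))\<^sup>2 \<le> c * inner (A x) x"
  using psd_norm_le[OF M, where Q = A and c = c and x = x] bounded_opsD[OF positive_opD(1)[OF A M]]
    positive_opD[OF A M] closed_csubspaceD[OF M] assms(3,4) by simp

section \<open>The positive square root\<close>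

text \<open>
  The square root is \<open>sqrt b (1 - X)\<close>, where X solves \<open>2 X = C + X\<^sup>2\<close> for the contraction
  \<open>C = 1 - B / b\<close>. The iterates \<open>X n\<close> are dominated in norm by the same iteration started from
  the scalar 1 in place of C, which converges.
\<close>

primrec sqrt_iter :: "('a::complex_hilbert \<Rightarrow> 'a) \<Rightarrow> nat \<Rightarrow> 'a \<Rightarrow> 'a" where
  "sqrt_iter C 0 x = 0"
| "sqrt_iter C (Suc n) x = (1/2) *\<^sub>R (C x + sqrt_iter C n (sqrt_iter C n x))"

primrec sqrt_iter_bound :: "nat \<Rightarrow> real" where
  "sqrt_iter_bound 0 = 0"
| "sqrt_iter_bound (Suc n) = (1 + (sqrt_iter_bound n)\<^sup>2) / 2"

lemma sqrt_iter_bound_range: "0 \<le> sqrt_iter_bound n" "sqrt_iter_bound n \<le> 1"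
proof -
  have "0 \<le> sqrt_iter_bound n \<and> sqrt_iter_bound n \<le> 1"
    by (induction n) (auto simp: power_le_one)
  then show "0 \<le> sqrt_iter_bound n" "sqrt_iter_bound n \<le> 1"
    by auto
qed

lemma incseq_sqrt_iter_bound: "incseq sqrt_iter_bound"
proof (rule incseq_SucI)
  show "sqrt_iter_bound n \<le> sqrt_iter_bound (Suc n)" for n
    using zero_le_power2[of "1 - sqrt_iter_bound n"] by (simp add: power2_eq_square algebra_simps)
qed

context
  fixes M :: "'a::complex_hilbert set" and C :: "'a \<Rightarrow> 'a"
  assumes M: "closed_csubspace M" and C: "C \<in> bounded_ops M M" and C_le: "\<forall>x\<in>M. norm (C x) \<le> norm x"
begin

lemma sqrt_iter_mem: "x \<in> M \<Longrightarrow> sqrt_iter C n x \<in> M"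
  by (induction n arbitrary: x) (simp_all add: closed_csubspaceD[OF M] bounded_opsD[OF C])

lemma sqrt_iter_add: "x \<in> M \<Longrightarrow> y \<in> M \<Longrightarrow> sqrt_iter C n (x + y) = sqrt_iter C n x + sqrt_iter C n y"
  by (induction n arbitrary: x y)
    (simp_all add: bounded_opsD[OF C] sqrt_iter_mem scaleR_add_right)

lemma sqrt_iter_scaleC: "x \<in> M \<Longrightarrow> sqrt_iter C n (a *\<^sub>C x) = a *\<^sub>C sqrt_iter C n x"
  by (induction n arbitrary: x)
    (simp_all add: bounded_opsD[OF C] sqrt_iter_mem scaleC_add_right scaleR_scaleC scaleC_scaleC mult.commute)

lemma sqrt_iter_norm_le: "x \<in> M \<Longrightarrow> norm (sqrt_iter C n x) \<le> sqrt_iter_bound n * norm x"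
proof (induction n arbitrary: x)
  case (Suc n)
  have "norm (sqrt_iter C n (sqrt_iter C n x)) \<le> sqrt_iter_bound n * norm (sqrt_iter C n x)"
    by (rule Suc.IH[OF sqrt_iter_mem[OF Suc.prems]])
  also have "\<dots> \<le> sqrt_iter_bound n * (sqrt_iter_bound n * norm x)"
    by (intro mult_left_mono Suc sqrt_iter_bound_range)
  finally have le: "norm (C x + sqrt_iter C n (sqrt_iter C n x)) \<le> norm x + (sqrt_iter_bound n)\<^sup>2 * norm x"
    using bspec[OF C_le Suc.prems] by (intro order_trans[OF norm_triangle_ineq]) (simp add: power2_eq_square mult.assoc)
  have "norm (sqrt_iter C (Suc n) x) = norm (C x + sqrt_iter C n (sqrt_iter C n x)) / 2"
    by simp
  also have "\<dots> \<le> (norm x + (sqrt_iter_bound n)\<^sup>2 * norm x) / 2"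
    by (rule divide_right_mono[OF le]) simp
  also have "\<dots> = sqrt_iter_bound (Suc n) * norm x"
    by (simp add: field_simps)
  finally show ?case .
qed simp

lemma sqrt_iter_diff: "x \<in> M \<Longrightarrow> y \<in> M \<Longrightarrow> sqrt_iter C n (x - y) = sqrt_iter C n x - sqrt_iter C n y"
  using sqrt_iter_add[of x "(-1) *\<^sub>C y" n] sqrt_iter_scaleC[of y n "-1"] closed_csubspaceD(4)[OF M, of y "-1"]
  by (simp add: scaleC_minus_one)

text \<open>For consecutive iterates X and Y one has X X - Y Y = X (X - Y) + (X - Y) Y without any
  commutation. With scalar bounds u and v the two terms add up to u^2 - v^2, twice the next scalar
  increment.\<close>

lemma sqrt_iter_step:
  "x \<in> M \<Longrightarrow> norm (sqrt_iter C (Suc n) x - sqrt_iter C n x)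
     \<le> (sqrt_iter_bound (Suc n) - sqrt_iter_bound n) * norm x"
proof (induction n arbitrary: x)
  case 0
  then show ?case
    using bspec[OF C_le, of x] by simp
next
  case (Suc n)
  let ?X = "sqrt_iter C (Suc n)" and ?Y = "sqrt_iter C n"
  let ?u = "sqrt_iter_bound (Suc n)" and ?v = "sqrt_iter_bound n"
  have u: "0 \<le> ?u" "0 \<le> ?v" "0 \<le> ?u - ?v"
    using incseq_SucD[OF incseq_sqrt_iter_bound, of n] sqrt_iter_bound_range by auto
  note mem = sqrt_iter_mem[OF Suc.prems]
  have dM: "?X x - ?Y x \<in> M"
    by (intro closed_csubspaceD(3)[OF M] mem)
  have "norm (?X (?X x - ?Y x)) \<le> ?u * norm (?X x - ?Y x)"
    by (rule sqrt_iter_norm_le[OF dM])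
  also have "\<dots> \<le> ?u * ((?u - ?v) * norm x)"
    by (rule mult_left_mono[OF Suc.IH[OF Suc.prems] u(1)])
  finally have 1: "norm (?X (?X x) - ?X (?Y x)) \<le> ?u * (?u - ?v) * norm x"
    by (simp only: sqrt_iter_diff[OF mem mem] mult.assoc)
  have "norm (?X (?Y x) - ?Y (?Y x)) \<le> (?u - ?v) * norm (?Y x)"
    by (rule Suc.IH[OF mem])
  also have "\<dots> \<le> (?u - ?v) * (?v * norm x)"
    by (rule mult_left_mono[OF sqrt_iter_norm_le[OF Suc.prems] u(3)])
  finally have 2: "norm (?X (?Y x) - ?Y (?Y x)) \<le> (?u - ?v) * ?v * norm x"
    by (simp only: mult.assoc)
  have "norm (?X (?X x) - ?Y (?Y x)) \<le> norm (?X (?X x) - ?X (?Y x)) + norm (?X (?Y x) - ?Y (?Y x))"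
    by (rule norm_diff_triangle_le[OF order_refl order_refl])
  also have "\<dots> \<le> (?u\<^sup>2 - ?v\<^sup>2) * norm x"
    using 1 2 by (simp add: power2_eq_square algebra_simps del: sqrt_iter.simps sqrt_iter_bound.simps)
  finally have "norm ((1/2) *\<^sub>R (?X (?X x) - ?Y (?Y x))) \<le> (?u\<^sup>2 - ?v\<^sup>2) / 2 * norm x"
    by (simp del: sqrt_iter.simps sqrt_iter_bound.simps)
  moreover have "sqrt_iter C (Suc (Suc n)) x - ?X x = (1/2) *\<^sub>R (?X (?X x) - ?Y (?Y x))"
    unfolding sqrt_iter.simps(2)[of C "Suc n"] sqrt_iter.simps(2)[of C n x] by (simp add: algebra_simps)
  moreover have "sqrt_iter_bound (Suc (Suc n)) - ?u = (?u\<^sup>2 - ?v\<^sup>2) / 2"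
    unfolding sqrt_iter_bound.simps(2)[of "Suc n"] sqrt_iter_bound.simps(2)[of n] by (simp add: field_simps)
  ultimately show ?case
    by (simp only:)
qed

lemma sqrt_iter_cauchy:
  "x \<in> M \<Longrightarrow> norm (sqrt_iter C (m + n) x - sqrt_iter C m x)
     \<le> (sqrt_iter_bound (m + n) - sqrt_iter_bound m) * norm x"
proof (induction n)
  case (Suc n)
  have "norm (sqrt_iter C (m + Suc n) x - sqrt_iter C m x) \<le>
      norm (sqrt_iter C (Suc (m + n)) x - sqrt_iter C (m + n) x) + norm (sqrt_iter C (m + n) x - sqrt_iter C m x)"
    using norm_triangle_ineq[of "sqrt_iter C (Suc (m + n)) x - sqrt_iter C (m + n) x"
      "sqrt_iter C (m + n) x - sqrt_iter C m x"] by (simp del: sqrt_iter.simps)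
  also have "\<dots> \<le> (sqrt_iter_bound (m + Suc n) - sqrt_iter_bound m) * norm x"
    using Suc.IH[OF Suc.prems] sqrt_iter_step[OF Suc.prems, of "m + n"]
    by (simp add: algebra_simps del: sqrt_iter.simps sqrt_iter_bound.simps)
  finally show ?case .
qed simp

lemma sqrt_iter_convergent: "x \<in> M \<Longrightarrow> convergent (\<lambda>n. sqrt_iter C n x)"
proof -
  assume x: "x \<in> M"
  have "convergent sqrt_iter_bound"
    by (intro Bseq_mono_convergent BseqI'[where K = 1])
      (use sqrt_iter_bound_range in \<open>auto intro: incseqD[OF incseq_sqrt_iter_bound]\<close>)
  then have u: "Cauchy sqrt_iter_bound"
    by (rule convergent_Cauchy)
  have "Cauchy (\<lambda>n. sqrt_iter C n x)"
  proof (rule CauchyI')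
    fix e :: real assume e: "0 < e"
    have "0 < e / (norm x + 1)"
      using e by (intro divide_pos_pos) (auto simp: add_nonneg_pos)
    then obtain N where N: "\<And>m n. m \<ge> N \<Longrightarrow> n \<ge> N \<Longrightarrow> norm (sqrt_iter_bound m - sqrt_iter_bound n) < e / (norm x + 1)"
      using CauchyD[OF u] by metis
    have "dist (sqrt_iter C m x) (sqrt_iter C n x) < e" if mn: "m \<ge> N" "n > m" for m n
    proof -
      have "norm (sqrt_iter C n x - sqrt_iter C m x) \<le> (sqrt_iter_bound n - sqrt_iter_bound m) * norm x"
        using sqrt_iter_cauchy[OF x, of m "n - m"] mn by simp
      also have "\<dots> \<le> e / (norm x + 1) * norm x"
        using N[of n m] mn by (intro mult_right_mono) auto
      also have "\<dots> < e"
        using e norm_ge_zero[of x] by (simp add: pos_divide_less_eq add_nonneg_pos distrib_left)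
      finally show ?thesis
        by (simp add: dist_norm norm_minus_commute)
    qed
    then show "\<exists>M. \<forall>m\<ge>M. \<forall>n>m. dist (sqrt_iter C m x) (sqrt_iter C n x) < e"
      by blast
  qed
  then show ?thesis
    by (rule Cauchy_convergent)
qed

lemma sqrt_iter_symmetric: "symmetric_on M C \<Longrightarrow> symmetric_on M (sqrt_iter C n)"
proof (induction n)
  case (Suc n)
  then have "symmetric_on M (sqrt_iter C n)"
    by simp
  then show ?case
    using Suc.prems by (simp add: symmetric_on_def sqrt_iter_mem scaleR_scaleC cinner_scaleC_left
      cinner_scaleC_right cinner_add_left cinner_add_right)
qed (simp add: symmetric_on_def cinner.zero_left cinner.zero_right)

lemma sqrt_iter_commute:
  assumes S: "S \<in> bounded_ops M M" "\<And>x. x \<in> M \<Longrightarrow> S (C x) = C (S x)"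
  shows "x \<in> M \<Longrightarrow> S (sqrt_iter C n x) = sqrt_iter C n (S x)"
  by (induction n arbitrary: x)
    (simp_all add: bounded_ops_0[OF S(1) M] bounded_opsD[OF S(1)] bounded_opsD(1)[OF C] sqrt_iter_mem S(2)
      closed_csubspaceD[OF M])

definition sqrt_iter_lim :: "'a \<Rightarrow> 'a" where
  "sqrt_iter_lim = (\<lambda>x\<in>M. lim (\<lambda>n. sqrt_iter C n x))"

lemma sqrt_iter_tendsto: "x \<in> M \<Longrightarrow> (\<lambda>n. sqrt_iter C n x) \<longlonglongrightarrow> sqrt_iter_lim x"
  using sqrt_iter_convergent by (simp add: sqrt_iter_lim_def convergent_LIMSEQ_iff)

lemma sqrt_iter_lim_norm_le: "x \<in> M \<Longrightarrow> norm (sqrt_iter_lim x) \<le> norm x"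
proof (rule LIMSEQ_le_const2)
  assume x: "x \<in> M"
  show "(\<lambda>n. norm (sqrt_iter C n x)) \<longlonglongrightarrow> norm (sqrt_iter_lim x)"
    by (intro tendsto_norm sqrt_iter_tendsto x)
  have "norm (sqrt_iter C n x) \<le> norm x" for n
    using sqrt_iter_norm_le[OF x, of n] mult_right_mono[OF sqrt_iter_bound_range(2)[of n], of "norm x"] by simp
  then show "\<exists>N. \<forall>n\<ge>N. norm (sqrt_iter C n x) \<le> norm x"
    by blast
qed

lemma sqrt_iter_lim_bounded_ops: "sqrt_iter_lim \<in> bounded_ops M M"
proof (rule bounded_opsI[where C = 1])
  fix x assume x: "x \<in> M"
  show "sqrt_iter_lim x \<in> M"
    by (rule closed_sequentially[OF closed_csubspaceD(7)[OF M] sqrt_iter_mem[OF x] sqrt_iter_tendsto[OF x]])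
  show "norm (sqrt_iter_lim x) \<le> 1 * norm x"
    by (simp add: sqrt_iter_lim_norm_le x)
  fix a
  have "a *\<^sub>C x \<in> M"
    by (simp add: closed_csubspaceD[OF M] x)
  from sqrt_iter_tendsto[OF this] have "(\<lambda>n. a *\<^sub>C sqrt_iter C n x) \<longlonglongrightarrow> sqrt_iter_lim (a *\<^sub>C x)"
    by (simp add: sqrt_iter_scaleC x)
  moreover have "(\<lambda>n. a *\<^sub>C sqrt_iter C n x) \<longlonglongrightarrow> a *\<^sub>C sqrt_iter_lim x"
    by (intro scaleC.tendsto tendsto_const sqrt_iter_tendsto x)
  ultimately show "sqrt_iter_lim (a *\<^sub>C x) = a *\<^sub>C sqrt_iter_lim x"
    by (rule LIMSEQ_unique)
next
  fix x y assume xy: "x \<in> M" "y \<in> M"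
  then have "x + y \<in> M"
    by (simp add: closed_csubspaceD[OF M])
  from sqrt_iter_tendsto[OF this] have "(\<lambda>n. sqrt_iter C n x + sqrt_iter C n y) \<longlonglongrightarrow> sqrt_iter_lim (x + y)"
    by (simp add: sqrt_iter_add xy)
  moreover have "(\<lambda>n. sqrt_iter C n x + sqrt_iter C n y) \<longlonglongrightarrow> sqrt_iter_lim x + sqrt_iter_lim y"
    by (intro tendsto_add sqrt_iter_tendsto xy)
  ultimately show "sqrt_iter_lim (x + y) = sqrt_iter_lim x + sqrt_iter_lim y"
    by (rule LIMSEQ_unique)
qed (simp add: sqrt_iter_lim_def)

lemma sqrt_iter_lim_fixpoint:
  assumes x: "x \<in> M"
  shows "2 *\<^sub>R sqrt_iter_lim x = C x + sqrt_iter_lim (sqrt_iter_lim x)"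
proof -
  let ?X = "sqrt_iter_lim"
  have Xx: "?X x \<in> M"
    by (rule bounded_opsD(1)[OF sqrt_iter_lim_bounded_ops x])
  \<comment> \<open>The n-th iterate occurs both outside and inside. As all iterates are
    contractions, the inner one may be replaced by its limit.\<close>
  have "(\<lambda>n. sqrt_iter C n (sqrt_iter C n x - ?X x)) \<longlonglongrightarrow> 0"
  proof (rule Lim_null_comparison[OF always_eventually])
    show "\<forall>n. norm (sqrt_iter C n (sqrt_iter C n x - ?X x)) \<le> norm (sqrt_iter C n x - ?X x)"
    proof
      fix n
      have "sqrt_iter C n x - ?X x \<in> M"
        by (intro closed_csubspaceD(3)[OF M] sqrt_iter_mem x Xx)
      from sqrt_iter_norm_le[OF this, of n] mult_right_mono[OF sqrt_iter_bound_range(2)[of n] norm_ge_zero]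
      show "norm (sqrt_iter C n (sqrt_iter C n x - ?X x)) \<le> norm (sqrt_iter C n x - ?X x)"
        by (metis mult_1 order_trans)
    qed
    show "(\<lambda>n. norm (sqrt_iter C n x - ?X x)) \<longlonglongrightarrow> 0"
      using sqrt_iter_tendsto[OF x] by (simp add: LIM_zero tendsto_norm_zero)
  qed
  from tendsto_add[OF this sqrt_iter_tendsto[OF Xx]]
  have "(\<lambda>n. sqrt_iter C n (sqrt_iter C n x)) \<longlonglongrightarrow> ?X (?X x)"
    by (simp add: sqrt_iter_diff sqrt_iter_mem x Xx)
  then have "(\<lambda>n. (1/2) *\<^sub>R (C x + sqrt_iter C n (sqrt_iter C n x))) \<longlonglongrightarrow> (1/2) *\<^sub>R (C x + ?X (?X x))"
    by (intro tendsto_intros)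
  then have "(\<lambda>n. sqrt_iter C (Suc n) x) \<longlonglongrightarrow> (1/2) *\<^sub>R (C x + ?X (?X x))"
    by simp
  moreover have "(\<lambda>n. sqrt_iter C (Suc n) x) \<longlonglongrightarrow> ?X x"
    by (rule LIMSEQ_Suc[OF sqrt_iter_tendsto[OF x]])
  ultimately have "?X x = (1/2) *\<^sub>R (C x + ?X (?X x))"
    by (rule LIMSEQ_unique[rotated])
  then show ?thesis
    by (metis scaleR_half_double scaleR_2 scaleR_add_right)
qed

lemma sqrt_iter_lim_symmetric:
  assumes "symmetric_on M C"
  shows "symmetric_on M sqrt_iter_lim"
  unfolding symmetric_on_def
proof (intro ballI)
  fix x y assume xy: "x \<in> M" "y \<in> M"
  have "(\<lambda>n. cinner (sqrt_iter C n x) y) \<longlonglongrightarrow> cinner (sqrt_iter_lim x) y"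
    by (intro cinner.tendsto sqrt_iter_tendsto xy tendsto_const)
  moreover have "(\<lambda>n. cinner x (sqrt_iter C n y)) \<longlonglongrightarrow> cinner x (sqrt_iter_lim y)"
    by (intro cinner.tendsto sqrt_iter_tendsto xy tendsto_const)
  ultimately show "cinner (sqrt_iter_lim x) y = cinner x (sqrt_iter_lim y)"
    using symmetric_onD[OF sqrt_iter_symmetric[OF assms] xy] by (simp add: LIMSEQ_unique)
qed

text \<open>Commutation with C survives the limit by continuity of S; the uniqueness of the positive
  root rests on this.\<close>

lemma sqrt_iter_lim_commute:
  assumes S: "S \<in> bounded_ops M M" "\<And>x. x \<in> M \<Longrightarrow> S (C x) = C (S x)" and x: "x \<in> M"
  shows "S (sqrt_iter_lim x) = sqrt_iter_lim (S x)"
proof -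
  have "(\<lambda>n. S (sqrt_iter C n x)) \<longlonglongrightarrow> S (sqrt_iter_lim x)"
    by (rule bounded_ops_tendsto[OF S(1) M sqrt_iter_mem[OF x] sqrt_iter_tendsto[OF x]])
  then show ?thesis
    using sqrt_iter_tendsto[OF bounded_opsD(1)[OF S(1) x]]
    by (simp add: sqrt_iter_commute[OF S x] LIMSEQ_unique)
qed

end

text \<open>The last conjunct says that R commutes with everything commuting with B. It serves to
  compare R with another positive root of B.\<close>

lemma positive_sqrt_exists:
  assumes M: "closed_csubspace M" and B: "positive_op M B"
  shows "\<exists>R. positive_op M R \<and> (\<forall>x\<in>M. R (R x) = B x) \<and>
    (\<forall>S\<in>bounded_ops M M. (\<forall>x\<in>M. S (B x) = B (S x)) \<longrightarrow> (\<forall>x\<in>M. S (R x) = R (S x)))"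
proof -
  note Bb = positive_opD(1)[OF B M]
  obtain b where b: "0 < b" "\<And>x. x \<in> M \<Longrightarrow> norm (B x) \<le> b * norm x"
    using bounded_ops_bound[OF Bb] by metis
  define C where "C = (\<lambda>x\<in>M. x - (1/b) *\<^sub>R B x)"
  have C_le: "\<forall>x\<in>M. norm (C x) \<le> norm x"
  proof
    fix x assume x: "x \<in> M"
    \<comment> \<open>In the expansion of |b x - B x|^2 this bound lets the cross term outweigh |B
      x|^2, so 1 - B / b is a contraction.\<close>
    have "(norm (B x))\<^sup>2 \<le> b * inner (B x) x"
      by (rule positive_op_norm_sq_le[OF M B b(2) x])
    moreover have "0 \<le> b * inner (B x) x"
      by (intro mult_nonneg_nonneg positive_opD(3)[OF B M x] less_imp_le[OF b(1)])
    moreover have "(norm (b *\<^sub>R x - B x))\<^sup>2 = (norm (b *\<^sub>R x))\<^sup>2 - 2 * (b * inner (B x) x) + (norm (B x))\<^sup>2"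
      unfolding norm_diff_cinner inner_eq_Re_cinner[symmetric] inner_scaleR_left by (simp only: inner_commute)
    ultimately have "(norm (b *\<^sub>R x - B x))\<^sup>2 \<le> (norm (b *\<^sub>R x))\<^sup>2"
      by linarith
    then have "norm (b *\<^sub>R x - B x) \<le> norm (b *\<^sub>R x)"
      by (rule power2_le_imp_le) simp
    moreover have "C x = (1/b) *\<^sub>R (b *\<^sub>R x - B x)"
      using x b(1) by (simp add: C_def scaleR_diff_right)
    ultimately show "norm (C x) \<le> norm x"
      using b(1) by (simp add: divide_le_eq mult.commute)
  qed
  have Cb: "C \<in> bounded_ops M M"
  proof (rule bounded_opsI[where C = 1])
    show "norm (C x) \<le> 1 * norm x" if "x \<in> M" for x
      using C_le that by simp
    show "C (x + y) = C x + C y" if "x \<in> M" "y \<in> M" for x y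
      using that by (simp add: C_def closed_csubspaceD[OF M] bounded_opsD[OF Bb] algebra_simps)
    show "C (a *\<^sub>C x) = a *\<^sub>C C x" if "x \<in> M" for a x
      using that
      by (simp add: C_def closed_csubspaceD[OF M] bounded_opsD(3)[OF Bb] scaleC.diff_right scaleC.scaleR_right)
    show "C x \<in> M" if "x \<in> M" for x
      unfolding C_def restrict_apply'[OF that] by (intro closed_csubspaceD(3,5)[OF M] bounded_opsD(1)[OF Bb] that)
    show "C x = undefined" if "x \<notin> M" for x
      unfolding C_def using that by (rule restrict_apply[THEN trans, OF if_not_P])
  qed
  have Csym: "symmetric_on M C"
    using positive_opD(2)[OF B M]
    by (simp add: symmetric_on_def C_def cinner.diff_left cinner.diff_right cinner.scaleR_left cinner.scaleR_right)
  define X where "X = sqrt_iter_lim M C"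
  note X_b = sqrt_iter_lim_bounded_ops[OF M Cb C_le, folded X_def]
  note X_le = sqrt_iter_lim_norm_le[OF M Cb C_le, folded X_def]
  note X_sym = sqrt_iter_lim_symmetric[OF M Cb C_le Csym, folded X_def]
  note X_fix = sqrt_iter_lim_fixpoint[OF M Cb C_le, folded X_def]
  note X_comm = sqrt_iter_lim_commute[OF M Cb C_le, folded X_def]
  define R where "R = (\<lambda>x\<in>M. sqrt b *\<^sub>R (x - X x))"
  have Rb: "R \<in> bounded_ops M M"
  proof (rule bounded_opsI[where C = "sqrt b * 2"])
    fix x assume x: "x \<in> M"
    show "norm (R x) \<le> sqrt b * 2 * norm x"
      using norm_triangle_ineq4[of x "X x"] X_le[OF x] b(1) x by (simp add: R_def)
    show "R (a *\<^sub>C x) = a *\<^sub>C R x" for a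
      using x by (simp add: R_def closed_csubspaceD[OF M] bounded_opsD(3)[OF X_b] scaleC.diff_right scaleC.scaleR_right)
  next
    show "R (x + y) = R x + R y" if "x \<in> M" "y \<in> M" for x y
      using that by (simp add: R_def closed_csubspaceD[OF M] bounded_opsD[OF X_b] algebra_simps)
    show "R x \<in> M" if "x \<in> M" for x
      unfolding R_def restrict_apply'[OF that] by (intro closed_csubspaceD(3,5)[OF M] bounded_opsD(1)[OF X_b] that)
    show "R x = undefined" if "x \<notin> M" for x
      unfolding R_def using that by (rule restrict_apply[THEN trans, OF if_not_P])
  qed
  have "positive_op M R"
    unfolding positive_op_iff[OF M]
  proof (intro conjI Rb ballI)
    show "symmetric_on M R"
      using X_sym
      by (simp add: symmetric_on_def R_def cinner.diff_left cinner.diff_right cinner.scaleR_left cinner.scaleR_right)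
    fix x assume x: "x \<in> M"
    have "inner (X x) x \<le> norm (X x) * norm x"
      by (rule norm_cauchy_schwarz)
    also have "\<dots> \<le> (norm x)\<^sup>2"
      using mult_right_mono[OF X_le[OF x], of "norm x"] by (simp add: power2_eq_square)
    finally show "0 \<le> inner (R x) x"
      using x b by (simp add: R_def inner_diff_left power2_norm_eq_inner)
  qed
  moreover have "\<forall>x\<in>M. R (R x) = B x"
  proof
    fix x assume x: "x \<in> M"
    have Xx: "X x \<in> M"
      by (rule bounded_opsD(1)[OF X_b x])
    \<comment> \<open>Here R R = b (1 - X)^2 = b (1 - 2 X + X X), and the fixed point equation 2 X =
      C + X X turns this into b (1 - C) = B.\<close>
    have "R (R x) = b *\<^sub>R ((x - X x) - X (x - X x))"
    proof -
      have y: "x - X x \<in> M"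
        by (rule closed_csubspaceD(3)[OF M x Xx])
      have "R (R x) = sqrt b *\<^sub>R (sqrt b *\<^sub>R (x - X x) - X (sqrt b *\<^sub>R (x - X x)))"
        unfolding R_def restrict_apply'[OF x] restrict_apply'[OF closed_csubspaceD(5)[OF M y]] ..
      also have "\<dots> = sqrt b *\<^sub>R sqrt b *\<^sub>R ((x - X x) - X (x - X x))"
        unfolding bounded_opsD(4)[OF X_b y] by (simp only: scaleR_diff_right)
      finally show ?thesis
        using b(1) by simp
    qed
    also have "(x - X x) - X (x - X x) = x - 2 *\<^sub>R X x + X (X x)"
      by (simp add: bounded_ops_diff[OF X_b M x Xx] scaleR_2)
    also have "\<dots> = x - C x"
      by (simp add: X_fix[OF x])
    also have "b *\<^sub>R (x - C x) = B x"
      using x b(1) by (simp add: C_def)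
    finally show "R (R x) = B x" .
  qed
  moreover have "S (R x) = R (S x)" if S: "S \<in> bounded_ops M M" "\<forall>x\<in>M. S (B x) = B (S x)" and x: "x \<in> M" for S x
  proof -
    have "S (C x) = C (S x)" if "x \<in> M" for x
      using S that bounded_opsD[OF S(1)] bounded_opsD[OF Bb]
      by (simp add: C_def bounded_ops_diff[OF S(1) M] closed_csubspaceD[OF M])
    then have "S (X x) = X (S x)"
      using X_comm[OF S(1)] x by blast
    then show ?thesis
      using x bounded_opsD(1)[OF S(1) x] bounded_opsD(1)[OF X_b x]
      by (simp add: R_def bounded_opsD[OF S(1)] bounded_ops_diff[OF S(1) M] closed_csubspaceD[OF M])
  qed
  ultimately show ?thesis
    by blast
qed

lemma positive_op_quadratic_zero:
  assumes M: "closed_csubspace M" and A: "positive_op M A" and "x \<in> M" "inner (A x) x = 0"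
  shows "A x = 0"
proof -
  obtain c where "\<And>x. x \<in> M \<Longrightarrow> norm (A x) \<le> c * norm x"
    using bounded_ops_bound[OF positive_opD(1)[OF A M]] by metis
  then show ?thesis
    using positive_op_norm_sq_le[OF M A, of c x] assms by simp
qed

text \<open>For y = R x - S x, commutation and equal squares give (R + S) y = 0. Both forms are
  nonnegative, so both vanish at y and R y = S y = 0; moving R and S to the other side then gives
  |y|^2 = 0.\<close>

lemma positive_sqrt_unique:
  assumes M: "closed_csubspace M" and R: "positive_op M R" and S: "positive_op M S"
    and eq: "\<And>x. x \<in> M \<Longrightarrow> R (R x) = S (S x)" and comm: "\<And>x. x \<in> M \<Longrightarrow> S (R x) = R (S x)"
  shows "R = S"
proof (rule bounded_ops_eqI)
  note Rb = positive_opD(1)[OF R M] and Sb = positive_opD(1)[OF S M]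
  show "R \<in> bounded_ops M M" "S \<in> bounded_ops M M"
    by (fact Rb Sb)+
  fix x assume x: "x \<in> M"
  note mem = closed_csubspaceD(2-3)[OF M] bounded_opsD(1)[OF Rb] bounded_opsD(1)[OF Sb]
  have key: "R (R x - S x) = 0 \<and> S (R x - S x) = 0" if x: "x \<in> M" for x
  proof -
    define y where "y = R x - S x"
    have y: "y \<in> M"
      by (simp add: y_def mem x)
    have "R y + S y = 0"
      using x by (simp add: y_def mem bounded_ops_diff[OF Rb M] bounded_ops_diff[OF Sb M] eq comm)
    then have "inner (R y) y + inner (S y) y = 0"
      by (metis inner_add_left inner_zero_left)
    then have "inner (R y) y = 0" "inner (S y) y = 0"
      using positive_opD(3)[OF R M y] positive_opD(3)[OF S M y] by linarith+
    then show ?thesis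
      using positive_op_quadratic_zero[OF M R y] positive_op_quadratic_zero[OF M S y] by (simp add: y_def)
  qed
  define y where "y = R x - S x"
  have y: "y \<in> M"
    by (simp add: y_def mem x)
  have "inner y y = inner (R x) y - inner (S x) y"
    by (simp add: y_def inner_diff_left)
  also have "\<dots> = inner x (R y) - inner x (S y)"
    by (simp add: positive_opD(4)[OF R M x y] positive_opD(4)[OF S M x y])
  also have "\<dots> = 0"
    using key[OF x] by (simp add: y_def)
  finally show "R x = S x"
    by (simp add: y_def)
qed

text \<open>Any positive root S commutes with B = S S, hence with the constructed R, which is the
  commutation that uniqueness asks for.\<close>

lemma op_sqrt_props:
  assumes M: "closed_csubspace M" and B: "positive_op M B"
  shows op_sqrt_positive: "positive_op M (op_sqrt M B)"
    and op_sqrt_op_sqrt: "x \<in> M \<Longrightarrow> op_sqrt M B (op_sqrt M B x) = B x"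
proof -
  note Bb = positive_opD(1)[OF B M]
  obtain R where R: "positive_op M R" "\<And>x. x \<in> M \<Longrightarrow> R (R x) = B x"
    and comm: "\<And>S x. S \<in> bounded_ops M M \<Longrightarrow> (\<forall>x\<in>M. S (B x) = B (S x)) \<Longrightarrow> x \<in> M \<Longrightarrow> S (R x) = R (S x)"
    using positive_sqrt_exists[OF M B] by blast
  have "op_sqrt M B = R"
    unfolding op_sqrt_def
  proof (rule the_equality)
    show "positive_op M R \<and> compose M R R = B"
      using R bounded_opsD(5)[OF Bb] by (auto simp: compose_def restrict_def fun_eq_iff)
    fix S assume S: "positive_op M S \<and> compose M S S = B"
    then have SS: "S (S x) = B x" if "x \<in> M" for x
      using that by (metis compose_eq)
    note Sb = positive_opD(1)[OF conjunct1[OF S] M]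
    have "S (R x) = R (S x)" if "x \<in> M" for x
      by (rule comm[OF Sb _ that]) (metis SS bounded_opsD(1)[OF Sb])
    then show "S = R"
      using positive_sqrt_unique[OF M R(1) conjunct1[OF S]] R(2) SS by metis
  qed
  then show "positive_op M (op_sqrt M B)" "x \<in> M \<Longrightarrow> op_sqrt M B (op_sqrt M B x) = B x"
    using R by auto
qed

text \<open>T and its modulus have the same Gram form, so norms and orthogonality of images transfer
  between them; below, the modulus is handled through these facts and not through its
  construction.\<close>

lemma op_abs_props:
  assumes M: "closed_csubspace M" and N: "closed_csubspace N" and T: "T \<in> bounded_ops M N"
  shows op_abs_positive: "positive_op M (op_abs M N T)"
    and cinner_op_abs: "x \<in> M \<Longrightarrow> y \<in> M \<Longrightarrow> cinner (op_abs M N T x) (op_abs M N T y) = cinner (T x) (T y)"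
    and norm_op_abs: "x \<in> M \<Longrightarrow> norm (op_abs M N T x) = norm (T x)"
proof -
  define B where "B = compose M (adj M N T) T"
  note a = adj_bounded_ops[OF M N T] cinner_adj[OF M N T]
  have Bb: "B \<in> bounded_ops M M"
    unfolding B_def by (rule compose_bounded_ops[OF T a(1) M])
  have B: "cinner x (B y) = cinner (T x) (T y)" if "x \<in> M" "y \<in> M" for x y
    using that by (simp add: B_def compose_eq a(2) bounded_opsD(1)[OF T])
  have B': "cinner (B x) y = cinner (T x) (T y)" if "x \<in> M" "y \<in> M" for x y
    using B[OF that(2,1)] cinner_commute by metis
  have pos: "positive_op M B"
    using Bb by (simp add: positive_op_iff[OF M] symmetric_on_def B B' inner_eq_Re_cinner cinner_self)
  have eq: "op_abs M N T = op_sqrt M B"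
    by (simp add: op_abs_def B_def)
  show P: "positive_op M (op_abs M N T)"
    unfolding eq by (rule op_sqrt_positive[OF M pos])
  show C: "cinner (op_abs M N T x) (op_abs M N T y) = cinner (T x) (T y)" if "x \<in> M" "y \<in> M" for x y
    using symmetric_onD[OF positive_opD(2)[OF P M] that(1), of "op_abs M N T y"]
      bounded_opsD(1)[OF positive_opD(1)[OF P M] that(2)] op_sqrt_op_sqrt[OF M pos that(2)] B[OF that]
    by (simp add: eq)
  show "norm (op_abs M N T x) = norm (T x)" if "x \<in> M"
    using C[OF that that] unfolding cinner_self of_real_eq_iff by simp
qed

section \<open>Spectrum of a positive operator\<close>

lemma unit_vector_exists:
  assumes "closed_csubspace M" "x \<in> M" "x \<noteq> 0"
  obtains u where "u \<in> M" "norm u = 1" "x = norm x *\<^sub>R u"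
  using that[of "(1 / norm x) *\<^sub>R x"] assms by (simp add: closed_csubspaceD)

text \<open>The right-hand side depends on z only through its real part and modulus, so A - z and A
  - cnj z have equal norms at x. This settles nonreal z in the invertibility criterion.\<close>

lemma norm_sq_diff_scaleC:
  assumes "symmetric_on M A" "x \<in> M"
  shows "(norm (A x - z *\<^sub>C x))\<^sup>2 = (norm (A x))\<^sup>2 - 2 * Re z * inner (A x) x + (cmod z)\<^sup>2 * (norm x)\<^sup>2"
proof -
  have "cnj (cinner (A x) x) = cinner (A x) x"
    using symmetric_onD[OF assms(1,2,2)] cinner_commute by metis
  then have "Im (cinner (A x) x) = 0"
    by (simp add: complex_eq_iff)
  then show ?thesis
    by (simp add: norm_diff_cinner cinner_scaleC_right norm_scaleC power_mult_distrib inner_eq_Re_cinner)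
qed

text \<open>A lower bound makes A - z injective with closed range and bounds the inverse. A vector
  orthogonal to the range is killed by A - cnj z, hence by A - z, so the range is all of M.\<close>

lemma not_in_spectrum_if_bounded_below:
  assumes M: "closed_csubspace M" and A: "A \<in> bounded_ops M M" and sym: "symmetric_on M A"
    and c: "0 < c" "\<And>x. x \<in> M \<Longrightarrow> c * norm x \<le> norm (A x - z *\<^sub>C x)"
  shows "z \<notin> spectrum M A"
proof -
  define G where "G x = A x - z *\<^sub>C x" for x
  note MD = closed_csubspaceD[OF M]
  have G_mem: "G x \<in> M" if "x \<in> M" for x
    using that by (simp add: G_def MD bounded_opsD[OF A])
  have G_add: "G (x + y) = G x + G y" if "x \<in> M" "y \<in> M" for x y
    using that by (simp add: G_def bounded_opsD[OF A] scaleC_add_right)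
  have G_scale: "G (a *\<^sub>C x) = a *\<^sub>C G x" if "x \<in> M" for x a
    using that by (simp add: G_def bounded_opsD[OF A] scaleC.diff_right scaleC_scaleC mult.commute)
  have G_diff: "G (x - y) = G x - G y" if "x \<in> M" "y \<in> M" for x y
    using that by (simp add: G_def bounded_ops_diff[OF A M] scaleC.diff_right)
  have G_low: "c * norm x \<le> norm (G x)" if "x \<in> M" for x
    using c(2)[OF that] by (simp add: G_def)
  have G_inj: "x = y" if "x \<in> M" "y \<in> M" "G x = G y" for x y
    using G_low[of "x - y"] that c(1) by (simp add: MD G_diff mult_le_0_iff)
  have "closed (G ` M)"
    unfolding closed_sequential_limits
  proof (intro allI impI, elim conjE)
    fix f l assume f: "\<forall>n. f n \<in> G ` M" "f \<longlonglongrightarrow> l"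
    then obtain x where x: "\<And>n. x n \<in> M" "\<And>n. f n = G (x n)"
      unfolding image_iff by metis
    have "Cauchy x"
    proof (rule metric_CauchyI)
      fix e :: real assume e: "0 < e"
      then obtain N where N: "\<And>m n. m \<ge> N \<Longrightarrow> n \<ge> N \<Longrightarrow> dist (f m) (f n) < c * e"
        using metric_CauchyD[OF LIMSEQ_imp_Cauchy[OF f(2)], of "c * e"] c(1) by auto
      have "dist (x m) (x n) < e" if "m \<ge> N" "n \<ge> N" for m n
      proof -
        have "c * norm (x m - x n) < c * e"
          using G_low[of "x m - x n"] N[OF that] by (simp add: x MD G_diff dist_norm)
        then show ?thesis
          using c(1) by (simp add: dist_norm)
      qed
      then show "\<exists>N. \<forall>m\<ge>N. \<forall>n\<ge>N. dist (x m) (x n) < e"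
        by blast
    qed
    then obtain y where y: "x \<longlonglongrightarrow> y"
      using Cauchy_convergent_iff convergent_def by blast
    then have "y \<in> M"
      using closed_sequentially[OF MD(7)] x(1) by blast
    moreover have "(\<lambda>n. G (x n)) \<longlonglongrightarrow> G y"
      unfolding G_def
      by (intro tendsto_diff bounded_ops_tendsto[OF A M] x(1) y scaleC.tendsto tendsto_const)
    then have "G y = l"
      using f(2) LIMSEQ_unique by (simp add: x(2)[symmetric])
    ultimately show "l \<in> G ` M"
      by blast
  qed
  moreover have "complex_vector.subspace (G ` M)"
  proof (rule complex_vector.subspaceI)
    show "0 \<in> G ` M"
      using G_scale[of 0 0] MD(1) by (intro image_eqI[of _ _ 0]) auto
  next
    fix u v assume "u \<in> G ` M" "v \<in> G ` M"
    then show "u + v \<in> G ` M"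
      using G_add MD(2) by (auto simp flip: G_add)
  next
    fix a u assume "u \<in> G ` M"
    then show "a *\<^sub>C u \<in> G ` M"
      using MD(4) by (auto simp flip: G_scale)
  qed
  ultimately have W: "closed_csubspace (G ` M)"
    by (simp add: closed_csubspace_def)
  have "M \<inter> orth_compl (G ` M) \<subseteq> {0}"
  proof
    fix y assume y: "y \<in> M \<inter> orth_compl (G ` M)"
    \<comment> \<open>By symmetry the inner product of \<open>G ?w\<close> with y is |?w|^2, and it
      vanishes because y is orthogonal to the range.\<close>
    let ?w = "A y - cnj z *\<^sub>C y"
    have w: "?w \<in> M"
      using y by (simp add: MD bounded_opsD[OF A])
    have "cinner (G ?w) y = 0"
      using y w by (auto dest: orth_complD)
    moreover have "cinner (G ?w) y = cinner ?w ?w"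
      using symmetric_onD[OF sym w, of y] y
      by (simp add: G_def cinner.diff_left[of "A ?w"] cinner_scaleC_left cinner_scaleC_right cinner.diff_right[of ?w])
    ultimately have "norm (G y) = 0"
      using norm_sq_diff_scaleC[OF sym, of y z] norm_sq_diff_scaleC[OF sym, of y "cnj z"] y
      by (simp add: G_def cinner_self)
    then show "y \<in> {0}"
      using G_low[of y] y c(1) by (simp add: mult_le_0_iff)
  qed
  then have surj: "M \<subseteq> G ` M"
    using subset_of_orth_compl_trivial[OF W M] G_mem by blast
  define B where "B = (\<lambda>y\<in>M. inv_into M G y)"
  have B: "B y \<in> M" "G (B y) = y" if "y \<in> M" for y
    using inv_into_into[of y G M] f_inv_into_f[of y G M] surj that by (auto simp: B_def)
  have BI: "B y = x" if "x \<in> M" "G x = y" for x y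
    using G_inj[OF B(1) that(1)] B(2) G_mem that by metis
  have "B \<in> bounded_ops M M"
  proof (rule bounded_opsI)
    show "norm (B y) \<le> 1 / c * norm y" if "y \<in> M" for y
      using G_low[OF B(1)[OF that]] c(1) by (simp add: B(2)[OF that] field_simps)
    show "B (x + y) = B x + B y" if "x \<in> M" "y \<in> M" for x y
      using that by (intro BI) (simp_all add: B MD G_add)
    show "B (a *\<^sub>C x) = a *\<^sub>C B x" if "x \<in> M" for a x
      using that by (intro BI) (simp_all add: B MD G_scale)
    show "B x \<in> M" if "x \<in> M" for x
      by (rule B(1)[OF that])
    show "B x = undefined" if "x \<notin> M" for x
      using that by (simp add: B_def)
  qed
  moreover have "B (A x - z *\<^sub>C x) = x \<and> A (B x) - z *\<^sub>C B x = x" if "x \<in> M" for x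
    using BI[OF that] B(2)[OF that] by (simp add: G_def)
  ultimately show ?thesis
    by (auto simp: spectrum_def)
qed

text \<open>For symmetric operators the whole spectrum is approximate point spectrum: conversely to
  the preceding criterion, an inverse of norm at most D gives the lower bound 1 / D.\<close>

lemma in_spectrum_iff:
  assumes M: "closed_csubspace M" and A: "A \<in> bounded_ops M M" and sym: "symmetric_on M A"
  shows "z \<in> spectrum M A \<longleftrightarrow> (\<forall>c>0. \<exists>x\<in>M. norm (A x - z *\<^sub>C x) < c * norm x)"
proof
  assume "z \<in> spectrum M A"
  then show "\<forall>c>0. \<exists>x\<in>M. norm (A x - z *\<^sub>C x) < c * norm x"
    using not_in_spectrum_if_bounded_below[OF assms] not_le by metis
next
  assume *: "\<forall>c>0. \<exists>x\<in>M. norm (A x - z *\<^sub>C x) < c * norm x"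
  show "z \<in> spectrum M A"
  proof (rule ccontr)
    assume "z \<notin> spectrum M A"
    then obtain B where B: "B \<in> bounded_ops M M" "\<And>x. x \<in> M \<Longrightarrow> B (A x - z *\<^sub>C x) = x"
      by (auto simp: spectrum_def)
    obtain D where D: "0 < D" "\<And>x. x \<in> M \<Longrightarrow> norm (B x) \<le> D * norm x"
      using bounded_ops_bound[OF B(1)] by metis
    obtain x where x: "x \<in> M" "norm (A x - z *\<^sub>C x) < 1 / D * norm x"
      using * D(1) by (metis zero_less_divide_1_iff)
    have "A x - z *\<^sub>C x \<in> M"
      using x by (simp add: closed_csubspaceD[OF M] bounded_opsD[OF A])
    from D(2)[OF this] have "norm x \<le> D * norm (A x - z *\<^sub>C x)"
      by (simp add: B x)
    then show False
      using x(2) D(1) by (simp add: field_simps)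
  qed
qed

lemma approx_eigenvalue_in_spectrum:
  assumes "closed_csubspace M" "A \<in> bounded_ops M M" "symmetric_on M A"
    and x: "\<And>n. x n \<in> M" "\<And>n. norm (x n) = 1" "(\<lambda>n. A (x n) - z *\<^sub>C x n) \<longlonglongrightarrow> 0"
  shows "z \<in> spectrum M A"
  unfolding in_spectrum_iff[OF assms(1-3)]
proof (intro allI impI)
  fix c :: real assume "0 < c"
  then obtain n where "norm (A (x n) - z *\<^sub>C x n) < c"
    using LIMSEQ_D[OF x(3), of c] by auto
  then show "\<exists>x\<in>M. norm (A x - z *\<^sub>C x) < c * norm x"
    using x(1,2) by (intro bexI[of _ "x n"]) auto
qed

section \<open>Extremal sequences and the location of the spectrum\<close>

lemma real_Sup_sequence:
  fixes f :: "'a \<Rightarrow> real"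
  assumes "S \<noteq> {}" "bdd_above (f ` S)"
  obtains x where "\<And>n::nat. x n \<in> S" "(\<lambda>n. f (x n)) \<longlonglongrightarrow> Sup (f ` S)"
proof -
  have "Sup (f ` S) \<in> closure (f ` S)"
    using assms by (intro closure_contains_Sup) auto
  then obtain g where g: "\<forall>n. g n \<in> f ` S" "g \<longlonglongrightarrow> Sup (f ` S)"
    by (auto simp: closure_sequential)
  then obtain x where "\<And>n. x n \<in> S" "\<And>n. g n = f (x n)"
    unfolding image_iff by metis
  then show thesis
    using that[of x] g(2) by presburger
qed

lemma real_Inf_sequence:
  fixes f :: "'a \<Rightarrow> real"
  assumes "S \<noteq> {}" "bdd_below (f ` S)"
  obtains x where "\<And>n::nat. x n \<in> S" "(\<lambda>n. f (x n)) \<longlonglongrightarrow> Inf (f ` S)"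
proof -
  have "bdd_above ((\<lambda>x. - f x) ` S)"
    using assms(2) bdd_above_uminus[of "f ` S"] by (simp add: image_image)
  then obtain x where "\<And>n::nat. x n \<in> S" "(\<lambda>n. - f (x n)) \<longlonglongrightarrow> Sup ((\<lambda>x. - f x) ` S)"
    using real_Sup_sequence[OF assms(1)] by blast
  then show thesis
    using that[of x] by (simp add: Inf_real_def image_image tendsto_minus_cancel_left)
qed

lemma nontrivial_unit_vectors:
  assumes "closed_csubspace M" "M \<noteq> {0}"
  shows "{x\<in>M. norm x = 1} \<noteq> {}"
  using assms unit_vector_exists[OF assms(1)] closed_csubspaceD(1)[OF assms(1)] by blast

text \<open>
  The number c is the infimum (\<open>e = 1\<close>) or the supremum (\<open>e = - 1\<close>) of the norm of G on unit vectors. The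
  form of \<open>e (G\<^sup>2 - c\<^sup>2)\<close> is positive, so vectors on which it tends to 0 are approximate null vectors.
\<close>

lemma extremal_sequence:
  fixes G :: "'a::complex_hilbert \<Rightarrow> 'a"
  assumes M: "closed_csubspace M" and G_mem: "\<And>u. u \<in> M \<Longrightarrow> G u \<in> M"
    and G_lin: "\<And>u v r. u \<in> M \<Longrightarrow> v \<in> M \<Longrightarrow> G (u + r *\<^sub>R v) = G u + r *\<^sub>R G v"
    and G_sym: "\<And>u v. u \<in> M \<Longrightarrow> v \<in> M \<Longrightarrow> inner (G u) v = inner u (G v)"
    and C: "0 \<le> C" "\<And>u. u \<in> M \<Longrightarrow> norm (G u) \<le> C * norm u"
    and ext: "\<And>u. u \<in> M \<Longrightarrow> 0 \<le> e * ((norm (G u))\<^sup>2 - (c * norm u)\<^sup>2)"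
    and x: "\<And>n. x n \<in> M" "\<And>n::nat. norm (x n) = 1" "(\<lambda>n. norm (G (x n))) \<longlonglongrightarrow> c"
  shows "(\<lambda>n. e *\<^sub>R (G (G (x n)) - c\<^sup>2 *\<^sub>R x n)) \<longlonglongrightarrow> 0"
proof -
  note MD = closed_csubspaceD[OF M]
  define Q where "Q u = e *\<^sub>R (G (G u) - c\<^sup>2 *\<^sub>R u)" for u
  define B where "B = \<bar>e\<bar> * (C * C + c\<^sup>2)"
  have form: "inner (Q u) u = e * ((norm (G u))\<^sup>2 - (c * norm u)\<^sup>2)" if "u \<in> M" for u
    using G_sym[OF G_mem[OF that] that]
    by (simp add: Q_def inner_diff_left dot_square_norm power_mult_distrib)
  have "(norm (Q u))\<^sup>2 \<le> B * inner (Q u) u" if u: "u \<in> M" for u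
  proof (rule psd_norm_le[OF M])
    fix u assume u: "u \<in> M"
    show "Q u \<in> M"
      using u by (simp add: Q_def MD G_mem)
    have le: "norm (G (G u) - c\<^sup>2 *\<^sub>R u) \<le> C * (C * norm u) + c\<^sup>2 * norm u"
      using C(1) order_trans[OF C(2)[OF G_mem[OF u]] mult_left_mono[OF C(2)[OF u]]]
      by (intro order_trans[OF norm_triangle_ineq4]) simp
    have "norm (Q u) = \<bar>e\<bar> * norm (G (G u) - c\<^sup>2 *\<^sub>R u)"
      by (simp add: Q_def)
    also have "\<dots> \<le> \<bar>e\<bar> * (C * (C * norm u) + c\<^sup>2 * norm u)"
      by (rule mult_left_mono[OF le]) simp
    finally show "norm (Q u) \<le> B * norm u"
      by (simp add: B_def algebra_simps)
    show "0 \<le> inner (Q u) u"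
      unfolding form[OF u] by (rule ext[OF u])
    fix v assume v: "v \<in> M"
    show "Q (u + r *\<^sub>R v) = Q u + r *\<^sub>R Q v" for r
      using u v by (simp add: Q_def G_lin G_mem algebra_simps)
    show "inner (Q u) v = inner u (Q v)"
      using G_sym G_mem u v by (simp add: Q_def inner_diff_left inner_diff_right)
  qed (fact u)
  \<comment> \<open>On unit vectors the form is e (|G x|^2 - c^2), which tends to 0 along the
    extremal sequence and drags the norm of Q with it.\<close>
  then have le: "(norm (Q (x n)))\<^sup>2 \<le> B * (e * ((norm (G (x n)))\<^sup>2 - c\<^sup>2))" for n
    using form[OF x(1)[of n]] x by (metis mult.right_neutral)
  have "(\<lambda>n. B * (e * ((norm (G (x n)))\<^sup>2 - c\<^sup>2))) \<longlonglongrightarrow> B * (e * (c\<^sup>2 - c\<^sup>2))"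
    by (intro tendsto_intros x(3))
  then have "(\<lambda>n. B * (e * ((norm (G (x n)))\<^sup>2 - c\<^sup>2))) \<longlonglongrightarrow> 0"
    by simp
  then have "(\<lambda>n. (norm (Q (x n)))\<^sup>2) \<longlonglongrightarrow> 0"
    by (rule Lim_null_comparison[rotated]) (intro always_eventually allI, use le in simp)
  from tendsto_real_sqrt[OF this] have "(\<lambda>n. norm (Q (x n))) \<longlonglongrightarrow> 0"
    by simp
  then show ?thesis
    unfolding Q_def by (simp only: tendsto_norm_zero_iff)
qed

text \<open>A sequence maximizing |A u| is annihilated in the limit by \<nu>^2 - A^2 = (\<nu> +
  A)(\<nu> - A). Positivity of A bounds \<nu> + A below by \<nu>, which removes that factor when
  \<nu> > 0; for \<nu> = 0 the operator is zero.\<close>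

lemma positive_op_maximizing_sequence:
  assumes M: "closed_csubspace M" and A: "positive_op M A" and ne: "M \<noteq> {0}"
  obtains \<nu> x where "0 \<le> \<nu>" "\<And>x. x \<in> M \<Longrightarrow> norm (A x) \<le> \<nu> * norm x" "\<And>n. x n \<in> M" "\<And>n::nat. norm (x n) = 1"
    "(\<lambda>n. A (x n) - \<nu> *\<^sub>R x n) \<longlonglongrightarrow> 0"
proof -
  note Ab = positive_opD(1)[OF A M] and MD = closed_csubspaceD[OF M]
  define S where "S = {x\<in>M. norm x = 1}"
  have S: "S \<noteq> {}"
    using nontrivial_unit_vectors[OF M ne] by (simp add: S_def)
  obtain C where C: "\<And>x. x \<in> M \<Longrightarrow> norm (A x) \<le> C * norm x"
    using bounded_ops_bound[OF Ab] by metis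
  have bdd: "bdd_above ((\<lambda>x. norm (A x)) ` S)"
    using C by (intro bdd_aboveI2[of _ _ C]) (force simp: S_def)
  define \<nu> where "\<nu> = Sup ((\<lambda>x. norm (A x)) ` S)"
  obtain x where x: "\<And>n::nat. x n \<in> S" "(\<lambda>n. norm (A (x n))) \<longlonglongrightarrow> \<nu>"
    using real_Sup_sequence[OF S bdd] unfolding \<nu>_def by blast
  have x': "x n \<in> M" "norm (x n) = 1" for n
    using x(1)[of n] by (auto simp: S_def)
  have \<nu>S: "norm (A u) \<le> \<nu>" if "u \<in> S" for u
    unfolding \<nu>_def by (rule cSUP_upper[OF that bdd])
  then have \<nu>0: "0 \<le> \<nu>"
    using S norm_ge_zero order_trans by blast
  have \<nu>: "norm (A u) \<le> \<nu> * norm u" if "u \<in> M" for u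
  proof (cases "u = 0")
    case False
    then obtain v where v: "v \<in> M" "norm v = 1" "u = norm u *\<^sub>R v"
      using unit_vector_exists[OF M \<open>u \<in> M\<close>] by blast
    have "norm (A u) = norm u * norm (A v)"
      by (subst v(3)) (simp add: bounded_opsD(4)[OF Ab v(1)])
    also have "\<dots> \<le> norm u * \<nu>"
      using v \<nu>S by (intro mult_left_mono) (auto simp: S_def)
    finally show ?thesis
      by (simp add: mult.commute)
  qed (simp add: bounded_ops_0[OF Ab M])
  define Q where "Q y = \<nu>\<^sup>2 *\<^sub>R y - A (A y)" for y
  have y_le: "\<nu> * norm (\<nu> *\<^sub>R u - A u) \<le> norm (Q u)" if u: "u \<in> M" for u
  proof -
    define y where "y = \<nu> *\<^sub>R u - A u"
    have y: "y \<in> M"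
      using u by (simp add: y_def MD bounded_opsD[OF Ab])
    have "Q u = \<nu> *\<^sub>R y + A y"
      using u by (simp add: Q_def y_def bounded_ops_diff[OF Ab M] bounded_opsD[OF Ab] MD algebra_simps power2_eq_square)
    then have "\<nu> * (norm y)\<^sup>2 \<le> inner (Q u) y"
      using positive_opD(3)[OF A M y] by (simp add: inner_add_left power2_norm_eq_inner)
    also have "\<dots> \<le> norm (Q u) * norm y"
      by (rule norm_cauchy_schwarz)
    finally have "(\<nu> * norm y) * norm y \<le> norm (Q u) * norm y"
      by (simp add: power2_eq_square)
    then have "\<nu> * norm y \<le> norm (Q u)" if "y \<noteq> 0"
      using that by simp
    then show ?thesis
      unfolding y_def[symmetric] by (cases "y = 0") auto
  qed
  have "(\<lambda>n. A (x n) - \<nu> *\<^sub>R x n) \<longlonglongrightarrow> 0"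
  proof (cases "\<nu> = 0")
    case True
    then show ?thesis
      using \<nu>[OF x'(1)] by simp
  next
    case False
    then have pos: "0 < \<nu>"
      using \<nu>0 by simp
    have "(\<lambda>n. (- 1) *\<^sub>R (A (A (x n)) - \<nu>\<^sup>2 *\<^sub>R x n)) \<longlonglongrightarrow> 0"
    proof (rule extremal_sequence[OF M _ _ _ \<nu>0 \<nu> _ x' x(2)])
      show "0 \<le> - 1 * ((norm (A u))\<^sup>2 - (\<nu> * norm u)\<^sup>2)" if "u \<in> M" for u
        using power_mono[OF \<nu>[OF that], of 2] by simp
    qed (simp_all add: bounded_opsD[OF Ab] MD positive_opD(4)[OF A M])
    then have "(\<lambda>n. norm (Q (x n))) \<longlonglongrightarrow> 0"
      by (intro tendsto_norm_zero) (simp add: Q_def)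
    then have "(\<lambda>n. norm (Q (x n)) / \<nu>) \<longlonglongrightarrow> 0"
      by (rule tendsto_divide_zero)
    then show ?thesis
    proof (rule Lim_null_comparison[rotated], intro always_eventually allI)
      show "norm (A (x n) - \<nu> *\<^sub>R x n) \<le> norm (Q (x n)) / \<nu>" for n
        using y_le[OF x'(1)[of n]] pos by (simp add: field_simps norm_minus_commute)
    qed
  qed
  then show thesis
    using that \<nu>0 \<nu> x' by blast
qed

text \<open>Identifies \<open>spec_sup\<close>, defined through the spectrum, with the operator
  norm: the norm \<nu> is an approximate eigenvalue, and A - t is bounded below for real t above
  \<nu>.\<close>

lemma spec_sup_props:
  assumes M: "closed_csubspace M" and A: "positive_op M A" and ne: "M \<noteq> {0}"
  shows spec_sup_nonneg: "0 \<le> spec_sup M A"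
    and norm_le_spec_sup: "x \<in> M \<Longrightarrow> norm (A x) \<le> spec_sup M A * norm x"
    and spec_sup_in_spectrum: "complex_of_real (spec_sup M A) \<in> spectrum M A"
    and spec_sup_sequence: "\<exists>x. (\<forall>n::nat. x n \<in> M \<and> norm (x n) = 1) \<and> (\<lambda>n. A (x n) - spec_sup M A *\<^sub>R x n) \<longlonglongrightarrow> 0"
proof -
  note Ab = positive_opD(1)[OF A M] and sym = positive_opD(2)[OF A M]
  obtain \<nu> x where \<nu>: "0 \<le> \<nu>" "\<And>x. x \<in> M \<Longrightarrow> norm (A x) \<le> \<nu> * norm x"
    and x: "\<And>n. x n \<in> M" "\<And>n::nat. norm (x n) = 1" "(\<lambda>n. A (x n) - \<nu> *\<^sub>R x n) \<longlonglongrightarrow> 0"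
    using positive_op_maximizing_sequence[OF assms] by metis
  have spec: "complex_of_real \<nu> \<in> spectrum M A"
    by (rule approx_eigenvalue_in_spectrum[OF M Ab sym x(1,2)]) (use x(3) in \<open>simp add: scaleR_scaleC\<close>)
  have "t \<le> \<nu>" if t: "complex_of_real t \<in> spectrum M A" for t
  proof (rule ccontr)
    assume "\<not> t \<le> \<nu>"
    then have "0 < t - \<nu>"
      by simp
    moreover have "(t - \<nu>) * norm u \<le> norm (A u - complex_of_real t *\<^sub>C u)" if "u \<in> M" for u
      using \<nu>(1) \<nu>(2)[OF that] norm_triangle_ineq2[of "t *\<^sub>R u" "A u"] \<open>\<not> t \<le> \<nu>\<close>
      by (simp add: norm_minus_commute left_diff_distrib flip: scaleR_scaleC)
    ultimately show False
      using not_in_spectrum_if_bounded_below[OF M Ab sym] t by blast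
  qed
  then have "spec_sup M A = \<nu>"
    unfolding spec_sup_def using spec by (intro cSup_eq_maximum) auto
  then show "0 \<le> spec_sup M A" "x \<in> M \<Longrightarrow> norm (A x) \<le> spec_sup M A * norm x"
    "complex_of_real (spec_sup M A) \<in> spectrum M A"
    "\<exists>x. (\<forall>n::nat. x n \<in> M \<and> norm (x n) = 1) \<and> (\<lambda>n. A (x n) - spec_sup M A *\<^sub>R x n) \<longlonglongrightarrow> 0" for x
    using \<nu> spec x by auto
qed

text \<open>A substitute for spectral mapping. With c the infimum of |(A - t) u| over unit vectors,
  (A - t)^2 - c^2 is not bounded below; it factors into A - (t + c) and A - (t - c), so one of these
  is not bounded below either.\<close>

lemma spectrum_at_distance:
  assumes M: "closed_csubspace M" and A: "positive_op M A" and ne: "M \<noteq> {0}"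
  obtains c where "0 \<le> c" "\<And>x. x \<in> M \<Longrightarrow> c * norm x \<le> norm (A x - t *\<^sub>R x)"
    "complex_of_real (t + c) \<in> spectrum M A \<or> complex_of_real (t - c) \<in> spectrum M A"
proof -
  note Ab = positive_opD(1)[OF A M] and sym = positive_opD(2)[OF A M] and MD = closed_csubspaceD[OF M]
  obtain C where C: "0 < C" "\<And>x. x \<in> M \<Longrightarrow> norm (A x) \<le> C * norm x"
    using bounded_ops_bound[OF Ab] by metis
  define G where "G x = A x - t *\<^sub>R x" for x
  have G_mem: "G x \<in> M" if "x \<in> M" for x
    using that by (simp add: G_def MD bounded_opsD[OF Ab])
  have G_lin: "G (x + r *\<^sub>R y) = G x + r *\<^sub>R G y" if "x \<in> M" "y \<in> M" for x y r
    using that by (simp add: G_def bounded_opsD[OF Ab] MD algebra_simps)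
  have G_sym: "inner (G x) y = inner x (G y)" if "x \<in> M" "y \<in> M" for x y
    using positive_opD(4)[OF A M] that by (simp add: G_def inner_diff_left inner_diff_right)
  define S where "S = {x\<in>M. norm x = 1}"
  have S: "S \<noteq> {}"
    using nontrivial_unit_vectors[OF M ne] by (simp add: S_def)
  have bdd: "bdd_below ((\<lambda>x. norm (G x)) ` S)"
    by (intro bdd_belowI2[of _ 0]) simp
  define c where "c = Inf ((\<lambda>x. norm (G x)) ` S)"
  obtain x where x: "\<And>n::nat. x n \<in> S" "(\<lambda>n. norm (G (x n))) \<longlonglongrightarrow> c"
    using real_Inf_sequence[OF S bdd] unfolding c_def by blast
  have x': "x n \<in> M" "norm (x n) = 1" for n
    using x(1)[of n] by (auto simp: S_def)
  have cS: "c \<le> norm (G u)" if "u \<in> S" for u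
    unfolding c_def by (rule cINF_lower[OF bdd that])
  have c0: "0 \<le> c"
    unfolding c_def by (rule cINF_greatest[OF S]) simp
  have c: "c * norm u \<le> norm (G u)" if "u \<in> M" for u
  proof (cases "u = 0")
    case False
    then obtain v where v: "v \<in> M" "norm v = 1" "u = norm u *\<^sub>R v"
      using unit_vector_exists[OF M \<open>u \<in> M\<close>] by blast
    have "norm u * c \<le> norm u * norm (G v)"
      using v cS by (intro mult_left_mono) (auto simp: S_def)
    also have "\<dots> = norm (norm u *\<^sub>R G v)"
      by simp
    also have "norm u *\<^sub>R G v = G (norm u *\<^sub>R v)"
      by (simp add: G_def bounded_opsD(4)[OF Ab v(1)] algebra_simps)
    also have "\<dots> = G u"
      by (simp only: v(3)[symmetric])
    finally show ?thesis
      by (simp add: mult.commute)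
  qed simp
  define Q where "Q y = G (G y) - c\<^sup>2 *\<^sub>R y" for y
  have Gle: "norm (G u) \<le> (C + \<bar>t\<bar>) * norm u" if "u \<in> M" for u
    unfolding G_def using C(2)[OF that] by (intro order_trans[OF norm_triangle_ineq4]) (simp add: algebra_simps)
  have "(\<lambda>n. 1 *\<^sub>R (G (G (x n)) - c\<^sup>2 *\<^sub>R x n)) \<longlonglongrightarrow> 0"
  proof (rule extremal_sequence[OF M G_mem G_lin G_sym _ Gle _ x' x(2)])
    show "0 \<le> 1 * ((norm (G u))\<^sup>2 - (c * norm u)\<^sup>2)" if "u \<in> M" for u
      using power_mono[OF c[OF that], of 2] c0 by simp
  qed (use C(1) in simp_all)
  then have Qlim: "(\<lambda>n. norm (Q (x n))) \<longlonglongrightarrow> 0"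
    by (intro tendsto_norm_zero) (simp add: Q_def)
  have "complex_of_real (t + c) \<in> spectrum M A \<or> complex_of_real (t - c) \<in> spectrum M A"
  proof (rule ccontr)
    assume "\<not> ?thesis"
    then obtain d e where d: "d > 0" "\<And>x. x \<in> M \<Longrightarrow> d * norm x \<le> norm (A x - (t + c) *\<^sub>R x)"
      and e: "e > 0" "\<And>x. x \<in> M \<Longrightarrow> e * norm x \<le> norm (A x - (t - c) *\<^sub>R x)"
      unfolding in_spectrum_iff[OF M Ab sym] scaleR_scaleC by (meson not_le)
    have "d * e \<le> norm (Q (x n))" for n
    proof -
      define y where "y = A (x n) - (t - c) *\<^sub>R x n"
      have y: "y \<in> M" "e \<le> norm y"
        using e(2)[OF x'(1)[of n]] x'[of n] by (simp_all add: y_def MD bounded_opsD[OF Ab])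
      have "d * e \<le> d * norm y"
        using y d(1) by simp
      also have "\<dots> \<le> norm (A y - (t + c) *\<^sub>R y)"
        by (rule d(2)[OF y(1)])
      also have "A y - (t + c) *\<^sub>R y = Q (x n)"
        using x'(1)[of n] by (simp add: y_def Q_def G_def bounded_ops_diff[OF Ab M] bounded_opsD[OF Ab] MD
            algebra_simps power2_eq_square)
      finally show ?thesis .
    qed
    then have "d * e \<le> 0"
      by (intro LIMSEQ_le_const[OF Qlim]) auto
    then show False
      using d(1) e(1) by (simp add: mult_le_0_iff)
  qed
  then show thesis
    using that c0 c unfolding G_def by blast
qed

text \<open>
  A spectral gap of width \<open>\<epsilon>\<close> below \<open>\<mu>\<close> means \<open>\<epsilon> B \<le> B\<^sup>2\<close> for \<open>B = \<mu> - A\<close>, so B is bounded below by \<open>\<epsilon>\<close> on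
  the closure of its range. If \<open>\<mu>\<close> were no eigenvalue, this closure would be all of M.
\<close>

lemma isolated_spec_sup_eigenvector:
  assumes M: "closed_csubspace M" and A: "positive_op M A" and ne: "M \<noteq> {0}"
    and iso: "\<not> complex_of_real (spec_sup M A) islimpt spectrum M A"
  shows "\<exists>x\<in>M. x \<noteq> 0 \<and> A x = spec_sup M A *\<^sub>R x"
proof (rule ccontr)
  assume none: "\<not> ?thesis"
  define \<mu> where "\<mu> = spec_sup M A"
  have ker: "x = 0" if "x \<in> M" "A x = \<mu> *\<^sub>R x" for x
    using that none unfolding \<mu>_def by blast
  note Ab = positive_opD(1)[OF A M] and sym = positive_opD(2)[OF A M] and MD = closed_csubspaceD[OF M]
  note \<mu> = spec_sup_props[OF M A ne, folded \<mu>_def]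
  obtain \<epsilon> where \<epsilon>: "0 < \<epsilon>" "\<And>z. z \<in> spectrum M A \<Longrightarrow> z \<noteq> complex_of_real \<mu> \<Longrightarrow> \<epsilon> \<le> dist z (complex_of_real \<mu>)"
    using iso unfolding islimpt_approachable \<mu>_def[symmetric] by (meson not_le)
  \<comment> \<open>The midpoint of the gap: for c < \<epsilon> / 2 both t + c and t - c differ from
    \<mu> by less than \<epsilon> without being \<mu>, so neither is in the spectrum.\<close>
  define t where "t = \<mu> - \<epsilon> / 2"
  obtain c where c: "0 \<le> c" "\<And>x. x \<in> M \<Longrightarrow> c * norm x \<le> norm (A x - t *\<^sub>R x)"
    "complex_of_real (t + c) \<in> spectrum M A \<or> complex_of_real (t - c) \<in> spectrum M A"
    using spectrum_at_distance[OF M A ne] by metis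
  have far: "\<epsilon> \<le> \<bar>s - \<mu>\<bar>" if "complex_of_real s \<in> spectrum M A" "s \<noteq> \<mu>" for s
    using \<epsilon>(2)[OF that(1)] that(2) by (simp add: dist_norm flip: of_real_diff)
  have "\<epsilon> / 2 \<le> c"
  proof (rule ccontr)
    assume "\<not> \<epsilon> / 2 \<le> c"
    then have "\<bar>t + c - \<mu>\<bar> < \<epsilon>" "t + c \<noteq> \<mu>" "\<bar>t - c - \<mu>\<bar> < \<epsilon>" "t - c \<noteq> \<mu>"
      using c(1) \<epsilon>(1) unfolding t_def by linarith+
    then show False
      using c(3) far[of "t + c"] far[of "t - c"] by linarith
  qed
  then have low: "\<epsilon> / 2 * norm x \<le> norm (A x - t *\<^sub>R x)" if "x \<in> M" for x
    using c(2)[OF that] mult_right_mono[of "\<epsilon> / 2" c "norm x"] by simp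
  define B where "B x = \<mu> *\<^sub>R x - A x" for x
  have B_mem: "B x \<in> M" if "x \<in> M" for x
    using that by (simp add: B_def MD bounded_opsD[OF Ab])
  have B_lin: "B (x + r *\<^sub>R y) = B x + r *\<^sub>R B y" if "x \<in> M" "y \<in> M" for x y r
    using that by (simp add: B_def bounded_opsD[OF Ab] MD algebra_simps)
  have B_sym: "cinner (B x) y = cinner x (B y)" if "x \<in> M" "y \<in> M" for x y
    using symmetric_onD[OF sym that] by (simp add: B_def cinner.diff_left cinner.diff_right cinner.scaleR_left cinner.scaleR_right)
  have B_sym': "inner (B x) y = inner x (B y)" if "x \<in> M" "y \<in> M" for x y
    using B_sym[OF that] by (simp add: inner_eq_Re_cinner)
  have B_pos: "0 \<le> inner (B x) x" if "x \<in> M" for x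
  proof -
    have "inner (A x) x \<le> \<mu> * norm x * norm x"
      by (rule order_trans[OF norm_cauchy_schwarz mult_right_mono[OF \<mu>(2)[OF that] norm_ge_zero]])
    moreover have "inner (B x) x = \<mu> * (norm x)\<^sup>2 - inner (A x) x"
      by (simp add: B_def inner_diff_left dot_square_norm)
    ultimately show ?thesis
      by (simp add: power2_eq_square mult.assoc)
  qed
  \<comment> \<open>Since A - t = \<epsilon> / 2 - B, squaring the lower bound at the midpoint
    leaves precisely this inequality.\<close>
  have gap: "\<epsilon> * inner (B x) x \<le> (norm (B x))\<^sup>2" if "x \<in> M" for x
  proof -
    have "(\<epsilon> / 2 * norm x)\<^sup>2 \<le> (norm (A x - t *\<^sub>R x))\<^sup>2"
      using \<epsilon>(1) by (intro power_mono low that) simp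
    also have "A x - t *\<^sub>R x = (\<epsilon> / 2) *\<^sub>R x - B x"
      by (simp add: B_def t_def algebra_simps)
    also have "(norm \<dots>)\<^sup>2 = (\<epsilon> / 2 * norm x)\<^sup>2 - \<epsilon> * inner (B x) x + (norm (B x))\<^sup>2"
      using \<epsilon>(1) unfolding norm_diff_cinner inner_eq_Re_cinner[symmetric] by (simp add: inner_commute)
    finally show ?thesis
      by simp
  qed
  \<comment> \<open>For w = B z, Cauchy-Schwarz for the form of B gives |w|^4 \<le> (B z, z) (B w,
    w), and the gap inequality bounds \<epsilon> (B z, z) by |w|^2.\<close>
  have range_low: "\<epsilon> * norm w \<le> norm (B w)" if w: "w \<in> B ` M" for w
  proof (cases "w = 0")
    case False
    obtain z where z: "z \<in> M" "w = B z"
      using w by blast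
    have wM: "w \<in> M"
      using z B_mem by simp
    have "((norm w)\<^sup>2)\<^sup>2 = (inner (B z) w)\<^sup>2"
      by (simp add: z(2) power2_norm_eq_inner)
    also have "\<dots> \<le> inner (B z) z * inner (B w) w"
      by (rule psd_cauchy_schwarz[OF M B_mem B_lin B_sym' B_pos z(1) wM])
    finally have "\<epsilon> * ((norm w)\<^sup>2)\<^sup>2 \<le> (\<epsilon> * inner (B z) z) * inner (B w) w"
      using \<epsilon>(1) by (simp add: mult.assoc)
    also have "\<dots> \<le> (norm w)\<^sup>2 * inner (B w) w"
      using gap[OF z(1)] by (intro mult_right_mono B_pos wM) (simp add: z(2))
    also have "\<dots> \<le> (norm w)\<^sup>2 * (norm (B w) * norm w)"
      by (intro mult_left_mono norm_cauchy_schwarz) simp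
    finally have "(\<epsilon> * norm w) * (norm w)^3 \<le> norm (B w) * (norm w)^3"
      by (simp add: power2_eq_square power3_eq_cube mult_ac)
    then show ?thesis
      using False by simp
  qed simp
  have sub: "complex_vector.subspace (B ` M)"
  proof (rule complex_vector.subspaceI)
    show "0 \<in> B ` M"
      using MD(1) bounded_ops_0[OF Ab M] by (intro image_eqI[of _ _ 0]) (auto simp: B_def)
  next
    fix u v assume "u \<in> B ` M" "v \<in> B ` M"
    then obtain x y where "x \<in> M" "y \<in> M" "u = B x" "v = B y"
      by blast
    then show "u + v \<in> B ` M"
      using B_lin[of x y 1] MD(2)[of x y] by (intro image_eqI[of _ _ "x + y"]) auto
  next
    fix a u assume "u \<in> B ` M"
    then obtain x where "x \<in> M" "u = B x"
      by blast
    then show "a *\<^sub>C u \<in> B ` M"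
      using MD(4)[of x a] by (intro image_eqI[of _ _ "a *\<^sub>C x"])
        (auto simp: B_def bounded_opsD[OF Ab] scaleC.diff_right scaleC.scaleR_right)
  qed
  then have cl: "closed_csubspace (closure (B ` M))"
    using closed_csubspace_closure_span[of "B ` M"] complex_vector.span_eq_iff by metis
  have "M \<inter> orth_compl (closure (B ` M)) \<subseteq> {0}"
  proof
    fix y assume y: "y \<in> M \<inter> orth_compl (closure (B ` M))"
    then have "cinner (B (B y)) y = 0"
      using B_mem by (auto simp: orth_compl_closure dest: orth_complD)
    then have "cinner (B y) (B y) = 0"
      using B_sym[OF B_mem, of y y] y by simp
    then show "y \<in> {0}"
      using ker[of y] y by (simp add: cinner_self B_def)
  qed
  moreover have "closure (B ` M) \<subseteq> M"
    using B_mem MD(7) by (intro closure_minimal) auto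
  ultimately have dense: "M \<subseteq> closure (B ` M)"
    using subset_of_orth_compl_trivial[OF cl M] by blast
  have "\<epsilon> * norm x \<le> norm (A x - complex_of_real \<mu> *\<^sub>C x)" if x: "x \<in> M" for x
  proof -
    obtain w where w: "\<And>n. w n \<in> B ` M" "w \<longlonglongrightarrow> x"
      using subsetD[OF dense x] unfolding closure_sequential by metis
    have wM: "w n \<in> M" for n
      using w(1)[of n] by (elim imageE) (simp add: B_mem)
    have "(\<lambda>n. \<epsilon> * norm (w n)) \<longlonglongrightarrow> \<epsilon> * norm x" "(\<lambda>n. norm (B (w n))) \<longlonglongrightarrow> norm (B x)"
      unfolding B_def by (intro tendsto_intros w(2) bounded_ops_tendsto[OF Ab M wM])+
    then have "\<epsilon> * norm x \<le> norm (B x)"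
      by (rule LIMSEQ_le) (use range_low[OF w(1)] in simp)
    then show ?thesis
      by (simp add: B_def norm_minus_commute flip: scaleR_scaleC)
  qed
  then show False
    using not_in_spectrum_if_bounded_below[OF M Ab sym \<epsilon>(1)] \<mu>(3) by blast
qed

section \<open>Finite-dimensional subspaces\<close>

lemma orthonormal_uptoD:
  assumes "orthonormal_upto n x" "i \<in> {1..n}" "j \<in> {1..n}"
  shows "cinner (x i) (x j) = (if i = j then 1 else 0)"
  using assms by (simp add: orthonormal_upto_def)

lemma orthonormal_upto_norm:
  assumes "orthonormal_upto n x" "i \<in> {1..n}"
  shows "norm (x i) = 1"
  using orthonormal_uptoD[OF assms(1,2,2)] by (intro norm_eq_1_if_cinner) simp

lemma orthonormal_upto_mono: "orthonormal_upto n x \<Longrightarrow> m \<le> n \<Longrightarrow> orthonormal_upto m x"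
  by (auto simp: orthonormal_upto_def)

text \<open>Describing the span as the solution set of a continuous equation makes it closed, and
  recovers vectors as limits of their coordinates.\<close>

lemma orthonormal_span_iff:
  assumes x: "orthonormal_upto n x"
  shows "v \<in> complex_vector.span (x ` {1..n}) \<longleftrightarrow> v = (\<Sum>i=1..n. cinner v (x i) *\<^sub>C x i)"
proof
  let ?S = "{v. v = (\<Sum>i=1..n. cinner v (x i) *\<^sub>C x i)}"
  have sub: "complex_vector.subspace ?S"
  proof (rule complex_vector.subspaceI)
    show "0 \<in> ?S"
      by (simp add: cinner.zero_left)
    fix u v assume "u \<in> ?S" "v \<in> ?S"
    then have "u + v = (\<Sum>i=1..n. cinner u (x i) *\<^sub>C x i) + (\<Sum>i=1..n. cinner v (x i) *\<^sub>C x i)"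
      by simp
    also have "\<dots> = (\<Sum>i=1..n. cinner (u + v) (x i) *\<^sub>C x i)"
      by (simp only: cinner_add_left scaleC_add_left sum.distrib)
    finally show "u + v \<in> ?S"
      by (rule CollectI)
  next
    fix a v assume "v \<in> ?S"
    then have "a *\<^sub>C v = a *\<^sub>C (\<Sum>i=1..n. cinner v (x i) *\<^sub>C x i)"
      by simp
    also have "\<dots> = (\<Sum>i=1..n. cinner (a *\<^sub>C v) (x i) *\<^sub>C x i)"
      by (simp only: cinner_scaleC_left complex_vector.scale_sum_right scaleC_scaleC)
    finally show "a *\<^sub>C v \<in> ?S"
      by (rule CollectI)
  qed
  have base: "x ` {1..n} \<subseteq> ?S"
  proof
    fix v assume "v \<in> x ` {1..n}"
    then obtain j where j: "j \<in> {1..n}" "v = x j"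
      by blast
    have "(\<Sum>i=1..n. cinner v (x i) *\<^sub>C x i) = (\<Sum>i=1..n. if j = i then x i else 0)"
      using orthonormal_uptoD[OF x j(1)] by (intro sum.cong) (auto simp: j(2) scaleC_one)
    then show "v \<in> ?S"
      using j by simp
  qed
  assume "v \<in> complex_vector.span (x ` {1..n})"
  then show "v = (\<Sum>i=1..n. cinner v (x i) *\<^sub>C x i)"
    using complex_vector.span_minimal[OF base sub] by blast
next
  assume v: "v = (\<Sum>i=1..n. cinner v (x i) *\<^sub>C x i)"
  show "v \<in> complex_vector.span (x ` {1..n})"
    by (subst v) (intro complex_vector.span_sum complex_vector.span_scale complex_vector.span_base imageI)
qed

lemma closed_csubspace_span_orthonormal:
  assumes "orthonormal_upto n x"
  shows "closed_csubspace (complex_vector.span (x ` {1..n}))"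
proof -
  have "complex_vector.span (x ` {1..n}) = {v. v = (\<Sum>i=1..n. cinner v (x i) *\<^sub>C x i)}"
    using orthonormal_span_iff[OF assms] by blast
  moreover have "closed {v. v = (\<Sum>i=1..n. cinner v (x i) *\<^sub>C x i)}"
    by (intro closed_Collect_eq continuous_intros scaleC.continuous_on cinner.continuous_on)
  ultimately have "closed (complex_vector.span (x ` {1..n}))"
    by (simp only:)
  then show ?thesis
    by (simp add: closed_csubspace_def complex_vector.subspace_span)
qed

lemma orthonormal_upto_append:
  assumes x: "orthonormal_upto m x" and y: "orthonormal_upto n y"
    and xy: "\<And>i j. i \<in> {1..m} \<Longrightarrow> j \<in> {1..n} \<Longrightarrow> cinner (y j) (x i) = 0"
  shows "orthonormal_upto (m + n) (\<lambda>j. if j \<le> m then x j else y (j - m))"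
  unfolding orthonormal_upto_def
proof (intro ballI)
  fix i j assume ij: "i \<in> {1..m + n}" "j \<in> {1..m + n}"
  have yx: "cinner (x i) (y j) = 0" if "i \<in> {1..m}" "j \<in> {1..n}" for i j
    using xy[OF that] by (simp add: cinner_eq_0_commute)
  consider "i \<le> m" "j \<le> m" | "i \<le> m" "m < j" | "m < i" "j \<le> m" | "m < i" "m < j"
    by linarith
  then show "cinner (if i \<le> m then x i else y (i - m)) (if j \<le> m then x j else y (j - m)) = (if i = j then 1 else 0)"
  proof cases
    case 1
    then show ?thesis
      using orthonormal_uptoD[OF x, of i j] ij by simp
  next
    case 2
    then have "i \<in> {1..m}" "j - m \<in> {1..n}"
      using ij by auto
    from yx[OF this] show ?thesis
      using 2 by simp
  next
    case 3
    then have "j \<in> {1..m}" "i - m \<in> {1..n}"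
      using ij by auto
    from xy[OF this] show ?thesis
      using 3 by simp
  next
    case 4
    then have "i - m \<in> {1..n}" "j - m \<in> {1..n}"
      using ij by auto
    from orthonormal_uptoD[OF y this] show ?thesis
      using 4 by auto
  qed
qed

lemma append_mem:
  fixes j m n :: nat
  assumes "\<And>i. i \<in> {1..m} \<Longrightarrow> x i \<in> V" "\<And>i. i \<in> {1..n} \<Longrightarrow> y i \<in> V" "j \<in> {1..m + n}"
  shows "(if j \<le> m then x j else y (j - m)) \<in> V"
proof (cases "j \<le> m")
  case False
  then have "j - m \<in> {1..n}"
    using assms(3) by auto
  then show ?thesis
    using False assms(2) by simp
qed (use assms(1,3) in simp)

lemma orthonormal_upto_extend:
  assumes x: "orthonormal_upto n x" "\<And>j. j \<in> {1..n} \<Longrightarrow> x j \<in> V" and V: "complex_vector.subspace V"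
    and v: "v \<in> V" "v \<notin> complex_vector.span (x ` {1..n})"
  obtains y where "orthonormal_upto (Suc n) y" "\<And>j. j \<in> {1..Suc n} \<Longrightarrow> y j \<in> V"
proof -
  let ?W = "complex_vector.span (x ` {1..n})"
  have W: "closed_csubspace ?W"
    by (rule closed_csubspace_span_orthonormal[OF x(1)])
  define w where "w = v - orth_proj ?W v"
  have "?W \<subseteq> V"
    using x(2) V by (intro complex_vector.span_minimal) auto
  then have wV: "w \<in> V"
    using v(1) orth_proj_mem[OF W, of v] V unfolding w_def by (intro complex_vector.subspace_diff) auto
  have w0: "w \<noteq> 0"
    using v(2) orth_proj_mem[OF W, of v] by (auto simp: w_def)
  define u where "u = complex_of_real (1 / norm w) *\<^sub>C w"
  have u: "cinner u u = 1"
    using w0 by (simp add: u_def cinner_self norm_scaleC norm_divide)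
  have orth: "cinner u (x i) = 0" if "i \<in> {1..n}" for i
    using orth_proj_orth[OF W complex_vector.span_base, of "x i" v] that by (simp add: u_def w_def cinner_scaleC_left)
  have "orthonormal_upto (n + 1) (\<lambda>j. if j \<le> n then x j else u)"
    using orthonormal_upto_append[OF x(1), of 1 "\<lambda>_. u"] u orth by (simp add: orthonormal_upto_def)
  moreover have "(if j \<le> n then x j else u) \<in> V" if "j \<in> {1..Suc n}" for j
    using x(2) that wV V by (auto simp: u_def intro: complex_vector.subspace_scale)
  ultimately show thesis
    using that by simp
qed

text \<open>The alternative mirrors the two cases of \<open>pk_norming\<close>: either k vectors are
  found, or the vectors found already span V.\<close>

lemma orthonormal_upto_exists:
  assumes V: "complex_vector.subspace V"
  obtains n x where "n \<le> k" "orthonormal_upto n x" "\<And>j. j \<in> {1..n} \<Longrightarrow> x j \<in> V"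
    "n = k \<or> V \<subseteq> complex_vector.span (x ` {1..n})"
proof -
  have "\<exists>n x. n \<le> k \<and> orthonormal_upto n x \<and> (\<forall>j\<in>{1..n}. x j \<in> V) \<and>
    (n = k \<or> V \<subseteq> complex_vector.span (x ` {1..n}))"
  proof (induction k)
    case 0
    then show ?case
      by (intro exI[of _ 0]) (simp add: orthonormal_upto_def)
  next
    case (Suc k)
    then obtain n x where x: "n \<le> k" "orthonormal_upto n x" "\<forall>j\<in>{1..n}. x j \<in> V"
      "n = k \<or> V \<subseteq> complex_vector.span (x ` {1..n})"
      by blast
    show ?case
    proof (cases "V \<subseteq> complex_vector.span (x ` {1..n})")
      case True
      then show ?thesis
        using x by (intro exI[of _ n] exI[of _ x]) auto
    next
      case False
      then obtain v where "v \<in> V" "v \<notin> complex_vector.span (x ` {1..n})"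
        by blast
      then obtain y where "orthonormal_upto (Suc n) y" "\<And>j. j \<in> {1..Suc n} \<Longrightarrow> y j \<in> V"
        using orthonormal_upto_extend[OF x(2) _ V] x(3) by metis
      then show ?thesis
        using x False by (intro exI[of _ "Suc n"] exI[of _ y]) auto
    qed
  qed
  then show thesis
    using that by blast
qed

lemma orthonormal_upto_independent:
  assumes x: "orthonormal_upto n x"
  shows "complex_vector.independent (x ` {1..n})" "card (x ` {1..n}) = n"
proof -
  have inj: "inj_on x {1..n}"
    using orthonormal_uptoD[OF x] by (intro inj_onI) (metis zero_neq_one)
  show "complex_vector.independent (x ` {1..n})"
  proof (rule complex_vector.independent_if_scalars_zero)
    fix f v assume 0: "(\<Sum>v\<in>x ` {1..n}. f v *\<^sub>C v) = 0" and "v \<in> x ` {1..n}"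
    then obtain j where j: "j \<in> {1..n}" "v = x j"
      by blast
    have "0 = cinner (\<Sum>v\<in>x ` {1..n}. f v *\<^sub>C v) (x j)"
      by (simp only: 0 cinner.zero_left)
    also have "\<dots> = cinner (\<Sum>i=1..n. f (x i) *\<^sub>C x i) (x j)"
      by (simp only: sum.reindex[OF inj] o_def)
    also have "\<dots> = (\<Sum>i=1..n. f (x i) * cinner (x i) (x j))"
      by (simp add: cinner.sum_left cinner_scaleC_left)
    also have "\<dots> = (\<Sum>i=1..n. if i = j then f (x i) else 0)"
      using orthonormal_uptoD[OF x _ j(1)] by (intro sum.cong) auto
    also have "\<dots> = f v"
      using j by simp
    finally show "f v = 0"
      by simp
  qed simp
  show "card (x ` {1..n}) = n"
    using card_image[OF inj] by simp
qed

lemma finite_dim_subset: "finite_dim W \<Longrightarrow> V \<subseteq> W \<Longrightarrow> finite_dim V"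
  by (auto simp: finite_dim_def)

lemma finite_dim_span: "finite B \<Longrightarrow> finite_dim (complex_vector.span B)"
  by (auto simp: finite_dim_def)

lemma dim_span_orthonormal:
  "orthonormal_upto n x \<Longrightarrow> complex_vector.dim (complex_vector.span (x ` {1..n})) = n"
  using orthonormal_upto_independent complex_vector.dim_span_eq_card_independent by metis

lemma finite_dim_orthonormal_basis:
  assumes V: "complex_vector.subspace V" and fin: "finite_dim V"
  obtains x where "orthonormal_upto (complex_vector.dim V) x"
    "V = complex_vector.span (x ` {1..complex_vector.dim V})"
proof -
  obtain B where B: "finite B" "V \<subseteq> complex_vector.span B"
    using fin by (auto simp: finite_dim_def)
  \<comment> \<open>Asking for one vector more than B has rules out the first alternative, since
    orthonormal vectors in the span of B number at most \<open>card B\<close>.\<close>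
  obtain n x where x: "n \<le> Suc (card B)" "orthonormal_upto n x" "\<And>j. j \<in> {1..n} \<Longrightarrow> x j \<in> V"
    "n = Suc (card B) \<or> V \<subseteq> complex_vector.span (x ` {1..n})"
    using orthonormal_upto_exists[OF V, of "Suc (card B)"] by metis
  have "x ` {1..n} \<subseteq> complex_vector.span B"
    using x(3) B(2) by blast
  then have "n \<le> card B"
    using complex_vector.independent_span_bound[OF B(1) orthonormal_upto_independent(1)[OF x(2)]]
    unfolding orthonormal_upto_independent(2)[OF x(2)] by blast
  then have "V \<subseteq> complex_vector.span (x ` {1..n})"
    using x(4) by simp
  moreover have "complex_vector.span (x ` {1..n}) \<subseteq> V"
    using x(3) V by (intro complex_vector.span_minimal) auto
  ultimately have "V = complex_vector.span (x ` {1..n})"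
    by simp
  moreover from this have "complex_vector.dim V = n"
    using dim_span_orthonormal[OF x(2)] by simp
  ultimately show thesis
    using that x(2) by simp
qed

lemma orthonormal_upto_le_dim:
  assumes V: "complex_vector.subspace V" and fin: "finite_dim V"
    and x: "orthonormal_upto n x" "\<And>j. j \<in> {1..n} \<Longrightarrow> x j \<in> V"
  shows "n \<le> complex_vector.dim V"
proof -
  obtain e where e: "orthonormal_upto (complex_vector.dim V) e"
    "V = complex_vector.span (e ` {1..complex_vector.dim V})"
    using finite_dim_orthonormal_basis[OF V fin] .
  have "x ` {1..n} \<subseteq> complex_vector.span (e ` {1..complex_vector.dim V})"
    using x(2) by (subst e(2)[symmetric]) auto
  from complex_vector.independent_span_bound[OF _ orthonormal_upto_independent(1)[OF x(1)] this]
  have "card (x ` {1..n}) \<le> card (e ` {1..complex_vector.dim V})"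
    by simp
  then show ?thesis
    unfolding orthonormal_upto_independent(2)[OF x(1)] orthonormal_upto_independent(2)[OF e(1)] .
qed

lemma finite_dim_closed:
  assumes "complex_vector.subspace V" "finite_dim V"
  shows "closed_csubspace V"
proof -
  obtain x where x: "orthonormal_upto (complex_vector.dim V) x"
    "V = complex_vector.span (x ` {1..complex_vector.dim V})"
    using finite_dim_orthonormal_basis[OF assms] .
  show ?thesis
    by (subst x(2)) (rule closed_csubspace_span_orthonormal[OF x(1)])
qed

lemma finite_family_convergent_subseq:
  fixes c :: "nat \<Rightarrow> nat \<Rightarrow> complex"
  assumes "\<And>i k. cmod (c i k) \<le> C"
  shows "\<exists>r. strict_mono r \<and> (\<forall>i\<in>{1..n}. convergent (\<lambda>k. c i (r k)))"
proof (induction n)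
  case 0
  then show ?case
    by (intro exI[of _ id]) (simp add: strict_mono_def)
next
  case (Suc n)
  then obtain r where r: "strict_mono r" "\<forall>i\<in>{1..n}. convergent (\<lambda>k. c i (r k))"
    by blast
  have "bounded (range (\<lambda>k. c (Suc n) (r k)))"
    using assms by (intro boundedI) auto
  then obtain l s where s: "strict_mono s" "((\<lambda>k. c (Suc n) (r k)) \<circ> s) \<longlonglongrightarrow> l"
    using bounded_imp_convergent_subsequence by blast
  have "convergent (\<lambda>k. c i ((r \<circ> s) k))" if "i \<in> {1..Suc n}" for i
  proof (cases "i = Suc n")
    case True
    then show ?thesis
      using s(2) by (auto simp: convergent_def o_def)
  next
    case False
    then have "convergent (\<lambda>k. c i (r k))"
      using r(2) that by auto
    from convergent_subseq_convergent[OF this s(1)] show ?thesis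
      by (simp add: o_def)
  qed
  then show ?case
    using strict_mono_o[OF r(1) s(1)] by blast
qed

lemma finite_dim_convergent_subseq:
  assumes V: "complex_vector.subspace V" "finite_dim V"
    and f: "\<And>k. f k \<in> V" "\<And>k. norm (f k) \<le> C"
  shows "\<exists>r::nat \<Rightarrow> nat. strict_mono r \<and> convergent (\<lambda>k. f (r k))"
proof -
  obtain n e where e: "orthonormal_upto n e" "V = complex_vector.span (e ` {1..n})"
    using finite_dim_orthonormal_basis[OF V] .
  \<comment> \<open>The coordinates are set to 0 off the index range because the extraction lemma
    asks for one bound over all i.\<close>
  let ?c = "\<lambda>i k. if i \<in> {1..n} then cinner (f k) (e i) else 0"
  have "cmod (?c i k) \<le> C" for i k
    using norm_cinner_le[of "f k" "e i"] orthonormal_upto_norm[OF e(1), of i] order_trans[OF norm_ge_zero f(2)[of k]] f(2)[of k]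
    by auto
  then obtain r where r: "strict_mono r" "\<forall>i\<in>{1..n}. convergent (\<lambda>k. ?c i (r k))"
    using finite_family_convergent_subseq[of ?c C n] by blast
  then have "\<forall>i\<in>{1..n}. \<exists>l. (\<lambda>k. cinner (f (r k)) (e i)) \<longlonglongrightarrow> l"
    by (simp add: convergent_def)
  then obtain l where l: "\<And>i. i \<in> {1..n} \<Longrightarrow> (\<lambda>k. cinner (f (r k)) (e i)) \<longlonglongrightarrow> l i"
    by metis
  have "(\<lambda>k. \<Sum>i=1..n. cinner (f (r k)) (e i) *\<^sub>C e i) \<longlonglongrightarrow> (\<Sum>i=1..n. l i *\<^sub>C e i)"
    by (intro tendsto_sum scaleC.tendsto l tendsto_const)
  moreover have "(\<Sum>i=1..n. cinner (f (r k)) (e i) *\<^sub>C e i) = f (r k)" for k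
    using f(1)[of "r k"] orthonormal_span_iff[OF e(1)] e(2) by metis
  ultimately show ?thesis
    using r(1) by (auto simp: convergent_def)
qed

section \<open>The recursion for the s-numbers\<close>

lemma subspace_image:
  assumes A: "A \<in> bounded_ops M N" and M: "closed_csubspace M"
  shows "complex_vector.subspace (A ` M)"
proof (rule complex_vector.subspaceI)
  show "0 \<in> A ` M"
    using bounded_ops_0[OF A M] closed_csubspaceD(1)[OF M] by (metis image_eqI)
  show "a *\<^sub>C u \<in> A ` M" if "u \<in> A ` M" for a u
    using that closed_csubspaceD(4)[OF M] by (auto simp flip: bounded_opsD(3)[OF A])
  show "u + v \<in> A ` M" if "u \<in> A ` M" "v \<in> A ` M" for u v
    using that closed_csubspaceD(2)[OF M] by (auto simp flip: bounded_opsD(2)[OF A])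
qed

lemma eigenspace_of_real: "eigenspace M A (complex_of_real t) = {x\<in>M. A x = t *\<^sub>R x}"
  by (simp add: eigenspace_def scaleR_scaleC)

lemma closed_csubspace_eigenspace:
  assumes A: "A \<in> bounded_ops M M" and M: "closed_csubspace M"
  shows "closed_csubspace (eigenspace M A z)"
  unfolding closed_csubspace_def
proof
  show "complex_vector.subspace (eigenspace M A z)"
    by (rule complex_vector.subspaceI)
      (auto simp: eigenspace_def closed_csubspaceD[OF M] bounded_ops_0[OF A M] bounded_opsD(2,3)[OF A]
        scaleC_add_right scaleC_scaleC mult.commute)
  show "closed (eigenspace M A z)"
    unfolding closed_sequential_limits
  proof (intro allI impI, elim conjE)
    fix x l assume x: "\<forall>n. x n \<in> eigenspace M A z" "x \<longlonglongrightarrow> l"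
    then have xM: "x n \<in> M" and eq: "A (x n) = z *\<^sub>C x n" for n
      by (auto simp: eigenspace_def)
    have "(\<lambda>n. A (x n)) \<longlonglongrightarrow> A l"
      by (rule bounded_ops_tendsto[OF A M xM x(2)])
    moreover have "(\<lambda>n. A (x n)) \<longlonglongrightarrow> z *\<^sub>C l"
      unfolding eq by (intro scaleC.tendsto tendsto_const x)
    ultimately have "A l = z *\<^sub>C l"
      by (rule LIMSEQ_unique)
    then show "l \<in> eigenspace M A z"
      using closed_sequentially[OF closed_csubspaceD(7)[OF M] xM x(2)] by (simp add: eigenspace_def)
  qed
qed

text \<open>Verbatim the operator in the recursive call of \<open>op_lambda\<close>.\<close>

definition deflate :: "'a::complex_hilbert set \<Rightarrow> ('a \<Rightarrow> 'a) \<Rightarrow> 'a \<Rightarrow> 'a" where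
  "deflate M A = (\<lambda>x\<in>M. A x - spec_sup M A *\<^sub>R orth_proj (eigenspace M A (complex_of_real (spec_sup M A))) x)"

lemma op_lambda_zero:
  assumes "closed_csubspace M" "\<And>x. x \<in> M \<Longrightarrow> A x = 0" "1 \<le> j"
  shows "op_lambda M A j = 0"
proof -
  have img: "A ` M = {0}"
    using assms closed_csubspaceD(1)[OF assms(1)] by force
  have "complex_vector.dim {0::'a} = 0"
    using complex_vector.dim_le_card[of "{0::'a}" "{}"] by (simp add: complex_vector.span_empty)
  then have "finite_rank M A" "op_rank M A = 0"
    unfolding finite_rank_def op_rank_def img
    by (auto simp: finite_dim_def intro!: exI[of _ "{0}"] complex_vector.span_superset)
  then show ?thesis
    using assms(3) by (subst op_lambda.simps) (simp add: Let_def)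
qed

context
  fixes M :: "'a::complex_hilbert set" and A :: "'a \<Rightarrow> 'a" and \<mu> and E
  assumes M: "closed_csubspace M" and A: "positive_op M A" and ne: "M \<noteq> {0}"
  defines \<mu>: "\<mu> \<equiv> spec_sup M A" and E: "E \<equiv> eigenspace M A (complex_of_real (spec_sup M A))"
begin

lemma top_eigenspaceD: "x \<in> E \<Longrightarrow> x \<in> M" "x \<in> E \<Longrightarrow> A x = \<mu> *\<^sub>R x"
  by (auto simp: E \<mu> eigenspace_of_real)

lemma top_eigenspaceI: "x \<in> M \<Longrightarrow> A x = \<mu> *\<^sub>R x \<Longrightarrow> x \<in> E"
  by (auto simp: E \<mu> eigenspace_of_real)

lemma top_eigenspace_closed: "closed_csubspace E"
  unfolding E by (rule closed_csubspace_eigenspace[OF positive_opD(1)[OF A M] M])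

lemma top_eigenspace_subset_range: "0 < \<mu> \<Longrightarrow> E \<subseteq> A ` M"
proof
  fix x assume "0 < \<mu>" "x \<in> E"
  then have "A ((1 / \<mu>) *\<^sub>R x) = x" "(1 / \<mu>) *\<^sub>R x \<in> M"
    by (simp_all add: bounded_opsD(4)[OF positive_opD(1)[OF A M]] top_eigenspaceD closed_csubspaceD[OF M])
  then show "x \<in> A ` M"
    by force
qed

lemma spec_sup_pos: "x \<in> M \<Longrightarrow> A x \<noteq> 0 \<Longrightarrow> 0 < \<mu>"
  using norm_le_spec_sup[OF M A ne, of x] spec_sup_nonneg[OF M A ne]
  by (auto simp: \<mu> less_le)

lemma deflate_eq': "x \<in> M \<Longrightarrow> deflate M A x = A x - \<mu> *\<^sub>R orth_proj E x"
  unfolding deflate_def[of M A, folded E \<mu>] by simp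

text \<open>In this form it is visible that the range stays inside that of A and that A is unchanged
  on the complement of E.\<close>

lemma deflate_eq: "x \<in> M \<Longrightarrow> deflate M A x = A (x - orth_proj E x)"
  using orth_proj_mem[OF top_eigenspace_closed, of x] bounded_ops_diff[OF positive_opD(1)[OF A M] M, of x "orth_proj E x"]
  by (simp add: deflate_eq' top_eigenspaceD)

lemma diff_orth_proj_top: "x \<in> M \<Longrightarrow> x - orth_proj E x \<in> M"
  using orth_proj_mem[OF top_eigenspace_closed, of x] by (simp add: closed_csubspaceD[OF M] top_eigenspaceD)

lemma op_orth_compl_top: "x \<in> M \<Longrightarrow> x \<in> orth_compl E \<Longrightarrow> A x \<in> orth_compl E"
  using symmetric_onD[OF positive_opD(2)[OF A M]]
  by (auto intro!: orth_complI dest: orth_complD simp: top_eigenspaceD cinner.scaleR_right)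

lemma deflate_orth: "x \<in> M \<Longrightarrow> deflate M A x \<in> orth_compl E"
  by (simp add: deflate_eq op_orth_compl_top diff_orth_proj_top diff_orth_proj_mem[OF top_eigenspace_closed])

lemma deflate_positive: "positive_op M (deflate M A)"
  unfolding positive_op_iff[OF M]
proof (intro conjI ballI)
  note Ab = positive_opD(1)[OF A M] and MD = closed_csubspaceD[OF M] and Ec = top_eigenspace_closed
  have P: "orth_proj E x \<in> M" for x
    using orth_proj_mem[OF Ec] top_eigenspaceD by blast
  show "deflate M A \<in> bounded_ops M M"
  proof (rule bounded_opsI[where C = \<mu>])
    fix x assume x: "x \<in> M"
    show "deflate M A x \<in> M"
      unfolding deflate_eq[OF x] by (rule bounded_opsD(1)[OF Ab diff_orth_proj_top[OF x]])
    have "norm (x - orth_proj E x) \<le> norm x"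
      by (rule power2_le_imp_le) (use orth_proj_pythagoras[OF Ec, of x] in simp_all)
    then have "\<mu> * norm (x - orth_proj E x) \<le> \<mu> * norm x"
      using spec_sup_nonneg[OF M A ne] by (intro mult_left_mono) (simp_all add: \<mu>)
    then show "norm (deflate M A x) \<le> \<mu> * norm x"
      using norm_le_spec_sup[OF M A ne diff_orth_proj_top[OF x]] by (simp add: deflate_eq[OF x] \<mu>)
    show "deflate M A (a *\<^sub>C x) = a *\<^sub>C deflate M A x" for a
      using x by (simp add: deflate_eq' MD bounded_opsD(3)[OF Ab] orth_proj_scaleC[OF Ec] scaleC.diff_right scaleC.scaleR_right)
    show "deflate M A (x + y) = deflate M A x + deflate M A y" if "y \<in> M" for y
      using x that by (simp add: deflate_eq' MD bounded_opsD(2)[OF Ab] orth_proj_add[OF Ec] algebra_simps)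
  qed (simp add: deflate_def)
  have PP: "cinner (orth_proj E x) y = cinner x (orth_proj E y)" for x y
    using orth_proj_cinner[OF Ec orth_proj_mem[OF Ec], of x y] orth_proj_cinner[OF Ec orth_proj_mem[OF Ec], of y x]
    by (metis cinner_commute)
  show "symmetric_on M (deflate M A)"
    unfolding symmetric_on_def
    using symmetric_onD[OF positive_opD(2)[OF A M]]
    by (simp add: deflate_eq' cinner.diff_left cinner.diff_right cinner.scaleR_left cinner.scaleR_right PP)
  fix x assume x: "x \<in> M"
  have "cinner (deflate M A x) (orth_proj E x) = 0"
    by (rule orth_complD(1)[OF deflate_orth[OF x] orth_proj_mem[OF Ec]])
  then have "inner (deflate M A x) x = inner (deflate M A x) (x - orth_proj E x)"
    by (simp add: inner_eq_Re_cinner cinner.diff_right)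
  then show "0 \<le> inner (deflate M A x) x"
    using positive_opD(3)[OF A M diff_orth_proj_top[OF x]] by (simp add: deflate_eq[OF x])
qed

text \<open>For \<mu> > 0 the eigenspace lies in the range, so the rank is infinite too: the zero
  branch is skipped and the essential branch is taken for every j.\<close>

lemma op_lambda_infinite_eigenspace:
  assumes "0 < \<mu>" "\<not> finite_dim E"
  shows "op_lambda M A j = \<mu>"
proof -
  have "\<not> finite_rank M A"
    using finite_dim_subset[OF _ top_eigenspace_subset_range[OF assms(1)]] assms(2) by (auto simp: finite_rank_def)
  moreover have "complex_of_real \<mu> \<in> ess_spectrum M A"
    using assms(2) spec_sup_in_spectrum[OF M A ne] by (simp add: ess_spectrum_def E \<mu>)
  ultimately show ?thesis
    unfolding op_lambda.simps[of M A j, unfolded Let_def, folded \<mu>] by simp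
qed

lemma op_lambda_ess:
  assumes "complex_of_real \<mu> \<in> ess_spectrum M A" "\<not> finite_rank M A"
  shows "op_lambda M A j = \<mu>"
  using assms unfolding op_lambda.simps[of M A j, unfolded Let_def, folded \<mu>] by simp

text \<open>E and the range of the deflated operator are orthogonal subspaces of the range of A, so
  their orthonormal bases concatenate.\<close>

lemma deflate_rank:
  assumes pos: "0 < \<mu>" and fr: "finite_rank M A"
  shows "finite_rank M (deflate M A)" "op_rank M (deflate M A) + complex_vector.dim E \<le> op_rank M A"
    "complex_vector.dim E \<le> op_rank M A"
proof -
  note Ab = positive_opD(1)[OF A M] and Db = positive_opD(1)[OF deflate_positive M]
  have sub: "deflate M A ` M \<subseteq> A ` M"
    using deflate_eq diff_orth_proj_top by auto
  have fD: "finite_dim (deflate M A ` M)" and fE: "finite_dim E"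
    using fr finite_dim_subset sub top_eigenspace_subset_range[OF pos] by (auto simp: finite_rank_def)
  show "finite_rank M (deflate M A)"
    using fD by (simp add: finite_rank_def)
  obtain y where y: "orthonormal_upto (op_rank M (deflate M A)) y"
    "deflate M A ` M = complex_vector.span (y ` {1..op_rank M (deflate M A)})"
    using finite_dim_orthonormal_basis[OF subspace_image[OF Db M] fD] unfolding op_rank_def .
  obtain x where x: "orthonormal_upto (complex_vector.dim E) x"
    "E = complex_vector.span (x ` {1..complex_vector.dim E})"
    using finite_dim_orthonormal_basis[OF closed_csubspaceD(8)[OF top_eigenspace_closed] fE] .
  have xE: "x i \<in> E" if "i \<in> {1..complex_vector.dim E}" for i
    by (subst x(2)) (intro complex_vector.span_base imageI that)
  have yD: "y j \<in> deflate M A ` M" if "j \<in> {1..op_rank M (deflate M A)}" for j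
    by (subst y(2)) (intro complex_vector.span_base imageI that)
  have xy: "cinner (y j) (x i) = 0" if ij: "i \<in> {1..complex_vector.dim E}" "j \<in> {1..op_rank M (deflate M A)}" for i j
  proof -
    from yD[OF ij(2)] obtain u where "u \<in> M" "y j = deflate M A u"
      by (elim imageE)
    then show ?thesis
      using orth_complD(1)[OF deflate_orth xE[OF ij(1)]] by simp
  qed
  have xA: "x i \<in> A ` M" if "i \<in> {1..complex_vector.dim E}" for i
    using xE[OF that] top_eigenspace_subset_range[OF pos] by blast
  have yA: "y j \<in> A ` M" if "j \<in> {1..op_rank M (deflate M A)}" for j
    using yD[OF that] sub by blast
  have "complex_vector.dim E + op_rank M (deflate M A) \<le> op_rank M A"
    unfolding op_rank_def[of M A]
    by (rule orthonormal_upto_le_dim[OF subspace_image[OF Ab M] _ orthonormal_upto_append[OF x(1) y(1) xy]])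
      (use fr in \<open>simp add: finite_rank_def\<close>, assumption, assumption, erule append_mem[rotated 2], erule xA, erule yA)
  then show "op_rank M (deflate M A) + complex_vector.dim E \<le> op_rank M A"
    "complex_vector.dim E \<le> op_rank M A"
    by auto
qed

text \<open>The recursion equation freed of its rank test: if the test fires for A at j, the rank
  inequality makes it fire for the deflated operator at the shifted index, so both sides are
  0.\<close>

lemma op_lambda_isolated:
  assumes pos: "0 < \<mu>" and fin: "finite_dim E" and E0: "E \<noteq> {0}"
    and iso: "\<not> complex_of_real \<mu> islimpt spectrum M A" and j: "1 \<le> j"
  shows "op_lambda M A j = (if j \<le> complex_vector.dim E then \<mu> else op_lambda M (deflate M A) (j - complex_vector.dim E))"
proof -
  have ess: "complex_of_real \<mu> \<notin> ess_spectrum M A"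
    using fin iso by (simp add: ess_spectrum_def E \<mu>)
  obtain x where "E = complex_vector.span (x ` {1..complex_vector.dim E})"
    using finite_dim_orthonormal_basis[OF closed_csubspaceD(8)[OF top_eigenspace_closed] fin] .
  then have "E \<subseteq> {0}" if "complex_vector.dim E = 0"
    using that by (simp add: complex_vector.span_empty)
  then have m0: "complex_vector.dim E \<noteq> 0"
    using E0 closed_csubspaceD(1)[OF top_eigenspace_closed] by blast
  have defl: "(\<lambda>x\<in>M. A x - \<mu> *\<^sub>R orth_proj E x) = deflate M A"
    by (simp add: deflate_def E \<mu>)
  show ?thesis
  proof (cases "finite_rank M A \<and> op_rank M A < j")
    case True
    then have 1: "complex_vector.dim E < j" "finite_rank M (deflate M A)"
      "op_rank M (deflate M A) < j - complex_vector.dim E"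
      using deflate_rank[OF pos] by auto
    have "op_lambda M A j = 0"
      using True by (subst op_lambda.simps) (simp add: Let_def)
    moreover have "op_lambda M (deflate M A) (j - complex_vector.dim E) = 0"
      using 1 by (subst op_lambda.simps) (simp add: Let_def)
    ultimately show ?thesis
      using 1 by simp
  next
    case False
    then show ?thesis
      using ess m0 unfolding op_lambda.simps[of M A j, unfolded Let_def, folded E \<mu>, unfolded defl] by auto
  qed
qed

end

section \<open>Operators that are essentially scalar\<close>

text \<open>
  For R the modulus of a restriction of T, this is what remains of the decomposition
  \<open>|T| = \<alpha> + K + F\<close>: the first part says that \<open>R\<^sup>2 - \<alpha>\<^sup>2\<close> is compact, the second that it is positive up
  to finite rank.
\<close>

definition ess_scalar :: "'a::complex_hilbert set \<Rightarrow> ('a \<Rightarrow> 'a) \<Rightarrow> real \<Rightarrow> bool" where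
  "ess_scalar M R \<alpha> \<longleftrightarrow>
     (\<forall>x. (\<forall>n. x n \<in> M \<and> norm (x n) \<le> 1) \<longrightarrow>
       (\<exists>r::nat \<Rightarrow> nat. strict_mono r \<and> convergent (\<lambda>n. R (R (x (r n))) - \<alpha>\<^sup>2 *\<^sub>R x (r n)))) \<and>
     (\<exists>B. finite B \<and> (\<forall>x\<in>M. (\<forall>b\<in>B. cinner x b = 0) \<longrightarrow> \<alpha> * norm x \<le> norm (R x)))"

text \<open>In the expansion of |A u - c u|^2 the cross term is at least 2 |A u|^2 in size, while
  both squares equal |A u|^2, so nothing positive remains.\<close>

lemma positive_op_maximizer_eigenvector:
  assumes M: "closed_csubspace M" and A: "positive_op M A"
    and le: "\<And>x. x \<in> M \<Longrightarrow> norm (A x) \<le> c * norm x" and u: "u \<in> M" "norm (A u) = c * norm u"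
  shows "A u = c *\<^sub>R u"
proof -
  have "(norm (A u))\<^sup>2 \<le> c * inner (A u) u"
    by (rule positive_op_norm_sq_le[OF M A le u(1)])
  moreover have "(norm (A u - c *\<^sub>R u))\<^sup>2 = (norm (A u))\<^sup>2 - 2 * (c * inner (A u) u) + (norm (c *\<^sub>R u))\<^sup>2"
    unfolding norm_diff_cinner inner_eq_Re_cinner[symmetric] inner_scaleR_right ..
  moreover have "(norm (c *\<^sub>R u))\<^sup>2 = (norm (A u))\<^sup>2"
    by (simp add: u(2) power_mult_distrib)
  ultimately have "(norm (A u - c *\<^sub>R u))\<^sup>2 \<le> 0"
    by linarith
  then show ?thesis
    by simp
qed

text \<open>It suffices that some sequence of approximate eigenvectors has a convergent subsequence.
  For \<mu> \<noteq> \<alpha> compactness provides it. For \<mu> = \<alpha> either a vector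
  orthogonal to \<open>B\<close> already attains the norm, or M has finite dimension.\<close>

lemma ess_scalar_norm_attained:
  assumes M: "closed_csubspace M" and R: "positive_op M R" and ne: "M \<noteq> {0}"
    and ess: "ess_scalar M R \<alpha>" and \<alpha>: "0 \<le> \<alpha>"
  shows "\<exists>x\<in>M. norm x = 1 \<and> R x = spec_sup M R *\<^sub>R x"
proof -
  note Rb = positive_opD(1)[OF R M]
  define \<mu> where "\<mu> = spec_sup M R"
  note \<mu> = spec_sup_nonneg[OF M R ne, folded \<mu>_def] norm_le_spec_sup[OF M R ne, folded \<mu>_def]
  obtain x where x: "\<And>n. x n \<in> M" "\<And>n::nat. norm (x n) = 1" and lim: "(\<lambda>n. R (x n) - \<mu> *\<^sub>R x n) \<longlonglongrightarrow> 0"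
    using spec_sup_sequence[OF M R ne, folded \<mu>_def] by metis
  have conv: "\<exists>x\<in>M. norm x = 1 \<and> R x = \<mu> *\<^sub>R x" if r: "strict_mono r" and l: "(\<lambda>n. x (r n)) \<longlonglongrightarrow> l" for r l
  proof (intro bexI conjI)
    show "l \<in> M"
      by (rule closed_sequentially[OF closed_csubspaceD(7)[OF M] x(1) l])
    show "norm l = 1"
      using tendsto_norm[OF l] by (simp add: x(2) LIMSEQ_const_iff)
    have "(\<lambda>n. R (x (r n)) - \<mu> *\<^sub>R x (r n)) \<longlonglongrightarrow> R l - \<mu> *\<^sub>R l"
      by (intro tendsto_intros bounded_ops_tendsto[OF Rb M x(1) l] l)
    moreover have "(\<lambda>n. R (x (r n)) - \<mu> *\<^sub>R x (r n)) \<longlonglongrightarrow> 0"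
      using LIMSEQ_subseq_LIMSEQ[OF lim r] by (simp add: o_def)
    ultimately have "R l - \<mu> *\<^sub>R l = 0"
      by (rule LIMSEQ_unique)
    then show "R l = \<mu> *\<^sub>R l"
      by simp
  qed
  obtain B where B: "finite B" "\<And>x. x \<in> M \<Longrightarrow> (\<forall>b\<in>B. cinner x b = 0) \<Longrightarrow> \<alpha> * norm x \<le> norm (R x)"
    using ess unfolding ess_scalar_def by blast
  have "\<exists>x\<in>M. norm x = 1 \<and> R x = \<mu> *\<^sub>R x"
  proof (cases "\<mu> = \<alpha>")
    case False
    then have ne2: "\<mu>\<^sup>2 - \<alpha>\<^sup>2 \<noteq> 0"
      using \<alpha> \<mu>(1) by (simp add: power2_eq_iff)
    obtain r z where r: "strict_mono r" and z: "(\<lambda>n. R (R (x (r n))) - \<alpha>\<^sup>2 *\<^sub>R x (r n)) \<longlonglongrightarrow> z"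
      using ess x unfolding ess_scalar_def convergent_def by (metis order_refl)
    have mem: "R (x n) - \<mu> *\<^sub>R x n \<in> M" for n
      by (intro closed_csubspaceD(3,5)[OF M] bounded_opsD(1)[OF Rb] x)
    have "(\<lambda>n. R (R (x n) - \<mu> *\<^sub>R x n) + \<mu> *\<^sub>R (R (x n) - \<mu> *\<^sub>R x n)) \<longlonglongrightarrow> R 0 + \<mu> *\<^sub>R 0"
      by (intro tendsto_intros bounded_ops_tendsto[OF Rb M mem lim] lim)
    moreover have "R (R (x n) - \<mu> *\<^sub>R x n) + \<mu> *\<^sub>R (R (x n) - \<mu> *\<^sub>R x n) = R (R (x n)) - \<mu>\<^sup>2 *\<^sub>R x n" for n
      using x(1)[of n] by (simp add: bounded_ops_diff[OF Rb M] bounded_opsD(1)[OF Rb] closed_csubspaceD(5)[OF M]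
          bounded_opsD(4)[OF Rb] power2_eq_square algebra_simps)
    ultimately have lim2: "(\<lambda>n. R (R (x n)) - \<mu>\<^sup>2 *\<^sub>R x n) \<longlonglongrightarrow> 0"
      by (simp add: bounded_ops_0[OF Rb M])
    \<comment> \<open>The vectors themselves are recovered as the difference of the convergent
      sequence for R^2 - \<alpha>^2 and the null sequence for R^2 - \<mu>^2.\<close>
    have "(\<lambda>n. (1 / (\<mu>\<^sup>2 - \<alpha>\<^sup>2)) *\<^sub>R ((R (R (x (r n))) - \<alpha>\<^sup>2 *\<^sub>R x (r n)) - (R (R (x (r n))) - \<mu>\<^sup>2 *\<^sub>R x (r n))))
        \<longlonglongrightarrow> (1 / (\<mu>\<^sup>2 - \<alpha>\<^sup>2)) *\<^sub>R (z - 0)"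
      using LIMSEQ_subseq_LIMSEQ[OF lim2 r] by (intro tendsto_intros z) (simp add: o_def)
    moreover have "(1 / (\<mu>\<^sup>2 - \<alpha>\<^sup>2)) *\<^sub>R ((R (R (x (r n))) - \<alpha>\<^sup>2 *\<^sub>R x (r n)) - (R (R (x (r n))) - \<mu>\<^sup>2 *\<^sub>R x (r n))) = x (r n)" for n
    proof -
      have "(R (R (x (r n))) - \<alpha>\<^sup>2 *\<^sub>R x (r n)) - (R (R (x (r n))) - \<mu>\<^sup>2 *\<^sub>R x (r n)) = (\<mu>\<^sup>2 - \<alpha>\<^sup>2) *\<^sub>R x (r n)"
        by (simp add: scaleR_diff_left)
      then show ?thesis
        using ne2 by (simp only: scaleR_scaleR) simp
    qed
    ultimately show ?thesis
      by (intro conv[OF r]) simp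
  next
    case True
    show ?thesis
    proof (cases "\<exists>v\<in>M. v \<noteq> 0 \<and> (\<forall>b\<in>B. cinner v b = 0)")
      case True
      then obtain v where v: "v \<in> M" "v \<noteq> 0" "\<forall>b\<in>B. cinner v b = 0"
        by blast
      define u where "u = (1 / norm v) *\<^sub>R v"
      have u: "u \<in> M" "norm u = 1" "\<forall>b\<in>B. cinner u b = 0"
        using v closed_csubspaceD(5)[OF M v(1)] by (simp_all add: u_def cinner.scaleR_left)
      have "norm (R u) = \<mu> * norm u"
        using B(2)[OF u(1,3)] \<mu>(2)[OF u(1)] \<open>\<mu> = \<alpha>\<close> by simp
      then show ?thesis
        using positive_op_maximizer_eigenvector[OF M R \<mu>(2) u(1)] u by blast
    next
      case False
      \<comment> \<open>When no nonzero vector of M is orthogonal to \<open>B\<close>, the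
        projections of \<open>B\<close> to M span M.\<close>
      define V where "V = complex_vector.span (orth_proj M ` B)"
      have fV: "finite_dim V"
        unfolding V_def by (intro finite_dim_span finite_imageI B)
      have "V \<subseteq> M"
        unfolding V_def using orth_proj_mem[OF M] closed_csubspaceD(8)[OF M]
        by (intro complex_vector.span_minimal) auto
      have cV: "closed_csubspace V"
        by (rule finite_dim_closed[OF _ fV]) (simp add: V_def complex_vector.subspace_span)
      have "M \<inter> orth_compl V \<subseteq> {0}"
      proof
        fix v assume v: "v \<in> M \<inter> orth_compl V"
        have "cinner v b = 0" if "b \<in> B" for b
        proof -
          have "cinner v (orth_proj M b) = 0"
            using v that by (intro orth_complD(1)[of v V]) (auto simp: V_def intro: complex_vector.span_base)
          then show ?thesis
            using orth_proj_cinner[OF M, of v b] v by (metis IntD1 cinner_eq_0_commute)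
        qed
        then show "v \<in> {0}"
          using False v by auto
      qed
      then have "M \<subseteq> V"
        using subset_of_orth_compl_trivial[OF cV M] \<open>V \<subseteq> M\<close> by blast
      then have "finite_dim M"
        using finite_dim_subset[OF fV] by blast
      then obtain r where "strict_mono r" "convergent (\<lambda>k. x (r k))"
        using finite_dim_convergent_subseq[where f = x and C = 1, OF closed_csubspaceD(8)[OF M]] x by auto
      then show ?thesis
        using conv by (auto simp: convergent_def)
    qed
  qed
  then show ?thesis
    by (simp add: \<mu>_def)
qed

text \<open>The square of the deflated operator is R^2 - \<mu>^2 P, where P projects onto E and has
  finite rank. The lower bound persists once a basis of E is added to the vectors to be
  avoided.\<close>

lemma deflate_ess_scalar:
  assumes M: "closed_csubspace M" and R: "positive_op M R" and ne: "M \<noteq> {0}"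
    and fin: "finite_dim (eigenspace M R (complex_of_real (spec_sup M R)))" and ess: "ess_scalar M R \<alpha>"
  shows "ess_scalar M (deflate M R) \<alpha>"
proof -
  note Rb = positive_opD(1)[OF R M]
  define \<mu> where "\<mu> = spec_sup M R"
  define E where "E = eigenspace M R (complex_of_real (spec_sup M R))"
  note Ec = top_eigenspace_closed[OF M R ne, folded E_def]
  note defl = deflate_eq[OF M R ne, folded E_def]
  have P: "orth_proj E u \<in> M" "R (orth_proj E u) = \<mu> *\<^sub>R orth_proj E u" for u
    using orth_proj_mem[OF Ec, of u] by (simp_all add: E_def eigenspace_of_real \<mu>_def)
  have defl2: "deflate M R (deflate M R u) = R (R u) - \<mu>\<^sup>2 *\<^sub>R orth_proj E u" if u: "u \<in> M" for u
  proof -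
    have d: "deflate M R u = R u - \<mu> *\<^sub>R orth_proj E u"
      by (simp add: defl u bounded_ops_diff[OF Rb M] P)
    have "deflate M R u \<in> M"
      by (rule bounded_opsD(1)[OF positive_opD(1)[OF deflate_positive[OF M R ne] M] u])
    moreover have "orth_proj E (deflate M R u) = 0"
      by (rule orth_proj_eq_0[OF Ec deflate_orth[OF M R ne u, folded E_def]])
    ultimately have "deflate M R (deflate M R u) = R (R u - \<mu> *\<^sub>R orth_proj E u)"
      by (simp add: defl[of "deflate M R u"] flip: d)
    also have "\<dots> = R (R u) - \<mu>\<^sup>2 *\<^sub>R orth_proj E u"
      by (simp add: u bounded_ops_diff[OF Rb M] P bounded_opsD(1,4)[OF Rb] closed_csubspaceD(5)[OF M] power2_eq_square)
    finally show ?thesis .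
  qed
  show ?thesis
    unfolding ess_scalar_def
  proof (intro conjI allI impI)
    fix x :: "nat \<Rightarrow> 'a"
    assume x: "\<forall>n. x n \<in> M \<and> norm (x n) \<le> 1"
    then obtain r where r: "strict_mono r" "convergent (\<lambda>n. R (R (x (r n))) - \<alpha>\<^sup>2 *\<^sub>R x (r n))"
      using ess unfolding ess_scalar_def by blast
    have "norm (orth_proj E (x (r k))) \<le> 1" for k
      using norm_orth_proj_le[OF Ec, of "x (r k)"] x order_trans by blast
    then obtain s :: "nat \<Rightarrow> nat" where s: "strict_mono s" "convergent (\<lambda>k. orth_proj E (x (r (s k))))"
      using finite_dim_convergent_subseq[OF closed_csubspaceD(8)[OF Ec] fin[folded E_def] orth_proj_mem[OF Ec],
        of "\<lambda>k. x (r k)" 1] by blast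
    obtain a b where "(\<lambda>n. R (R (x (r (s n)))) - \<alpha>\<^sup>2 *\<^sub>R x (r (s n))) \<longlonglongrightarrow> a"
      "(\<lambda>n. orth_proj E (x (r (s n)))) \<longlonglongrightarrow> b"
      using convergent_subseq_convergent[OF r(2) s(1)] s(2) by (auto simp: convergent_def o_def)
    then have "(\<lambda>n. (R (R (x (r (s n)))) - \<alpha>\<^sup>2 *\<^sub>R x (r (s n))) - \<mu>\<^sup>2 *\<^sub>R orth_proj E (x (r (s n)))) \<longlonglongrightarrow> a - \<mu>\<^sup>2 *\<^sub>R b"
      by (intro tendsto_intros)
    then have "convergent (\<lambda>n. deflate M R (deflate M R (x ((r \<circ> s) n))) - \<alpha>\<^sup>2 *\<^sub>R x ((r \<circ> s) n))"
      using x unfolding convergent_def by (auto simp: defl2 algebra_simps)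
    then show "\<exists>r. strict_mono r \<and> convergent (\<lambda>n. deflate M R (deflate M R (x (r n))) - \<alpha>\<^sup>2 *\<^sub>R x (r n))"
      using strict_mono_o[OF r(1) s(1)] by blast
  next
    obtain B where B: "finite B" "\<And>x. x \<in> M \<Longrightarrow> (\<forall>b\<in>B. cinner x b = 0) \<Longrightarrow> \<alpha> * norm x \<le> norm (R x)"
      using ess unfolding ess_scalar_def by blast
    obtain n e where e: "E = complex_vector.span (e ` {1..n::nat})"
      using finite_dim_orthonormal_basis[OF closed_csubspaceD(8)[OF Ec] fin[folded E_def]] by metis
    have "\<alpha> * norm x \<le> norm (deflate M R x)" if x: "x \<in> M" "\<forall>b\<in>B \<union> e ` {1..n}. cinner x b = 0" for x
    proof -
      have "x \<in> orth_compl E"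
        unfolding e orth_compl_span using x(2) by (intro orth_complI) auto
      then have "deflate M R x = R x"
        using defl[OF x(1)] orth_proj_eq_0[OF Ec] by simp
      then show ?thesis
        using B(2)[OF x(1)] x(2) by simp
    qed
    then show "\<exists>B. finite B \<and> (\<forall>x\<in>M. (\<forall>b\<in>B. cinner x b = 0) \<longrightarrow> \<alpha> * norm x \<le> norm (deflate M R x))"
      using B(1) by (intro exI[of _ "B \<union> e ` {1..n}"]) auto
  qed
qed

text \<open>Norm attainment for the deflated operator shows that its norm \<nu> is strictly below
  \<mu>. So R is \<mu> on E and bounded by \<nu> on the complement, and \<mu> is the only spectral
  point outside the disc of radius \<nu>.\<close>

lemma ess_scalar_isolated:
  assumes M: "closed_csubspace M" and R: "positive_op M R" and ne: "M \<noteq> {0}"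
    and fin: "finite_dim (eigenspace M R (complex_of_real (spec_sup M R)))" and ess: "ess_scalar M R \<alpha>" "0 \<le> \<alpha>"
    and pos: "0 < spec_sup M R"
  shows "\<not> complex_of_real (spec_sup M R) islimpt spectrum M R"
proof -
  note Rb = positive_opD(1)[OF R M] and sym = positive_opD(2)[OF R M]
  define \<mu> where "\<mu> = spec_sup M R"
  define E where "E = eigenspace M R (complex_of_real (spec_sup M R))"
  note Ec = top_eigenspace_closed[OF M R ne, folded E_def]
  note defl = deflate_eq[OF M R ne, folded E_def]
  note R' = deflate_positive[OF M R ne]
  define \<nu> where "\<nu> = spec_sup M (deflate M R)"
  note \<nu> = spec_sup_nonneg[OF M R' ne, folded \<nu>_def] norm_le_spec_sup[OF M R' ne, folded \<nu>_def]
  obtain x where x: "x \<in> M" "norm x = 1" "deflate M R x = \<nu> *\<^sub>R x"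
    using ess_scalar_norm_attained[OF M R' ne deflate_ess_scalar[OF M R ne fin ess(1)] ess(2)] \<nu>_def by blast
  \<comment> \<open>Otherwise a normalized eigenvector of the deflated operator for \<nu> > 0 is
    orthogonal to E, is an eigenvector of R for \<nu>, and \<nu> = \<mu> puts it into E.\<close>
  have "\<nu> < \<mu>"
  proof (rule ccontr)
    assume "\<not> \<nu> < \<mu>"
    then have \<nu>0: "0 < \<nu>"
      using pos \<mu>_def by simp
    have "\<nu> *\<^sub>R x \<in> orth_compl E"
      using deflate_orth[OF M R ne x(1), folded E_def] x(3) by simp
    then have "(1 / \<nu>) *\<^sub>R (\<nu> *\<^sub>R x) \<in> orth_compl E"
      by (rule closed_csubspaceD(5)[OF closed_csubspace_orth_compl])
    then have xo: "x \<in> orth_compl E"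
      using \<nu>0 by simp
    have Rx: "R x = \<nu> *\<^sub>R x"
      using defl[OF x(1)] orth_proj_eq_0[OF Ec xo] x(3) by simp
    then have "\<nu> \<le> \<mu>"
      using norm_le_spec_sup[OF M R ne x(1)] \<nu>0 x(2) by (simp add: \<mu>_def)
    then have "x \<in> E"
      using \<open>\<not> \<nu> < \<mu>\<close> Rx x(1) by (simp add: E_def eigenspace_of_real \<mu>_def)
    then have "cinner x x = 0"
      using xo orth_complD by blast
    then show False
      using x(2) by (simp add: cinner_self)
  qed
  have "z \<notin> spectrum M R" if z: "z \<noteq> complex_of_real \<mu>" "\<nu> < cmod z" for z
  proof -
    \<comment> \<open>R - z acts on E as \<mu> - z and is at least |z| - \<nu> on the complement;
      the smaller value works on the orthogonal sum.\<close>
    define c where "c = min (cmod (\<mu> - z)) (cmod z - \<nu>)"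
    have c: "0 < c" "c \<le> cmod (\<mu> - z)" "c \<le> cmod z - \<nu>"
      using z by (auto simp: c_def)
    have "c * norm u \<le> norm (R u - z *\<^sub>C u)" if u: "u \<in> M" for u
    proof -
      define e where "e = orth_proj E u"
      define y where "y = u - e"
      have eE: "e \<in> E"
        unfolding e_def by (rule orth_proj_mem[OF Ec])
      then have e: "e \<in> M" "R e = \<mu> *\<^sub>R e"
        by (simp_all add: E_def eigenspace_of_real \<mu>_def)
      have y: "y \<in> M" "y \<in> orth_compl E"
        unfolding y_def by (simp add: closed_csubspaceD(3)[OF M u e(1)], simp add: e_def diff_orth_proj_mem[OF Ec])
      have Ry: "R y = deflate M R y"
        using defl[OF y(1)] orth_proj_eq_0[OF Ec y(2)] by simp
      have "R y \<in> orth_compl E"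
        unfolding Ry using deflate_orth[OF M R ne y(1)] by (simp add: E_def)
      then have w: "R y - z *\<^sub>C y \<in> orth_compl E"
        using y(2) by (intro closed_csubspaceD(3,4)[OF closed_csubspace_orth_compl])
      have split: "R u - z *\<^sub>C u = (R y - z *\<^sub>C y) + (complex_of_real \<mu> - z) *\<^sub>C e"
        using bounded_ops_diff[OF Rb M u e(1)] e(2)
        by (simp add: y_def scaleC.diff_left scaleC.diff_right flip: scaleR_scaleC)
      have "cinner (R y - z *\<^sub>C y) ((complex_of_real \<mu> - z) *\<^sub>C e) = 0"
        by (rule orth_complD(1)[OF w closed_csubspaceD(4)[OF Ec eE]])
      then have "(norm (R u - z *\<^sub>C u))\<^sup>2 = (norm (R y - z *\<^sub>C y))\<^sup>2 + (cmod (\<mu> - z) * norm e)\<^sup>2"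
        unfolding split by (simp add: pythagoras_cinner norm_scaleC)
      moreover have "(c * norm y)\<^sup>2 \<le> (norm (R y - z *\<^sub>C y))\<^sup>2"
      proof (rule power_mono)
        have "c * norm y \<le> cmod z * norm y - \<nu> * norm y"
          using mult_right_mono[OF c(3), of "norm y"] by (simp add: left_diff_distrib)
        also have "\<dots> \<le> norm (R y - z *\<^sub>C y)"
          using \<nu>(2)[OF y(1)] norm_triangle_ineq2[of "z *\<^sub>C y" "R y"]
          unfolding Ry by (simp add: norm_scaleC norm_minus_commute)
        finally show "c * norm y \<le> norm (R y - z *\<^sub>C y)" .
      qed (use c in simp)
      moreover have "(c * norm e)\<^sup>2 \<le> (cmod (\<mu> - z) * norm e)\<^sup>2"
        using c by (intro power_mono mult_right_mono) auto
      moreover have "(norm u)\<^sup>2 = (norm e)\<^sup>2 + (norm y)\<^sup>2"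
        using orth_proj_pythagoras[OF Ec, of u] by (simp add: y_def e_def)
      ultimately have "(c * norm u)\<^sup>2 \<le> (norm (R u - z *\<^sub>C u))\<^sup>2"
        by (simp add: power_mult_distrib distrib_left)
      then show ?thesis
        by (rule power2_le_imp_le) simp
    qed
    then show ?thesis
      by (rule not_in_spectrum_if_bounded_below[OF M Rb sym c(1)])
  qed
  moreover have "\<nu> < cmod z" if "dist z (complex_of_real \<mu>) < \<mu> - \<nu>" for z
    using that norm_triangle_ineq2[of "complex_of_real \<mu>" z] \<open>\<nu> < \<mu>\<close> \<nu>(1) by (simp add: dist_norm norm_minus_commute)
  ultimately show ?thesis
    unfolding islimpt_approachable \<mu>_def[symmetric] using \<open>\<nu> < \<mu>\<close> by (metis diff_gt_0_iff_gt)
qed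

text \<open>
  The eigenvectors must lie in a subspace V that shrinks along the recursion, since deflation
  moves the eigenspaces already treated into the kernel.
\<close>

lemma op_lambda_eigenvectors:
  assumes M: "closed_csubspace M" and ne: "M \<noteq> {0}"
    and "positive_op M R" "ess_scalar M R \<alpha>" "0 \<le> \<alpha>"
    and "closed_csubspace V" "V \<subseteq> M" "\<And>x. x \<in> M \<Longrightarrow> R x \<in> V"
  shows "\<exists>n x. n \<le> k \<and> orthonormal_upto n x \<and> (\<forall>j\<in>{1..n}. x j \<in> V \<and> R (x j) = op_lambda M R j *\<^sub>R x j) \<and>
    (n = k \<or> V \<subseteq> complex_vector.span (x ` {1..n}))"
  using assms(3-)
proof (induction k arbitrary: R V rule: less_induct)
  case (less k)
  note R = less.prems(1) and ess = less.prems(2,3) and V = less.prems(4) and VM = less.prems(5) and RV = less.prems(6)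
  note Rb = positive_opD(1)[OF R M]
  show ?case
  proof (cases "\<forall>x\<in>M. R x = 0")
    case True
    \<comment> \<open>For R = 0 all the numbers \<open>op_lambda M R j\<close> with j \<ge> 1
      vanish, so any orthonormal vectors of V serve.\<close>
    obtain n x where x: "n \<le> k" "orthonormal_upto n x" "\<And>j. j \<in> {1..n} \<Longrightarrow> x j \<in> V"
      "n = k \<or> V \<subseteq> complex_vector.span (x ` {1..n})"
      using orthonormal_upto_exists[OF closed_csubspaceD(8)[OF V], of k] by metis
    moreover have "R (x j) = op_lambda M R j *\<^sub>R x j" if "j \<in> {1..n}" for j
      using op_lambda_zero[OF M, of R j] True that x(3)[OF that] VM by auto
    ultimately show ?thesis
      by blast
  next
    case False
    define \<mu> where "\<mu> = spec_sup M R"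
    define E where "E = eigenspace M R (complex_of_real (spec_sup M R))"
    note Ec = top_eigenspace_closed[OF M R ne, folded E_def]
    note ED = top_eigenspaceD[OF M R ne, folded E_def \<mu>_def]
    have pos: "0 < \<mu>"
      using spec_sup_pos[OF M R ne] False unfolding \<mu>_def by blast
    have EV: "E \<subseteq> V"
      using top_eigenspace_subset_range[OF M R ne, folded E_def \<mu>_def, OF pos] RV by blast
    show ?thesis
    proof (cases "finite_dim E")
      case infinite: False
      obtain n x where x: "n \<le> k" "orthonormal_upto n x" "\<And>j. j \<in> {1..n} \<Longrightarrow> x j \<in> E"
        "n = k \<or> E \<subseteq> complex_vector.span (x ` {1..n})"
        using orthonormal_upto_exists[OF closed_csubspaceD(8)[OF Ec], of k] by metis
      have "n = k"
        using x(4) infinite finite_dim_subset[OF finite_dim_span, of "x ` {1..n}" E] by auto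
      moreover have "R (x j) = op_lambda M R j *\<^sub>R x j" if "j \<in> {1..n}" for j
        using op_lambda_infinite_eigenspace[OF M R ne, folded E_def \<mu>_def, OF pos infinite] ED(2)[OF x(3)[OF that]]
        by simp
      ultimately show ?thesis
        using x EV by blast
    next
      case fin: True
      define m where "m = complex_vector.dim E"
      obtain e where e: "orthonormal_upto m e" "E = complex_vector.span (e ` {1..m})"
        using finite_dim_orthonormal_basis[OF closed_csubspaceD(8)[OF Ec] fin] unfolding m_def .
      have eE: "e j \<in> E" if "j \<in> {1..m}" for j
        unfolding e(2) by (intro complex_vector.span_base imageI that)
      obtain v where "v \<in> M" "norm v = 1" "R v = \<mu> *\<^sub>R v"
        using ess_scalar_norm_attained[OF M R ne ess] unfolding \<mu>_def by blast
      then have E0: "E \<noteq> {0}"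
        using top_eigenspaceI[OF M R ne, folded E_def \<mu>_def, of v] by auto
      \<comment> \<open>This makes k - m smaller than k, so the induction applies to the deflated
        operator.\<close>
      have m0: "0 < m"
        using E0 e(2) by (cases m) (auto simp: complex_vector.span_empty)
      note lam = op_lambda_isolated[OF M R ne, folded E_def \<mu>_def, OF pos fin E0
          ess_scalar_isolated[OF M R ne fin[unfolded E_def] ess pos[unfolded \<mu>_def], folded \<mu>_def], folded m_def]
      show ?thesis
      proof (cases "k \<le> m")
        case True
        then have "e j \<in> V \<and> R (e j) = op_lambda M R j *\<^sub>R e j" if "j \<in> {1..k}" for j
          using that eE[of j] EV ED(2)[of "e j"] lam[of j] by auto
        then show ?thesis
          using orthonormal_upto_mono[OF e(1) True] by blast
      next
        case km: False
        define R' where "R' = deflate M R"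
        define V' where "V' = V \<inter> orth_compl E"
        have R'V: "R' x \<in> V'" if x: "x \<in> M" for x
          using deflate_orth[OF M R ne x, folded E_def] deflate_eq[OF M R ne x, folded E_def]
            RV[OF diff_orth_proj_top[OF M R ne x, folded E_def]]
          by (simp add: V'_def R'_def)
        have "\<exists>n x. n \<le> k - m \<and> orthonormal_upto n x \<and>
            (\<forall>j\<in>{1..n}. x j \<in> V' \<and> R' (x j) = op_lambda M R' j *\<^sub>R x j) \<and>
            (n = k - m \<or> V' \<subseteq> complex_vector.span (x ` {1..n}))"
        proof (rule less.IH)
          show "positive_op M R'" "ess_scalar M R' \<alpha>"
            unfolding R'_def using deflate_positive[OF M R ne] deflate_ess_scalar[OF M R ne _ ess(1)] fin
            by (simp_all add: E_def)
          show "closed_csubspace V'"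
            unfolding V'_def by (intro closed_csubspace_Int V closed_csubspace_orth_compl)
        qed (use km m0 ess R'V VM in \<open>auto simp: V'_def\<close>)
        then obtain n y where n: "n \<le> k - m" and y: "orthonormal_upto n y"
          "\<And>j. j \<in> {1..n} \<Longrightarrow> y j \<in> V'" "\<And>j. j \<in> {1..n} \<Longrightarrow> R' (y j) = op_lambda M R' j *\<^sub>R y j"
          and span: "n = k - m \<or> V' \<subseteq> complex_vector.span (y ` {1..n})"
          by blast
        define x where "x = (\<lambda>j. if j \<le> m then e j else y (j - m))"
        have ye: "cinner (y j) (e i) = 0" if "i \<in> {1..m}" "j \<in> {1..n}" for i j
          using y(2)[OF that(2)] eE[OF that(1)] by (auto simp: V'_def dest: orth_complD)
        have on: "orthonormal_upto (m + n) x"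
          unfolding x_def by (rule orthonormal_upto_append[OF e(1) y(1) ye])
        have mem: "x j \<in> V \<and> R (x j) = op_lambda M R j *\<^sub>R x j" if j: "j \<in> {1..m + n}" for j
        proof (cases "j \<le> m")
          case True
          then show ?thesis
            using j eE[of j] EV ED(2)[of "e j"] lam[of j] by (auto simp: x_def)
        next
          case False
          define i where "i = j - m"
          have i: "i \<in> {1..n}" "j = m + i"
            using False j by (auto simp: i_def)
          have yi: "y i \<in> V" "y i \<in> orth_compl E"
            using y(2)[OF i(1)] by (auto simp: V'_def)
          then have "R' (y i) = R (y i)"
            using deflate_eq[OF M R ne, of "y i", folded E_def] orth_proj_eq_0[OF Ec yi(2)] VM by (auto simp: R'_def)
          moreover have "op_lambda M R j = op_lambda M R' i"
            using lam[of j] False i by (simp add: R'_def)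
          moreover have "x j = y i"
            using i by (auto simp: x_def)
          ultimately show ?thesis
            using y(3)[OF i(1)] yi(1) by simp
        qed
        \<comment> \<open>If the deflated vectors exhaust the part of V orthogonal to E, then
          together with the basis of E they exhaust V.\<close>
        have "V \<subseteq> complex_vector.span (x ` {1..m + n})" if sub: "V' \<subseteq> complex_vector.span (y ` {1..n})"
        proof
          fix v assume v: "v \<in> V"
          let ?S = "complex_vector.span (x ` {1..m + n})"
          have "e ` {1..m} \<subseteq> x ` {1..m + n}"
            by (auto simp: x_def intro!: image_eqI)
          then have 1: "E \<subseteq> ?S"
            unfolding e(2) by (rule complex_vector.span_mono)
          have "y ` {1..n} \<subseteq> x ` {1..m + n}"
          proof
            fix w assume "w \<in> y ` {1..n}"
            then obtain i where "i \<in> {1..n}" "w = y i"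
              by blast
            then show "w \<in> x ` {1..m + n}"
              by (intro image_eqI[of _ _ "m + i"]) (auto simp: x_def)
          qed
          then have "V' \<subseteq> ?S"
            using complex_vector.span_mono sub by (meson order_trans)
          moreover have "v - orth_proj E v \<in> V'"
            using closed_csubspaceD(3)[OF V v] EV orth_proj_mem[OF Ec, of v] diff_orth_proj_mem[OF Ec, of v]
            by (auto simp: V'_def)
          ultimately have "orth_proj E v + (v - orth_proj E v) \<in> ?S"
            using 1 orth_proj_mem[OF Ec, of v] by (intro complex_vector.span_add) auto
          then show "v \<in> ?S"
            by simp
        qed
        then have "m + n = k \<or> V \<subseteq> complex_vector.span (x ` {1..m + n})"
          using span km by auto
        moreover have "m + n \<le> k"
          using n km by simp
        ultimately show ?thesis
          using on mem by blast
      qed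
    qed
  qed
qed

section \<open>Norming operators\<close>

text \<open>With \<alpha> = 0 the lower bound is trivial and R R has finite rank; norm attainment
  for finite-rank operators thus reuses the general argument.\<close>

lemma finite_rank_ess_scalar:
  assumes M: "closed_csubspace M" and R: "R \<in> bounded_ops M M" and fin: "finite_rank M R"
  shows "ess_scalar M R 0"
proof -
  obtain C where C: "0 < C" "\<And>x. x \<in> M \<Longrightarrow> norm (R x) \<le> C * norm x"
    using bounded_ops_bound[OF R] by metis
  have "\<exists>r::nat \<Rightarrow> nat. strict_mono r \<and> convergent (\<lambda>n. R (R (x (r n))))"
    if x: "\<forall>n. x n \<in> M \<and> norm (x n) \<le> 1" for x
  proof (rule finite_dim_convergent_subseq[where f = "\<lambda>n. R (R (x n))" and C = "C * (C * 1)"])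
    show "complex_vector.subspace (R ` M)"
      by (rule subspace_image[OF R M])
    show "finite_dim (R ` M)"
      using fin by (simp add: finite_rank_def)
    fix n
    have xn: "x n \<in> M" "norm (x n) \<le> 1"
      using x by auto
    show "R (R (x n)) \<in> R ` M"
      using bounded_opsD(1)[OF R xn(1)] by simp
    have "norm (R (R (x n))) \<le> C * norm (R (x n))"
      by (rule C(2)[OF bounded_opsD(1)[OF R xn(1)]])
    also have "\<dots> \<le> C * (C * norm (x n))"
      using C(1) by (intro mult_left_mono C(2)[OF xn(1)]) simp
    also have "\<dots> \<le> C * (C * 1)"
      using C(1) xn(2) by (intro mult_left_mono) simp_all
    finally show "norm (R (R (x n))) \<le> C * (C * 1)" .
  qed
  then show ?thesis
    unfolding ess_scalar_def by (auto intro!: exI[of _ "{}"])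
qed

lemma powr_inverse_powr: "0 \<le> x \<Longrightarrow> 0 < p \<Longrightarrow> (x powr (1 / p)) powr p = (x::real)"
  by (simp add: powr_powr)

lemma pk_norming_imp_norm_attained:
  assumes M: "closed_csubspace M" and N: "closed_csubspace N" and T: "T \<in> bounded_ops M N" and ne: "M \<noteq> {0}"
    and p: "0 < p" and k: "1 \<le> k" and norming: "pk_norming p k M N T"
  shows "\<exists>x\<in>M. norm x = 1 \<and> (\<forall>y\<in>M. norm (T y) \<le> norm (T x) * norm y)"
proof -
  define A where "A = op_abs M N T"
  define \<mu> where "\<mu> = spec_sup M A"
  note A = op_abs_positive[OF M N T, folded A_def]
  note Ab = positive_opD(1)[OF A M]
  note nA = norm_op_abs[OF M N T, folded A_def]
  note \<mu> = spec_sup_nonneg[OF M A ne, folded \<mu>_def] norm_le_spec_sup[OF M A ne, folded \<mu>_def]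
  have "\<exists>x\<in>M. norm x = 1 \<and> \<mu> \<le> norm (T x)"
  proof -
    consider "finite_rank M A" | "complex_of_real \<mu> \<notin> ess_spectrum M A" | "\<mu> = 0"
      | "complex_of_real \<mu> \<in> ess_spectrum M A" "\<not> finite_rank M A" "0 < \<mu>"
      using \<mu>(1) by linarith
    then show ?thesis
    proof cases
      case 1
      obtain x where "x \<in> M" "norm x = 1" "A x = \<mu> *\<^sub>R x"
        using ess_scalar_norm_attained[OF M A ne finite_rank_ess_scalar[OF M Ab 1]] \<mu>_def by auto
      then show ?thesis
        using nA[of x] \<mu>(1) by (intro bexI[of _ x]) auto
    next
      case 2
      then have "\<not> complex_of_real \<mu> islimpt spectrum M A"
        using spec_sup_in_spectrum[OF M A ne] by (simp add: ess_spectrum_def \<mu>_def)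
      then obtain v where v: "v \<in> M" "v \<noteq> 0" "A v = \<mu> *\<^sub>R v"
        using isolated_spec_sup_eigenvector[OF M A ne] by (auto simp: \<mu>_def)
      define u where "u = (1 / norm v) *\<^sub>R v"
      have "u \<in> M" "norm u = 1" "A u = \<mu> *\<^sub>R u"
        using v closed_csubspaceD(5)[OF M v(1)] by (simp_all add: u_def bounded_opsD(4)[OF Ab])
      then show ?thesis
        using nA[of u] \<mu>(1) by (intro bexI[of _ u]) auto
    next
      case 3
      then show ?thesis
        using nontrivial_unit_vectors[OF M ne] by auto
    next
      case 4
      obtain n x where n: "n \<le> k" and x: "\<And>j. j \<in> {1..n} \<Longrightarrow> x j \<in> M" "orthonormal_upto n x"
        and eq: "pk_norm p k M N T powr p = (\<Sum>j=1..n. norm (T (x j)) powr p)"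
      proof -
        have "(if finite_dim M \<and> complex_vector.dim M < k then complex_vector.dim M else k) \<le> k"
          by simp
        then show thesis
          using norming that unfolding pk_norming_def Let_def by blast
      qed
      have "s_number M N T j = \<mu>" for j
        using op_lambda_ess[OF M A ne] 4 unfolding s_number_def A_def[symmetric] \<mu>_def by blast
      then have "pk_norm p k M N T powr p = real k * \<mu> powr p"
        using p by (simp add: pk_norm_def powr_inverse_powr)
      then have sum: "(\<Sum>j=1..n. norm (T (x j)) powr p) = real k * \<mu> powr p"
        using eq by simp
      \<comment> \<open>If every norm were below \<mu>, a sum of n \<le> k terms could not reach k
        times \<open>\<mu> powr p\<close>.\<close>
      have "\<exists>j\<in>{1..n}. \<mu> \<le> norm (T (x j))"
      proof (rule ccontr)
        assume "\<not> ?thesis"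
        then have lt: "norm (T (x j)) powr p < \<mu> powr p" if "j \<in> {1..n}" for j
          using that p by (intro powr_less_mono2) (auto simp: not_le)
        show False
        proof (cases "n = 0")
          case True
          then show ?thesis
            using sum k 4(3) by simp
        next
          case False
          then have "(\<Sum>j=1..n. norm (T (x j)) powr p) < (\<Sum>j=1..n. \<mu> powr p)"
            using lt by (intro sum_strict_mono) auto
          also have "\<dots> \<le> real k * \<mu> powr p"
            using n by (simp add: mult_right_mono)
          finally show ?thesis
            using sum by simp
        qed
      qed
      then show ?thesis
        using x orthonormal_upto_norm by blast
    qed
  qed
  then obtain x where x: "x \<in> M" "norm x = 1" "\<mu> \<le> norm (T x)"
    by blast
  have "norm (T y) \<le> norm (T x) * norm y" if "y \<in> M" for y
    using \<mu>(2)[OF that] mult_right_mono[OF x(3), of "norm y"] nA[OF that] by simp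
  then show ?thesis
    using x by blast
qed

lemma op_rank_le_dim:
  assumes M: "closed_csubspace M" and R: "R \<in> bounded_ops M M" and fin: "finite_dim M"
  shows "finite_rank M R" "op_rank M R \<le> complex_vector.dim M"
proof -
  have sub: "R ` M \<subseteq> M"
    using bounded_opsD(1)[OF R] by blast
  then have f: "finite_dim (R ` M)"
    by (rule finite_dim_subset[OF fin])
  then show "finite_rank M R"
    by (simp add: finite_rank_def)
  obtain e where e: "orthonormal_upto (complex_vector.dim (R ` M)) e"
    "R ` M = complex_vector.span (e ` {1..complex_vector.dim (R ` M)})"
    using finite_dim_orthonormal_basis[OF subspace_image[OF R M] f] .
  have "e j \<in> M" if "j \<in> {1..complex_vector.dim (R ` M)}" for j
  proof -
    have "e j \<in> R ` M"
      by (subst e(2)) (intro complex_vector.span_base imageI that)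
    then show ?thesis
      using sub by blast
  qed
  from orthonormal_upto_le_dim[OF closed_csubspaceD(8)[OF M] fin e(1) this]
  show "op_rank M R \<le> complex_vector.dim M"
    by (simp add: op_rank_def)
qed

lemma ess_scalar_imp_pk_norming:
  assumes M: "closed_csubspace M" and N: "closed_csubspace N" and T: "T \<in> bounded_ops M N" and ne: "M \<noteq> {0}"
    and p: "0 < p" and ess: "ess_scalar M (op_abs M N T) \<alpha>" "0 \<le> \<alpha>"
  shows "pk_norming p k M N T"
proof -
  define A where "A = op_abs M N T"
  note A = op_abs_positive[OF M N T, folded A_def]
  note Ab = positive_opD(1)[OF A M]
  obtain n x where n: "n \<le> k" and x: "orthonormal_upto n x"
    "\<And>j. j \<in> {1..n} \<Longrightarrow> x j \<in> M \<and> A (x j) = op_lambda M A j *\<^sub>R x j"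
    and full: "n = k \<or> M \<subseteq> complex_vector.span (x ` {1..n})"
    using op_lambda_eigenvectors[OF M ne A ess[folded A_def] M order_refl bounded_opsD(1)[OF Ab], of k] by blast
  have s: "s_number M N T j = op_lambda M A j" for j
    by (simp add: s_number_def A_def)
  have Tx: "norm (T (x j)) = s_number M N T j" if j: "j \<in> {1..n}" for j
  proof -
    have xj: "x j \<in> M" "A (x j) = op_lambda M A j *\<^sub>R x j" "norm (x j) = 1"
      using x(2)[OF j] orthonormal_upto_norm[OF x(1) j] by auto
    \<comment> \<open>The number is the value of the positive form at the unit vector
      \<open>x j\<close>.\<close>
    have "0 \<le> op_lambda M A j"
      using positive_opD(3)[OF A M xj(1)] xj(3) by (simp add: xj(2) dot_square_norm)
    then show ?thesis
      using norm_op_abs[OF M N T xj(1)] xj by (simp add: s flip: A_def)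
  qed
  have norm: "pk_norm p k M N T powr p = (\<Sum>j=1..k. s_number M N T j powr p)"
    using p by (simp add: pk_norm_def powr_inverse_powr sum_nonneg)
  define d where "d = (if finite_dim M \<and> complex_vector.dim M < k then complex_vector.dim M else k)"
  have le: "finite_dim M \<Longrightarrow> n \<le> complex_vector.dim M"
    using orthonormal_upto_le_dim[OF closed_csubspaceD(8)[OF M] _ x(1)] x(2) by blast
  have fullD: "finite_dim M \<and> complex_vector.dim M = n" if "M \<subseteq> complex_vector.span (x ` {1..n})"
  proof -
    have "complex_vector.span (x ` {1..n}) \<subseteq> M"
      using x(2) closed_csubspaceD(8)[OF M] by (intro complex_vector.span_minimal) auto
    then have "M = complex_vector.span (x ` {1..n})"
      using that by blast
    then show ?thesis
      using dim_span_orthonormal[OF x(1)] finite_dim_span[of "x ` {1..n}"] by simp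
  qed
  \<comment> \<open>Either n = k, or the vectors span M and n is its dimension; since n never
    exceeds a finite dimension, this agrees with the case distinction in
    \<open>pk_norming\<close>.\<close>
  have "d = n"
    using full fullD le n by (fastforce simp: d_def)
  have "(\<Sum>j=1..k. s_number M N T j powr p) = (\<Sum>j=1..n. s_number M N T j powr p)"
  proof (rule sum.mono_neutral_right)
    \<comment> \<open>An index beyond n exists only if n < k; then n is the dimension of M, which
      bounds the rank, and the rank test of \<open>op_lambda\<close> returns 0.\<close>
    show "\<forall>j\<in>{1..k} - {1..n}. s_number M N T j powr p = 0"
    proof
      fix j assume j: "j \<in> {1..k} - {1..n}"
      then have fin: "finite_dim M" "complex_vector.dim M < j"
        using full fullD n by auto
      then have "op_rank M A < j" "finite_rank M A"
        using op_rank_le_dim[OF M Ab fin(1)] by auto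
      then have "op_lambda M A j = 0"
        by (subst op_lambda.simps) (simp add: Let_def)
      then show "s_number M N T j powr p = 0"
        by (simp add: s)
    qed
  qed (use n in auto)
  also have "\<dots> = (\<Sum>j=1..n. norm (T (x j)) powr p)"
    by (rule sum.cong) (simp_all add: Tx)
  finally have "pk_norm p k M N T powr p = (\<Sum>j=1..n. norm (T (x j)) powr p)"
    by (simp only: norm)
  then show ?thesis
    unfolding pk_norming_def d_def[symmetric] Let_def \<open>d = n\<close> using T x by blast
qed

lemma compact_op_convergent_subseq:
  assumes "compact_op M K" "\<And>n. x n \<in> M \<and> norm (x n) \<le> 1"
  shows "\<exists>r::nat \<Rightarrow> nat. strict_mono r \<and> convergent (\<lambda>n. K (x (r n)))"
proof -
  have "seq_compact (closure (K ` (M \<inter> cball 0 1)))"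
    using assms(1) by (simp add: compact_op_def compact_imp_seq_compact)
  moreover have "K (x n) \<in> closure (K ` (M \<inter> cball 0 1))" for n
    using assms(2)[of n] by (intro subsetD[OF closure_subset] imageI) (simp add: dist_norm)
  ultimately obtain l r where "strict_mono r" "((\<lambda>n. K (x n)) \<circ> r) \<longlonglongrightarrow> l"
    unfolding seq_compact_def by metis
  then show ?thesis
    by (auto simp: o_def convergent_def)
qed

lemma scalar_plus_compact_plus_finite_imp_ess_scalar:
  fixes T :: "'h::complex_hilbert \<Rightarrow> 'k::complex_hilbert"
  assumes T: "T \<in> bounded_ops UNIV UNIV" and \<alpha>: "0 \<le> \<alpha>" and K: "positive_op UNIV K" "compact_op UNIV K"
    and F: "self_adjoint_op UNIV F" "finite_rank UNIV F"
    and eq: "op_abs UNIV UNIV T = (\<lambda>x. \<alpha> *\<^sub>R x + K x + F x)" and M: "closed_csubspace M"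
  shows "ess_scalar M (op_abs M UNIV (restrict T M)) \<alpha>"
proof -
  define A where "A = op_abs UNIV UNIV T"
  define R where "R = op_abs M UNIV (restrict T M)"
  note U = closed_csubspace_UNIV
  note TM = restrict_bounded_ops[OF T M subset_UNIV]
  note A = op_abs_positive[OF U U T, folded A_def]
  note Ab = positive_opD(1)[OF A U]
  note R = op_abs_positive[OF M U TM, folded R_def]
  note Rb = positive_opD(1)[OF R M]
  have Fb: "F \<in> bounded_ops UNIV UNIV" and Fsym: "symmetric_on UNIV F"
    using F(1) self_adjoint_op_iff[OF U] by auto
  have A_eq: "A x = \<alpha> *\<^sub>R x + (K x + F x)" for x
    using eq by (simp add: A_def add.assoc)
  have RA: "cinner (R x) (R y) = cinner (A x) (A y)" if "x \<in> M" "y \<in> M" for x y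
    using cinner_op_abs[OF M U TM that] cinner_op_abs[OF U U T, of x y] that by (simp add: R_def A_def)
  \<comment> \<open>Equality of the Gram forms on M, read through the symmetry of R and A,
    determines R R as a compression.\<close>
  have R2: "R (R x) = orth_proj M (A (A x))" if x: "x \<in> M" for x
  proof (rule sym, rule orth_proj_eqI[OF M])
    show "R (R x) \<in> M"
      by (intro bounded_opsD(1)[OF Rb] x)
    show "cinner (A (A x) - R (R x)) z = 0" if "z \<in> M" for z
      using RA[OF x that] symmetric_onD[OF positive_opD(2)[OF R M] bounded_opsD(1)[OF Rb x] that]
        symmetric_onD[OF positive_opD(2)[OF A U], of "A x" z]
      by (simp add: cinner.diff_left)
  qed
  have "\<exists>r::nat \<Rightarrow> nat. strict_mono r \<and> convergent (\<lambda>n. R (R (x (r n))) - \<alpha>\<^sup>2 *\<^sub>R x (r n))"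
    if x: "\<forall>n. x n \<in> M \<and> norm (x n) \<le> 1" for x
  proof -
    obtain r :: "nat \<Rightarrow> nat" where r: "strict_mono r" "convergent (\<lambda>n. K (x (r n)))"
      using compact_op_convergent_subseq[OF K(2), of x] x by auto
    obtain C where C: "0 < C" "\<And>x. norm (F x) \<le> C * norm x"
      using bounded_ops_bound[OF Fb] UNIV_I by metis
    have "norm (F (x (r n))) \<le> C * 1" for n
      using x C(1) by (intro order_trans[OF C(2)] mult_left_mono) auto
    then obtain s :: "nat \<Rightarrow> nat" where s: "strict_mono s" "convergent (\<lambda>n. F (x (r (s n))))"
      using finite_dim_convergent_subseq[OF subspace_image[OF Fb U], of "\<lambda>n. F (x (r n))" "C * 1"] F(2)
      by (auto simp: finite_rank_def)
    define y where "y n = x ((r \<circ> s) n)" for n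
    have yM: "y n \<in> M" for n
      using x by (simp add: y_def)
    obtain a b where "(\<lambda>n. K (y n)) \<longlonglongrightarrow> a" "(\<lambda>n. F (y n)) \<longlonglongrightarrow> b"
      using convergent_subseq_convergent[OF r(2) s(1)] s(2) by (auto simp: convergent_def o_def y_def)
    then have d: "(\<lambda>n. K (y n) + F (y n)) \<longlonglongrightarrow> a + b"
      by (rule tendsto_add)
    have "(\<lambda>n. \<alpha> *\<^sub>R (K (y n) + F (y n)) + A (K (y n) + F (y n))) \<longlonglongrightarrow> \<alpha> *\<^sub>R (a + b) + A (a + b)"
      by (intro tendsto_intros d bounded_ops_tendsto[OF Ab U] UNIV_I)
    \<comment> \<open>This is A^2 - \<alpha>^2 = \<alpha> (A - \<alpha>) + A (A - \<alpha>) with A -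
      \<alpha> = K + F.\<close>
    moreover have "\<alpha> *\<^sub>R (K (y n) + F (y n)) + A (K (y n) + F (y n)) = A (A (y n)) - \<alpha>\<^sup>2 *\<^sub>R y n" for n
    proof -
      have "A (A (y n)) = \<alpha> *\<^sub>R A (y n) + A (K (y n) + F (y n))"
        by (subst (2) A_eq) (simp add: bounded_opsD(2,4)[OF Ab])
      then show ?thesis
        by (simp add: A_eq[of "y n"] algebra_simps power2_eq_square)
    qed
    ultimately have "(\<lambda>n. A (A (y n)) - \<alpha>\<^sup>2 *\<^sub>R y n) \<longlonglongrightarrow> \<alpha> *\<^sub>R (a + b) + A (a + b)"
      by simp
    from orth_proj_tendsto[OF M this]
    have "(\<lambda>n. R (R (y n)) - \<alpha>\<^sup>2 *\<^sub>R y n) \<longlonglongrightarrow> orth_proj M (\<alpha> *\<^sub>R (a + b) + A (a + b))"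
      by (simp add: orth_proj_diff[OF M] orth_proj_id[OF M closed_csubspaceD(5)[OF M yM]] R2[OF yM])
    then have "convergent (\<lambda>n. R (R (x ((r \<circ> s) n))) - \<alpha>\<^sup>2 *\<^sub>R x ((r \<circ> s) n))"
      unfolding y_def convergent_def by blast
    then show ?thesis
      using strict_mono_o[OF r(1) s(1)] by blast
  qed
  moreover have "\<exists>B. finite B \<and> (\<forall>x\<in>M. (\<forall>b\<in>B. cinner x b = 0) \<longrightarrow> \<alpha> * norm x \<le> norm (R x))"
  proof -
    obtain n e where e: "range F = complex_vector.span (e ` {1..n::nat})"
      using finite_dim_orthonormal_basis[OF subspace_image[OF Fb U]] F(2) unfolding finite_rank_def by metis
    have "\<alpha> * norm x \<le> norm (R x)" if x: "x \<in> M" "\<forall>b\<in>e ` {1..n}. cinner x b = 0" for x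
    proof (rule power2_le_imp_le)
      have "x \<in> orth_compl (range F)"
        unfolding e orth_compl_span using x(2) by (intro orth_complI) blast
      then have "cinner x (F (F x)) = 0"
        by (rule orth_complD) simp
      then have "F x = 0"
        using symmetric_onD[OF Fsym, of x "F x"] by (simp add: cinner_self)
      then have Ax: "A x = \<alpha> *\<^sub>R x + K x"
        by (simp add: A_eq)
      \<comment> \<open>Orthogonality to the range of F has removed F, and positivity of K now makes
        the cross term of |\<alpha> x + K x|^2 nonnegative.\<close>
      have "0 \<le> \<alpha> * inner (K x) x"
        using \<alpha> positive_opD(3)[OF K(1) U] by simp
      moreover have "(norm (A x))\<^sup>2 = (norm (\<alpha> *\<^sub>R x))\<^sup>2 + 2 * (\<alpha> * inner (K x) x) + (norm (K x))\<^sup>2"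
        unfolding Ax norm_add_cinner inner_eq_Re_cinner[symmetric] by (simp add: inner_commute)
      moreover have "norm (R x) = norm (A x)"
        using norm_op_abs[OF M U TM x(1)] norm_op_abs[OF U U T, of x] x(1) by (simp add: R_def A_def)
      ultimately show "(\<alpha> * norm x)\<^sup>2 \<le> (norm (R x))\<^sup>2"
        using \<alpha> zero_le_power2[of "norm (K x)"] by simp
    qed simp
    then show ?thesis
      by (intro exI[of _ "e ` {1..n}"]) simp
  qed
  ultimately show ?thesis
    unfolding ess_scalar_def R_def[symmetric] by blast
qed

section \<open>Operators that attain their norm on every subspace\<close>

definition abs_norm_attaining :: "('a::complex_hilbert \<Rightarrow> 'b::complex_hilbert) \<Rightarrow> bool" where
  "abs_norm_attaining A \<longleftrightarrow> (\<forall>M. closed_csubspace M \<and> M \<noteq> {0} \<longrightarrow>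
     (\<exists>x\<in>M. norm x = 1 \<and> (\<forall>y\<in>M. norm (A y) \<le> norm (A x) * norm y)))"

text \<open>First variation at a maximum: s -> t^2 |x + s w|^2 - |A (x + s w)|^2 is nonnegative and
  vanishes at s = 0, so its linear coefficient is 0. Using z and i z as w gives both parts of the
  complex identity.\<close>

lemma norm_maximizer_cinner:
  assumes M: "closed_csubspace M" and A: "A \<in> bounded_ops UNIV UNIV"
    and x: "x \<in> M" "norm x = 1" and max: "\<And>y. y \<in> M \<Longrightarrow> norm (A y) \<le> norm (A x) * norm y" and z: "z \<in> M"
  shows "cinner (A x) (A z) = complex_of_real ((norm (A x))\<^sup>2) * cinner x z"
proof -
  define t where "t = norm (A x)"
  have key: "inner (A x) (A w) = t\<^sup>2 * inner x w" if w: "w \<in> M" for w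
  proof -
    have "(t\<^sup>2 * inner x w - inner (A x) (A w))\<^sup>2 \<le> 0 * (t\<^sup>2 * (norm w)\<^sup>2 - (norm (A w))\<^sup>2)"
    proof (rule quadratic_nonneg_imp_discriminant)
      fix s
      have "norm (A (x + s *\<^sub>R w)) \<le> t * norm (x + s *\<^sub>R w)"
        unfolding t_def by (intro max closed_csubspaceD(2,5)[OF M] x w)
      then have "(norm (A (x + s *\<^sub>R w)))\<^sup>2 \<le> (t * norm (x + s *\<^sub>R w))\<^sup>2"
        by (intro power_mono) simp_all
      also have "\<dots> = t\<^sup>2 * (1 + 2 * (s * inner x w) + s\<^sup>2 * (norm w)\<^sup>2)"
        unfolding power_mult_distrib norm_add_cinner inner_eq_Re_cinner[symmetric]
        by (simp add: x(2) power_mult_distrib)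
      also have "(norm (A (x + s *\<^sub>R w)))\<^sup>2 = t\<^sup>2 + 2 * (s * inner (A x) (A w)) + s\<^sup>2 * (norm (A w))\<^sup>2"
        unfolding bounded_opsD(2)[OF A UNIV_I UNIV_I] bounded_opsD(4)[OF A UNIV_I]
          norm_add_cinner inner_eq_Re_cinner[symmetric]
        by (simp add: t_def power_mult_distrib)
      finally show "0 \<le> 0 + 2 * (t\<^sup>2 * inner x w - inner (A x) (A w)) * s + (t\<^sup>2 * (norm w)\<^sup>2 - (norm (A w))\<^sup>2) * s\<^sup>2"
        by (simp add: algebra_simps)
    qed
    then show ?thesis
      by simp
  qed
  have "inner (A x) (\<i> *\<^sub>C A z) = t\<^sup>2 * inner x (\<i> *\<^sub>C z)"
    using key[OF closed_csubspaceD(4)[OF M z, of \<i>]] by (simp add: bounded_opsD(3)[OF A])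
  then show ?thesis
    using key[OF z] by (simp add: complex_eq_iff Im_cinner t_def[symmetric] flip: inner_eq_Re_cinner)
qed

text \<open>On the closed span of the v n the supremum of the norm of A is not attained.\<close>

lemma not_abs_norm_attaining_if_increasing:
  assumes A: "positive_op UNIV A"
    and v: "\<And>i j. cinner (v i) (v j) = (if i = j then 1 else 0)"
    and Av: "\<And>i j. cinner (A (v i)) (A (v j)) = (if i = j then complex_of_real (\<tau> i) else 0)"
    and \<tau>: "strict_mono (\<tau> :: nat \<Rightarrow> real)"
  shows "\<not> abs_norm_attaining A"
proof
  assume att: "abs_norm_attaining A"
  note U = closed_csubspace_UNIV
  note Ab = positive_opD(1)[OF A U] and sym = positive_opD(2)[OF A U]
  define M where "M = closure (complex_vector.span (range v))"
  have M: "closed_csubspace M"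
    unfolding M_def by (rule closed_csubspace_closure_span)
  have vM: "v n \<in> M" for n
    unfolding M_def by (intro subsetD[OF closure_subset] complex_vector.span_base rangeI)
  have nv: "norm (v n) = 1" for n
    by (rule norm_eq_1_if_cinner) (simp add: v)
  have nAv: "(norm (A (v n)))\<^sup>2 = \<tau> n" for n
    using Av[of n n] unfolding cinner_self by (simp only: if_True of_real_eq_iff refl)
  have "M \<noteq> {0}"
    using vM[of 0] nv[of 0] by auto
  then obtain x where x: "x \<in> M" "norm x = 1" and max: "\<And>y. y \<in> M \<Longrightarrow> norm (A y) \<le> norm (A x) * norm y"
    using att M unfolding abs_norm_attaining_def by blast
  have "cinner x (v n) = 0" for n
  proof -
    \<comment> \<open>Orthogonality of the images makes \<open>w\<close> orthogonal to every
      \<open>v i\<close>, hence to M. So (A x, A (v n)) is \<tau> n times (x, v n), while maximality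
      makes it |A x|^2 times (x, v n).\<close>
    define w where "w = A (A (v n)) - \<tau> n *\<^sub>R v n"
    have yw: "cinner y w = cinner (A y) (A (v n)) - complex_of_real (\<tau> n) * cinner y (v n)" for y
      using symmetric_onD[OF sym, of y "A (v n)"]
      by (simp add: w_def cinner.diff_right cinner.scaleR_right scaleR_conv_of_real)
    have "M \<subseteq> orth_compl {w}"
      unfolding M_def
    proof (intro closure_minimal complex_vector.span_minimal closed_csubspaceD(7,8)[OF closed_csubspace_orth_compl])
      show "range v \<subseteq> orth_compl {w}"
        by (auto intro!: orth_complI simp: yw v Av)
    qed
    then have "cinner x w = 0"
      using x(1) by (auto dest: orth_complD)
    then have "complex_of_real ((norm (A x))\<^sup>2 - \<tau> n) * cinner x (v n) = 0"
      using norm_maximizer_cinner[OF M Ab x max vM[of n]] by (simp add: yw left_diff_distrib)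
    \<comment> \<open>The next vector \<open>v (Suc n)\<close> is what makes this strict, so the two
      factors differ and (x, v n) must vanish.\<close>
    moreover have "\<tau> n < (norm (A x))\<^sup>2"
    proof -
      have "\<tau> n < \<tau> (Suc n)"
        using \<tau> by (simp add: strict_mono_def)
      also have "\<dots> \<le> (norm (A x))\<^sup>2"
        unfolding nAv[symmetric] using max[OF vM[of "Suc n"]] by (intro power_mono) (simp_all add: nv)
      finally show ?thesis .
    qed
    then have "complex_of_real ((norm (A x))\<^sup>2 - \<tau> n) \<noteq> 0"
      unfolding of_real_eq_0_iff by simp
    ultimately show ?thesis
      by (simp only: mult_eq_0_iff) simp
  qed
  then have "x \<in> orth_compl M"
    unfolding M_def orth_compl_closure orth_compl_span by (auto intro: orth_complI)
  then have "cinner x x = 0"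
    using x(1) by (rule orth_complD)
  then show False
    using x(2) by (simp add: cinner_self)
qed

text \<open>A nonnegative eigenvalue at a unit vector is the norm of its image, so no separate
  eigenvalue function has to be carried along.\<close>

definition orthonormal_eigenvectors :: "('a::complex_hilbert \<Rightarrow> 'a) \<Rightarrow> 'a set \<Rightarrow> bool" where
  "orthonormal_eigenvectors A S \<longleftrightarrow> (\<forall>s\<in>S. norm s = 1 \<and> A s = norm (A s) *\<^sub>R s) \<and>
     (\<forall>s\<in>S. \<forall>t\<in>S. s \<noteq> t \<longrightarrow> cinner s t = 0)"

lemma orthonormal_eigenvectorsD:
  assumes "orthonormal_eigenvectors A S"
  shows "s \<in> S \<Longrightarrow> norm s = 1" "s \<in> S \<Longrightarrow> A s = norm (A s) *\<^sub>R s"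
    "s \<in> S \<Longrightarrow> t \<in> S \<Longrightarrow> cinner s t = (if s = t then 1 else 0)"
  using assms by (auto simp: orthonormal_eigenvectors_def cinner_self)

lemma eigenvector_basis_exists:
  assumes A: "positive_op UNIV A" and att: "abs_norm_attaining A"
  obtains S where "orthonormal_eigenvectors A S" "orth_compl S = {0}"
proof -
  note U = closed_csubspace_UNIV
  note Ab = positive_opD(1)[OF A U] and sym = positive_opD(2)[OF A U]
  have "\<exists>S\<in>Collect (orthonormal_eigenvectors A). \<forall>X\<in>Collect (orthonormal_eigenvectors A). S \<subseteq> X \<longrightarrow> X = S"
  proof (rule subset_Zorn')
    fix C assume "subset.chain (Collect (orthonormal_eigenvectors A)) C"
    then have C: "\<And>X. X \<in> C \<Longrightarrow> orthonormal_eigenvectors A X" "\<And>X Y. X \<in> C \<Longrightarrow> Y \<in> C \<Longrightarrow> X \<subseteq> Y \<or> Y \<subseteq> X"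
      by (auto simp: subset_chain_def)
    have "cinner s t = 0" if st: "s \<in> X" "X \<in> C" "t \<in> Y" "Y \<in> C" "s \<noteq> t" for s t X Y
    proof -
      obtain Z where "Z \<in> C" "s \<in> Z" "t \<in> Z"
        using C(2)[OF st(2,4)] st by blast
      then show ?thesis
        using orthonormal_eigenvectorsD(3)[OF C(1)] st(5) by fastforce
    qed
    then show "\<Union>C \<in> Collect (orthonormal_eigenvectors A)"
      using C(1) by (simp add: orthonormal_eigenvectors_def)
  qed
  then obtain S where S: "orthonormal_eigenvectors A S"
    and maxS: "\<And>X. orthonormal_eigenvectors A X \<Longrightarrow> S \<subseteq> X \<Longrightarrow> X = S"
    by blast
  define M where "M = orth_compl S"
  have M: "closed_csubspace M"
    unfolding M_def by (rule closed_csubspace_orth_compl)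
  have AM: "A y \<in> M" if "y \<in> M" for y
    unfolding M_def
  proof (rule orth_complI)
    fix s assume s: "s \<in> S"
    have "cinner (A y) s = cinner y (norm (A s) *\<^sub>R s)"
      using symmetric_onD[OF sym, of y s] orthonormal_eigenvectorsD(2)[OF S s] by simp
    then show "cinner (A y) s = 0"
      using that s by (simp add: M_def cinner.scaleR_right orth_complD)
  qed
  have "M = {0}"
  proof (rule ccontr)
    assume "M \<noteq> {0}"
    then obtain x where x: "x \<in> M" "norm x = 1" and max: "\<And>y. y \<in> M \<Longrightarrow> norm (A y) \<le> norm (A x) * norm y"
      using att M unfolding abs_norm_attaining_def by blast
    \<comment> \<open>The complement of a set of eigenvectors is invariant, so A restricts to a
      positive operator there, and a norm maximizer of it would enlarge the maximal set.\<close>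
    have AMb: "restrict A M \<in> bounded_ops M M"
      using restrict_bounded_ops[OF Ab M subset_UNIV] AM unfolding bounded_ops_def by (auto simp: PiE_def)
    have "positive_op M (restrict A M)"
      unfolding positive_op_iff[OF M] using AMb symmetric_onD[OF sym] positive_opD(3)[OF A U]
      by (auto simp: symmetric_on_def)
    from positive_op_maximizer_eigenvector[OF M this, of "norm (A x)" x]
    have Ax: "A x = norm (A x) *\<^sub>R x"
      using x max by simp
    have "orthonormal_eigenvectors A (insert x S)"
      using S x Ax by (auto simp: orthonormal_eigenvectors_def M_def dest: orth_complD)
    then have "x \<in> S"
      using maxS by blast
    then have "cinner x x = 0"
      using x(1) by (auto simp: M_def dest: orth_complD)
    then show False
      using x(2) by (simp add: cinner_self)
  qed
  then show thesis
    using that[OF S] M_def by simp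
qed

text \<open>Total boundedness: a finite net of a compact set close to S is itself nearly a net of S.
  The compact sets used below are balls of finite-dimensional spaces.\<close>

lemma compact_closure_if_approx:
  fixes S :: "'a::complete_space set"
  assumes "\<And>e. 0 < e \<Longrightarrow> \<exists>C. compact C \<and> (\<forall>x\<in>S. \<exists>c\<in>C. dist c x \<le> e)"
  shows "compact (closure S)"
  unfolding compact_eq_totally_bounded
proof (intro conjI allI impI)
  show "complete (closure S)"
    by (simp add: complete_eq_closed)
  fix e :: real assume e: "0 < e"
  then obtain C where C: "compact C" "\<And>x. x \<in> S \<Longrightarrow> \<exists>c\<in>C. dist c x \<le> e / 4"
    using assms[of "e / 4"] by auto
  then obtain k where k: "finite k" "C \<subseteq> (\<Union>x\<in>k. ball x (e / 4))"
    using e unfolding compact_eq_totally_bounded by (metis divide_pos_pos zero_less_numeral)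
  \<comment> \<open>Closed balls of half the radius, so that the cover passes to the closure before
    the balls are enlarged to open ones.\<close>
  have "S \<subseteq> (\<Union>x\<in>k. cball x (e / 2))"
  proof
    fix x assume "x \<in> S"
    then obtain c where c: "c \<in> C" "dist c x \<le> e / 4"
      using C(2) by blast
    then obtain y where y: "y \<in> k" "dist y c < e / 4"
      using k(2) by auto
    have "dist y x \<le> dist y c + dist c x"
      by (rule dist_triangle)
    then show "x \<in> (\<Union>x\<in>k. cball x (e / 2))"
      using y c by force
  qed
  then have "closure S \<subseteq> (\<Union>x\<in>k. cball x (e / 2))"
    using k(1) by (intro closure_minimal closed_UN) auto
  also have "\<dots> \<subseteq> (\<Union>x\<in>k. ball x e)"
    using e by (force simp: mem_ball)
  finally show "\<exists>k. finite k \<and> closure S \<subseteq> (\<Union>x\<in>k. ball x e)"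
    using k(1) by blast
qed

lemma compact_finite_dim_ball:
  assumes V: "complex_vector.subspace V" "finite_dim V"
  shows "compact (V \<inter> cball 0 r)"
  unfolding compact_eq_seq_compact_metric seq_compact_def
proof (intro allI impI)
  fix f assume f: "\<forall>n::nat. f n \<in> V \<inter> cball 0 r"
  then obtain s l where s: "strict_mono s" "(\<lambda>k. f (s k)) \<longlonglongrightarrow> l"
    using finite_dim_convergent_subseq[OF V, of f r] by (auto simp: convergent_def dist_norm)
  have "closed (V \<inter> cball 0 r)"
    using closed_csubspaceD(7)[OF finite_dim_closed[OF V]] by (intro closed_Int) auto
  moreover have "f (s k) \<in> V \<inter> cball 0 r" for k
    using f by (rule spec)
  ultimately have "l \<in> V \<inter> cball 0 r"
    using s(2) by (rule closed_sequentially)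
  then show "\<exists>l\<in>V \<inter> cball 0 r. \<exists>r. strict_mono r \<and> (f \<circ> r) \<longlonglongrightarrow> l"
    using s by (auto simp: o_def)
qed

text \<open>Used twice: as the finite-rank summand F, and as the truncations that approximate
  K.\<close>

definition finite_diag :: "'a::complex_hilbert set \<Rightarrow> ('a \<Rightarrow> real) \<Rightarrow> 'a \<Rightarrow> 'a" where
  "finite_diag J d x = (\<Sum>s\<in>J. (complex_of_real (d s) * cinner x s) *\<^sub>C s)"

lemma finite_diag_add: "finite_diag J d (x + y) = finite_diag J d x + finite_diag J d y"
  by (simp add: finite_diag_def cinner_add_left distrib_left scaleC_add_left sum.distrib)

lemma finite_diag_scaleC: "finite_diag J d (a *\<^sub>C x) = a *\<^sub>C finite_diag J d x"
  by (simp add: finite_diag_def cinner_scaleC_left complex_vector.scale_sum_right scaleC_scaleC mult_ac)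

lemma finite_diag_mem_span: "finite_diag J d x \<in> complex_vector.span J"
  unfolding finite_diag_def by (intro complex_vector.span_sum complex_vector.span_scale complex_vector.span_base)

lemma finite_diag_bounded_ops: "finite_diag J d \<in> bounded_ops UNIV UNIV"
proof (rule bounded_opsI[where C = "\<Sum>s\<in>J. \<bar>d s\<bar> * norm s * norm s"])
  fix x :: 'a
  have "norm (finite_diag J d x) \<le> (\<Sum>s\<in>J. norm ((complex_of_real (d s) * cinner x s) *\<^sub>C s))"
    unfolding finite_diag_def by (rule norm_sum)
  also have "\<dots> \<le> (\<Sum>s\<in>J. \<bar>d s\<bar> * norm s * norm s * norm x)"
  proof (rule sum_mono)
    fix s
    have "\<bar>d s\<bar> * cmod (cinner x s) * norm s \<le> \<bar>d s\<bar> * (norm x * norm s) * norm s"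
      by (intro mult_right_mono mult_left_mono norm_cinner_le) auto
    then show "norm ((complex_of_real (d s) * cinner x s) *\<^sub>C s) \<le> \<bar>d s\<bar> * norm s * norm s * norm x"
      by (simp add: norm_scaleC norm_mult mult_ac)
  qed
  finally show "norm (finite_diag J d x) \<le> (\<Sum>s\<in>J. \<bar>d s\<bar> * norm s * norm s) * norm x"
    by (simp add: sum_distrib_right)
qed (simp_all add: finite_diag_add finite_diag_scaleC)

lemma finite_diag_symmetric: "symmetric_on UNIV (finite_diag J d)"
  unfolding symmetric_on_def finite_diag_def
  by (auto simp: cinner.sum_left cinner.sum_right cinner_scaleC_left cinner_scaleC_right mult_ac
      cinner_commute[of _ "_ :: 'a", symmetric] intro!: sum.cong)

lemma bounded_ops_diff_op:
  assumes "S \<in> bounded_ops UNIV UNIV" "T \<in> bounded_ops UNIV UNIV"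
  shows "(\<lambda>x. S x - T x) \<in> bounded_ops UNIV UNIV"
proof -
  obtain C D where "\<And>x. norm (S x) \<le> C * norm x" "\<And>x. norm (T x) \<le> D * norm x"
    using bounded_ops_bound[OF assms(1)] bounded_ops_bound[OF assms(2)] UNIV_I by metis
  then show ?thesis
    by (intro bounded_opsI[where C = "C + D"])
      (auto simp: bounded_opsD(2,3)[OF assms(1)] bounded_opsD(2,3)[OF assms(2)] scaleC.diff_right distrib_right
        intro!: order_trans[OF norm_triangle_ineq4] add_mono)
qed

lemma scaleR_bounded_ops: "(\<lambda>x. r *\<^sub>R x) \<in> bounded_ops UNIV UNIV"
  by (intro bounded_opsI[where C = "\<bar>r\<bar>"]) (simp_all add: scaleR_add_right scaleC.scaleR_right)

section \<open>Diagonal operators over a complete orthonormal set of eigenvectors\<close>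

context
  fixes A :: "'a::complex_hilbert \<Rightarrow> 'a" and S
  assumes S: "orthonormal_eigenvectors A S" and dense: "orth_compl S = {0}"
begin

lemma finite_diag_eigenvector:
  assumes "finite J" "J \<subseteq> S" "s \<in> S"
  shows "finite_diag J d s = (if s \<in> J then d s else 0) *\<^sub>R s"
proof -
  have "finite_diag J d s = (\<Sum>t\<in>J. if s = t then d t *\<^sub>R t else 0)"
    unfolding finite_diag_def using assms
    by (intro sum.cong) (auto simp: orthonormal_eigenvectorsD(3)[OF S] subset_iff scaleR_scaleC)
  then show ?thesis
    using assms(1) by simp
qed

lemma cinner_orthonormal_sum:
  assumes "finite t" "t \<subseteq> S"
  shows "cinner (\<Sum>s\<in>t. a s *\<^sub>C s) (\<Sum>s\<in>t. b s *\<^sub>C s) = (\<Sum>s\<in>t. a s * cnj (b s))"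
proof -
  have "cinner (\<Sum>s\<in>t. a s *\<^sub>C s) (\<Sum>s\<in>t. b s *\<^sub>C s) = (\<Sum>s\<in>t. \<Sum>u\<in>t. a s * cnj (b u) * cinner s u)"
    unfolding cinner.sum_left
    by (simp add: cinner.sum_right cinner_scaleC_left cinner_scaleC_right sum_distrib_left mult_ac)
  also have "\<dots> = (\<Sum>s\<in>t. \<Sum>u\<in>t. if s = u then a s * cnj (b u) else 0)"
    using assms(2) by (intro sum.cong) (auto simp: orthonormal_eigenvectorsD(3)[OF S] subset_iff)
  also have "\<dots> = (\<Sum>s\<in>t. a s * cnj (b s))"
    using assms(1) by (intro sum.cong) auto
  finally show ?thesis .
qed

text \<open>Both claims are coordinate computations on the span of S; completeness makes the span
  dense, and both conditions are closed, so continuity of D extends them.\<close>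

lemma diagonal_op:
  assumes D: "D \<in> bounded_ops UNIV UNIV" and d: "\<And>s. s \<in> S \<Longrightarrow> D s = d s *\<^sub>R s \<and> 0 \<le> d s \<and> d s \<le> c"
  shows "norm (D x) \<le> c * norm x" "cinner (D x) x \<in> \<real>\<^sub>\<ge>\<^sub>0"
proof -
  let ?V = "complex_vector.span S"
  have span: "norm (D x) \<le> c * norm x \<and> cinner (D x) x \<in> \<real>\<^sub>\<ge>\<^sub>0" if "x \<in> ?V" for x
  proof -
    have "\<exists>t a. finite t \<and> t \<subseteq> S \<and> x = (\<Sum>s\<in>t. a s *\<^sub>C s)"
      using that unfolding complex_vector.span_explicit mem_Collect_eq by (elim exE conjE) (intro exI conjI)
    then obtain t a where t: "finite t" "t \<subseteq> S" and x: "x = (\<Sum>s\<in>t. a s *\<^sub>C s)"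
      by (elim exE conjE)
    have d': "D s = d s *\<^sub>R s" "0 \<le> d s" "d s \<le> c" if "s \<in> t" for s
      using d t(2) that by auto
    have D0: "D 0 = 0"
      by (rule bounded_ops_0[OF D closed_csubspace_UNIV])
    have "D (\<Sum>s\<in>t. a s *\<^sub>C s) = (\<Sum>s\<in>t. D (a s *\<^sub>C s))"
      using t(1) by induction (simp_all add: D0 bounded_opsD(2)[OF D])
    also have "\<dots> = (\<Sum>s\<in>t. (a s * complex_of_real (d s)) *\<^sub>C s)"
      by (intro sum.cong) (simp_all add: bounded_opsD(3)[OF D] d' scaleR_scaleC scaleC_scaleC)
    finally have Dx: "D x = (\<Sum>s\<in>t. (a s * complex_of_real (d s)) *\<^sub>C s)"
      by (simp add: x)
    have nx: "(norm x)\<^sup>2 = (\<Sum>s\<in>t. (cmod (a s))\<^sup>2)"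
    proof -
      have "complex_of_real ((norm x)\<^sup>2) = complex_of_real (\<Sum>s\<in>t. (cmod (a s))\<^sup>2)"
        unfolding cinner_self[symmetric] x cinner_orthonormal_sum[OF t] of_real_sum complex_norm_square ..
      then show ?thesis
        unfolding of_real_eq_iff .
    qed
    have nDx: "(norm (D x))\<^sup>2 = (\<Sum>s\<in>t. (cmod (a s))\<^sup>2 * (d s)\<^sup>2)"
    proof -
      have "complex_of_real ((norm (D x))\<^sup>2) = complex_of_real (\<Sum>s\<in>t. (cmod (a s))\<^sup>2 * (d s)\<^sup>2)"
        unfolding cinner_self[symmetric] Dx cinner_orthonormal_sum[OF t] of_real_sum of_real_mult complex_norm_square
        by (intro sum.cong) (simp_all add: power2_eq_square mult_ac)
      then show ?thesis
        unfolding of_real_eq_iff .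
    qed
    have Dxx: "cinner (D x) x = complex_of_real (\<Sum>s\<in>t. (cmod (a s))\<^sup>2 * d s)"
      unfolding Dx unfolding x cinner_orthonormal_sum[OF t] of_real_sum of_real_mult complex_norm_square
      by (intro sum.cong) (simp_all add: mult_ac)
    \<comment> \<open>Squares can be compared only for c \<ge> 0, which one basis vector in the
      support guarantees; an empty support means x = 0.\<close>
    have c: "0 \<le> c \<or> t = {}"
      using d' order_trans by blast
    have "(norm (D x))\<^sup>2 \<le> (\<Sum>s\<in>t. (cmod (a s))\<^sup>2 * c\<^sup>2)"
      unfolding nDx using d' by (intro sum_mono mult_left_mono power_mono) auto
    also have "\<dots> = (c * norm x)\<^sup>2"
      by (simp add: nx power_mult_distrib sum_distrib_left mult.commute)
    finally have le: "(norm (D x))\<^sup>2 \<le> (c * norm x)\<^sup>2" .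
    have "norm (D x) \<le> c * norm x"
    proof (cases "t = {}")
      case True
      then show ?thesis
        by (simp add: x D0)
    next
      case False
      then show ?thesis
        using c by (intro power2_le_imp_le[OF le]) simp
    qed
    moreover have "0 \<le> (\<Sum>s\<in>t. (cmod (a s))\<^sup>2 * d s)"
      using d' by (intro sum_nonneg) simp
    ultimately show ?thesis
      unfolding Dxx nonneg_Reals_of_real_iff by blast
  qed
  have "UNIV \<subseteq> closure ?V"
    by (rule subset_of_orth_compl_trivial[OF closed_csubspace_closure_span closed_csubspace_UNIV])
      (simp_all add: orth_compl_closure orth_compl_span dense)
  then obtain y where y: "\<And>n. y n \<in> ?V" "y \<longlonglongrightarrow> x"
    unfolding closure_sequential by (metis UNIV_I closure_sequential subset_eq)
  have Dy: "(\<lambda>n. D (y n)) \<longlonglongrightarrow> D x"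
    by (rule bounded_ops_tendsto[OF D closed_csubspace_UNIV UNIV_I y(2)])
  show "norm (D x) \<le> c * norm x"
    by (rule LIMSEQ_le[OF tendsto_norm[OF Dy] tendsto_mult_left[OF tendsto_norm[OF y(2)]]])
      (use span[OF y(1)] in blast)
  show "cinner (D x) x \<in> \<real>\<^sub>\<ge>\<^sub>0"
    by (rule closed_sequentially[OF closed_nonneg_Reals_complex _ cinner.tendsto[OF Dy y(2)]])
      (use span[OF y(1)] in blast)
qed

lemma no_increasing_eigenvalues:
  assumes A: "positive_op UNIV A" and att: "abs_norm_attaining A"
    and s: "\<And>n::nat. s n \<in> S" "\<And>n. norm (A (s n)) < norm (A (s (Suc n)))"
  shows False
proof -
  have mono: "strict_mono (\<lambda>n. norm (A (s n)))"
    using s(2) by (simp add: strict_mono_Suc_iff)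
  have inj: "s i = s j \<longleftrightarrow> i = j" for i j
    using strict_mono_eq[OF mono, of i j] by auto
  note SD = orthonormal_eigenvectorsD[OF S]
  have "cinner (A (s i)) (A (s j)) = (if i = j then complex_of_real ((norm (A (s i)))\<^sup>2) else 0)" for i j
  proof (cases "i = j")
    case False
    have "cinner (A (s i)) (A (s j)) = cinner (norm (A (s i)) *\<^sub>R s i) (norm (A (s j)) *\<^sub>R s j)"
      by (subst (1 2) SD(2)[OF s(1)]) (rule refl)
    then show ?thesis
      using False SD(3)[OF s(1) s(1), of i j] by (simp add: inj cinner.scaleR_left cinner.scaleR_right)
  qed (simp add: cinner_self)
  moreover have "strict_mono (\<lambda>n. (norm (A (s n)))\<^sup>2)"
    using mono by (auto simp: strict_mono_def intro!: power_strict_mono)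
  ultimately show False
    using not_abs_norm_attaining_if_increasing[OF A, of s "\<lambda>n. (norm (A (s n)))\<^sup>2"] SD(3)[OF s(1) s(1)] att
    by (simp add: inj)
qed

text \<open>
  Mixing a low and a high eigenvector in the right proportion realizes every intermediate value;
  two infinite clusters of eigenvalues thus produce an orthonormal sequence with increasing norms.
\<close>

lemma no_two_eigenvalue_clusters:
  assumes A: "positive_op UNIV A" and att: "abs_norm_attaining A" and lt: "\<beta> < \<gamma>"
    and low: "infinite {s\<in>S. norm (A s) \<le> \<beta>}" and high: "infinite {s\<in>S. \<gamma> \<le> norm (A s)}"
  shows False
proof -
  note SD = orthonormal_eigenvectorsD[OF S]
  note Ab = positive_opD(1)[OF A closed_csubspace_UNIV]
  obtain e where e: "inj e" "range (e :: nat \<Rightarrow> 'a) \<subseteq> {s\<in>S. norm (A s) \<le> \<beta>}"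
    using infinite_countable_subset[OF low] by blast
  obtain f where f: "inj f" "range (f :: nat \<Rightarrow> 'a) \<subseteq> {s\<in>S. \<gamma> \<le> norm (A s)}"
    using infinite_countable_subset[OF high] by blast
  have eS: "e n \<in> S" "norm (A (e n)) \<le> \<beta>" and fS: "f n \<in> S" "\<gamma> \<le> norm (A (f n))" for n
    using e(2) f(2) by auto
  have \<beta>0: "0 \<le> \<beta>"
    using order_trans[OF norm_ge_zero eS(2)] .
  define a where "a n = norm (A (e n))" for n
  define b where "b n = norm (A (f n))" for n
  \<comment> \<open>Any strictly increasing sequence strictly between the two squares would do; the
    offset 2 keeps already the first term above \<beta>^2.\<close>
  define \<tau> where "\<tau> n = \<gamma>\<^sup>2 - (\<gamma>\<^sup>2 - \<beta>\<^sup>2) / (real n + 2)" for n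
  \<comment> \<open>The weight of the high eigenvector, solving (1 - q) a^2 + q b^2 = \<tau>; the
    square roots of 1 - q and q become the mixing coefficients.\<close>
  define q where "q n = (\<tau> n - (a n)\<^sup>2) / ((b n)\<^sup>2 - (a n)\<^sup>2)" for n
  have gap: "0 < \<gamma>\<^sup>2 - \<beta>\<^sup>2"
    using lt \<beta>0 by (simp add: power_strict_mono)
  have \<tau>: "\<beta>\<^sup>2 < \<tau> n" "\<tau> n < \<gamma>\<^sup>2" for n
  proof -
    have "(\<gamma>\<^sup>2 - \<beta>\<^sup>2) / (real n + 2) < (\<gamma>\<^sup>2 - \<beta>\<^sup>2) / 1"
      using gap by (intro divide_strict_left_mono) auto
    moreover have "0 < (\<gamma>\<^sup>2 - \<beta>\<^sup>2) / (real n + 2)"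
      using gap by (intro divide_pos_pos) auto
    ultimately show "\<beta>\<^sup>2 < \<tau> n" "\<tau> n < \<gamma>\<^sup>2"
      by (simp_all add: \<tau>_def)
  qed
  have \<tau>_mono: "strict_mono \<tau>"
    unfolding strict_mono_def \<tau>_def using gap by (auto intro!: divide_strict_left_mono mult_pos_pos)
  have ab: "(a n)\<^sup>2 \<le> \<beta>\<^sup>2" "\<gamma>\<^sup>2 \<le> (b n)\<^sup>2" for n
    using eS(2) fS(2) lt \<beta>0 by (auto simp: a_def b_def intro!: power_mono)
  have q: "0 \<le> q n" "q n \<le> 1" "(1 - q n) * (a n)\<^sup>2 + q n * (b n)\<^sup>2 = \<tau> n" for n
  proof -
    have pos: "0 < (b n)\<^sup>2 - (a n)\<^sup>2"
      using ab[of n] gap by linarith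
    show "0 \<le> q n"
      unfolding q_def using ab(1)[of n] \<tau>(1)[of n] pos by (intro divide_nonneg_pos) auto
    show "q n \<le> 1"
      unfolding q_def using ab(2)[of n] \<tau>(2)[of n] pos by (simp add: divide_le_eq_1)
    have "q n * ((b n)\<^sup>2 - (a n)\<^sup>2) = \<tau> n - (a n)\<^sup>2"
      using pos by (simp add: q_def)
    then show "(1 - q n) * (a n)\<^sup>2 + q n * (b n)\<^sup>2 = \<tau> n"
      by (simp add: algebra_simps)
  qed
  define x where "x n = sqrt (1 - q n)" for n
  define y where "y n = sqrt (q n)" for n
  have xy: "x n * x n = 1 - q n" "y n * y n = q n" for n
    using q[of n] by (simp_all add: x_def y_def)
  define v where "v n = x n *\<^sub>R e n + y n *\<^sub>R f n" for n
  have ee: "cinner (e i) (e j) = (if i = j then 1 else 0)" "cinner (f i) (f j) = (if i = j then 1 else 0)"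
    "cinner (e i) (f j) = 0" "cinner (f i) (e j) = 0" for i j
  proof -
    have "e i \<noteq> f j" for i j
      using eS(2)[of i] fS(2)[of j] lt by auto
    then show "cinner (e i) (e j) = (if i = j then 1 else 0)" "cinner (f i) (f j) = (if i = j then 1 else 0)"
      "cinner (e i) (f j) = 0" "cinner (f i) (e j) = 0"
      using SD(3) eS(1) fS(1) e(1) f(1) by (auto simp: inj_eq) metis+
  qed
  have Av: "A (v n) = (x n * a n) *\<^sub>R e n + (y n * b n) *\<^sub>R f n" for n
  proof -
    have "A (e n) = a n *\<^sub>R e n" "A (f n) = b n *\<^sub>R f n"
      unfolding a_def b_def by (rule SD(2)[OF eS(1)], rule SD(2)[OF fS(1)])
    then show ?thesis
      by (simp add: v_def bounded_opsD(2,4)[OF Ab])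
  qed
  have gen: "cinner (r *\<^sub>R e i + t *\<^sub>R f i) (r' *\<^sub>R e j + t' *\<^sub>R f j) =
      (if i = j then complex_of_real (r * r' + t * t') else 0)" for r t r' t' i j
    by (simp add: cinner_add_left cinner_add_right cinner.scaleR_left cinner.scaleR_right ee scaleR_conv_of_real)
  have "cinner (v i) (v j) = (if i = j then 1 else 0)" for i j
    unfolding v_def gen using xy by simp
  moreover have "cinner (A (v i)) (A (v j)) = (if i = j then complex_of_real (\<tau> i) else 0)" for i j
  proof -
    have "(x i * a i) * (x i * a i) + (y i * b i) * (y i * b i) = (x i * x i) * (a i)\<^sup>2 + (y i * y i) * (b i)\<^sup>2" for i
      by (simp add: power2_eq_square mult_ac)
    then have "(x i * a i) * (x i * a i) + (y i * b i) * (y i * b i) = \<tau> i" for i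
      by (simp only: xy q(3))
    then show ?thesis
      unfolding Av gen by (cases "i = j") (simp_all only: if_True if_False simp_thms)
  qed
  ultimately show False
    using not_abs_norm_attaining_if_increasing[OF A _ _ \<tau>_mono, of v] att by blast
qed

text \<open>\<alpha> is the supremum of the levels with only finitely many basis vectors below them;
  for finite S the value 0 works.\<close>

lemma eigenvalue_threshold:
  assumes A: "positive_op UNIV A" and att: "abs_norm_attaining A"
  obtains \<alpha> where "0 \<le> \<alpha>" "finite {s\<in>S. norm (A s) < \<alpha>}" "\<And>\<gamma>. \<alpha> < \<gamma> \<Longrightarrow> finite {s\<in>S. \<gamma> \<le> norm (A s)}"
proof (cases "finite S")
  case True
  then show thesis
    using that[of 0] by simp
next
  case infS: False
  note SD = orthonormal_eigenvectorsD[OF S]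
  note Ab = positive_opD(1)[OF A closed_csubspace_UNIV]
  obtain C where C: "\<And>x. norm (A x) \<le> C * norm x"
    using bounded_ops_bound[OF Ab] UNIV_I by metis
  define X where "X = {t. 0 \<le> t \<and> finite {s\<in>S. norm (A s) < t}}"
  have le: "t \<le> C" if "t \<in> X" for t
  proof (rule ccontr)
    assume "\<not> t \<le> C"
    then have "norm (A s) < t" if "s \<in> S" for s
      using C[of s] SD(1)[OF that] by simp
    then have "{s\<in>S. norm (A s) < t} = S"
      by blast
    then show False
      using \<open>t \<in> X\<close> infS by (simp add: X_def)
  qed
  have X0: "0 \<in> X"
    by (simp add: X_def)
  have bdd: "bdd_above X"
    using le by (rule bdd_aboveI)
  define \<alpha> where "\<alpha> = Sup X"
  have \<alpha>0: "0 \<le> \<alpha>"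
    unfolding \<alpha>_def by (rule cSup_upper[OF X0 bdd])
  have below: "finite {s\<in>S. norm (A s) < t}" if t: "t < \<alpha>" for t
  proof -
    obtain u where "u \<in> X" "t < u"
      using t less_cSup_iff[OF _ bdd, of t] X0 unfolding \<alpha>_def by auto
    then have "{s\<in>S. norm (A s) < t} \<subseteq> {s\<in>S. norm (A s) < u}"
      by auto
    then show ?thesis
      by (rule finite_subset) (use \<open>u \<in> X\<close> in \<open>simp add: X_def\<close>)
  qed
  \<comment> \<open>The supremum is itself such a level: otherwise infinitely many eigenvalues lie
    below \<alpha> but only finitely many below each t < \<alpha>, and a strictly increasing
    sequence can be chosen.\<close>
  have "finite {s\<in>S. norm (A s) < \<alpha>}"
  proof (rule ccontr)
    assume inf: "infinite {s\<in>S. norm (A s) < \<alpha>}" (is "infinite ?J")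
    have "\<exists>s. \<forall>n. s n \<in> ?J \<and> norm (A (s n)) < norm (A (s (Suc n)))"
    proof (rule dependent_nat_choice)
      show "\<exists>s. s \<in> ?J"
        using infinite_imp_nonempty[OF inf] by blast
      fix s and n :: nat
      assume "s \<in> ?J"
      then have "norm (A s) < (norm (A s) + \<alpha>) / 2" "(norm (A s) + \<alpha>) / 2 < \<alpha>"
        by auto
      then have "infinite (?J - {u\<in>S. norm (A u) < (norm (A s) + \<alpha>) / 2})"
        by (intro Diff_infinite_finite inf below)
      from infinite_imp_nonempty[OF this] obtain u where "u \<in> ?J - {u\<in>S. norm (A u) < (norm (A s) + \<alpha>) / 2}"
        by blast
      then show "\<exists>u. u \<in> ?J \<and> norm (A s) < norm (A u)"
        using \<open>norm (A s) < (norm (A s) + \<alpha>) / 2\<close> by (intro exI[of _ u]) auto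
    qed
    then show False
      using no_increasing_eigenvalues[OF A att] by blast
  qed
  moreover have "finite {s\<in>S. \<gamma> \<le> norm (A s)}" if \<gamma>: "\<alpha> < \<gamma>" for \<gamma>
  proof (rule ccontr)
    assume high: "infinite {s\<in>S. \<gamma> \<le> norm (A s)}"
    \<comment> \<open>A level above \<alpha>, hence with infinitely many eigenvalues below it, yet
      strictly below \<gamma>: these are the two separated clusters.\<close>
    define t where "t = (\<alpha> + \<gamma>) / 2"
    have t: "\<alpha> < t" "t < \<gamma>"
      using \<gamma> by (auto simp: t_def)
    then have "t \<notin> X"
      using cSup_upper[OF _ bdd, of t] unfolding \<alpha>_def by auto
    then have "infinite {s\<in>S. norm (A s) < t}"
      using t(1) \<alpha>0 by (simp add: X_def)
    then have "infinite {s\<in>S. norm (A s) \<le> t}"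
      by (rule contrapos_nn) (rule finite_subset[rotated], auto)
    then show False
      using no_two_eigenvalue_clusters[OF A att t(2) _ high] by blast
  qed
  ultimately show thesis
    using that \<alpha>0 by blast
qed

text \<open>Cutting D off at level \<epsilon> leaves a diagonal remainder with entries in
  [0, \<epsilon>], so the image of the unit ball lies within \<epsilon> of a ball in a
  finite-dimensional space.\<close>

lemma diagonal_compact:
  assumes D: "D \<in> bounded_ops UNIV UNIV" and d: "\<And>s. s \<in> S \<Longrightarrow> D s = d s *\<^sub>R s \<and> 0 \<le> d s"
    and fin: "\<And>\<epsilon>. 0 < \<epsilon> \<Longrightarrow> finite {s\<in>S. \<epsilon> \<le> d s}"
  shows "compact_op UNIV D"
proof -
  have "\<exists>C. compact C \<and> (\<forall>x\<in>D ` cball 0 1. \<exists>c\<in>C. dist c x \<le> \<epsilon>)" if \<epsilon>: "0 < \<epsilon>" for \<epsilon>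
  proof -
    define J where "J = {s\<in>S. \<epsilon> \<le> d s}"
    have J: "finite J" "J \<subseteq> S"
      using fin[OF \<epsilon>] by (auto simp: J_def)
    define G where "G = finite_diag J d"
    have Gb: "G \<in> bounded_ops UNIV UNIV"
      unfolding G_def by (rule finite_diag_bounded_ops)
    obtain B where B: "0 < B" "\<And>x. norm (G x) \<le> B * norm x"
      using bounded_ops_bound[OF Gb] UNIV_I by metis
    have near: "norm (D x - G x) \<le> \<epsilon> * norm x" for x
    proof (rule diagonal_op(1)[OF bounded_ops_diff_op[OF D Gb], where d = "\<lambda>s. if s \<in> J then 0 else d s"])
      fix s assume s: "s \<in> S"
      show "D s - G s = (if s \<in> J then 0 else d s) *\<^sub>R s \<and> 0 \<le> (if s \<in> J then 0 else d s) \<and>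
          (if s \<in> J then 0 else d s) \<le> \<epsilon>"
        using d[OF s] \<epsilon> s unfolding G_def finite_diag_eigenvector[OF J s] by (auto simp: J_def)
    qed
    let ?C = "complex_vector.span J \<inter> cball 0 B"
    have "compact ?C"
      by (intro compact_finite_dim_ball complex_vector.subspace_span finite_dim_span J)
    moreover have "\<exists>c\<in>?C. dist c (D x) \<le> \<epsilon>" if x: "x \<in> cball 0 1" for x
    proof (rule bexI[of _ "G x"])
      have x1: "norm x \<le> 1"
        using x by (simp add: dist_norm)
      have "norm (G x) \<le> B * 1"
        using B(1) x1 by (intro order_trans[OF B(2)] mult_left_mono) auto
      then show "G x \<in> ?C"
        by (simp add: G_def finite_diag_mem_span)
      have "norm (D x - G x) \<le> \<epsilon> * 1"
        using \<epsilon> x1 by (intro order_trans[OF near] mult_left_mono) auto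
      then show "dist (G x) (D x) \<le> \<epsilon>"
        by (simp add: dist_norm norm_minus_commute)
    qed
    ultimately show ?thesis
      by blast
  qed
  then show ?thesis
    using compact_closure_if_approx[of "D ` cball 0 1"] D by (simp add: compact_op_def)
qed

end

lemma abs_norm_attaining_imp_scalar_plus_compact_plus_finite:
  fixes A :: "'a::complex_hilbert \<Rightarrow> 'a"
  assumes A: "positive_op UNIV A" and att: "abs_norm_attaining A"
  shows "\<exists>\<alpha>::real. \<exists>K F. 0 \<le> \<alpha> \<and> positive_op UNIV K \<and> compact_op UNIV K \<and>
    self_adjoint_op UNIV F \<and> finite_rank UNIV F \<and> A = (\<lambda>x. \<alpha> *\<^sub>R x + K x + F x)"
proof -
  note Ab = positive_opD(1)[OF A closed_csubspace_UNIV]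
  obtain S where S: "orthonormal_eigenvectors A S" "orth_compl S = {0}"
    using eigenvector_basis_exists[OF A att] .
  obtain \<alpha> where \<alpha>: "0 \<le> \<alpha>" "finite {s\<in>S. norm (A s) < \<alpha>}" "\<And>\<gamma>. \<alpha> < \<gamma> \<Longrightarrow> finite {s\<in>S. \<gamma> \<le> norm (A s)}"
    using eigenvalue_threshold[OF S A att] by blast
  define J where "J = {s\<in>S. norm (A s) < \<alpha>}"
  have J: "finite J" "J \<subseteq> S"
    using \<alpha>(2) by (auto simp: J_def)
  define F where "F = finite_diag J (\<lambda>s. norm (A s) - \<alpha>)"
  define K where "K x = A x - \<alpha> *\<^sub>R x - F x" for x
  have Fb: "F \<in> bounded_ops UNIV UNIV"
    unfolding F_def by (rule finite_diag_bounded_ops)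
  have Kb: "K \<in> bounded_ops UNIV UNIV"
    unfolding K_def[abs_def] by (intro bounded_ops_diff_op Ab Fb scaleR_bounded_ops)
  obtain C where C: "\<And>x. norm (A x) \<le> C * norm x"
    using bounded_ops_bound[OF Ab] UNIV_I by metis
  \<comment> \<open>On basis vectors outside \<open>J\<close> the operator F vanishes; on those in
    \<open>J\<close> it cancels A - \<alpha>. The positive part is what K retains.\<close>
  define d where "d s = max (norm (A s) - \<alpha>) 0" for s
  have Ks: "K s = d s *\<^sub>R s" if s: "s \<in> S" for s
  proof -
    have "K s = (norm (A s) - \<alpha> - (if s \<in> J then norm (A s) - \<alpha> else 0)) *\<^sub>R s"
      unfolding K_def F_def finite_diag_eigenvector[OF S J s] scaleR_diff_left
      using orthonormal_eigenvectorsD(2)[OF S(1) s] by simp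
    then show ?thesis
      using s by (auto simp: d_def J_def)
  qed
  have "positive_op UNIV K"
    unfolding positive_op_def
  proof (intro conjI ballI Kb)
    show "cinner (K x) x \<in> \<real>\<^sub>\<ge>\<^sub>0" for x
    proof (rule diagonal_op(2)[OF S Kb, where d = d and c = "max (C - \<alpha>) 0"])
      show "K s = d s *\<^sub>R s \<and> 0 \<le> d s \<and> d s \<le> max (C - \<alpha>) 0" if "s \<in> S" for s
        using Ks[OF that] C[of s] orthonormal_eigenvectorsD(1)[OF S(1) that] by (auto simp: d_def)
    qed
  qed
  moreover have "compact_op UNIV K"
  proof (rule diagonal_compact[OF S Kb, where d = d])
    show "K s = d s *\<^sub>R s \<and> 0 \<le> d s" if "s \<in> S" for s
      using Ks[OF that] by (simp add: d_def)
    show "finite {s\<in>S. \<epsilon> \<le> d s}" if "0 < \<epsilon>" for \<epsilon>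
      using that by (intro finite_subset[OF _ \<alpha>(3)[of "\<alpha> + \<epsilon>"]]) (auto simp: d_def)
  qed
  moreover have "self_adjoint_op UNIV F"
    using Fb finite_diag_symmetric by (simp add: self_adjoint_op_iff[OF closed_csubspace_UNIV] F_def)
  moreover have "finite_rank UNIV F"
    unfolding finite_rank_def
    by (rule finite_dim_subset[OF finite_dim_span[OF J(1)]]) (auto simp: F_def finite_diag_mem_span)
  moreover have "A = (\<lambda>x. \<alpha> *\<^sub>R x + K x + F x)"
    by (simp add: K_def)
  ultimately show ?thesis
    using \<alpha>(1) by blast
qed

text \<open>Attainment is obtained for the restrictions of T and transferred to the modulus, which
  has the same norm at every vector.\<close>

lemma abs_pk_norming_imp_abs_norm_attaining:
  assumes T: "T \<in> bounded_ops UNIV UNIV" and p: "0 < p" and k: "1 \<le> k"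
    and norming: "abs_pk_norming p k UNIV UNIV T"
  shows "abs_norm_attaining (op_abs UNIV UNIV T)"
  unfolding abs_norm_attaining_def
proof (intro allI impI, elim conjE)
  note U = closed_csubspace_UNIV
  fix M :: "'a set" assume M: "closed_csubspace M" "M \<noteq> {0}"
  then have "pk_norming p k M UNIV (restrict T M)"
    using norming by (simp add: abs_pk_norming_def)
  from pk_norming_imp_norm_attained[OF M(1) U restrict_bounded_ops[OF T M(1) subset_UNIV] M(2) p k this]
  show "\<exists>x\<in>M. norm x = 1 \<and> (\<forall>y\<in>M. norm (op_abs UNIV UNIV T y) \<le> norm (op_abs UNIV UNIV T x) * norm y)"
    by (simp add: norm_op_abs[OF U U T])
qed

lemma scalar_plus_compact_plus_finite_imp_abs_pk_norming:
  assumes T: "T \<in> bounded_ops UNIV UNIV" and "0 \<le> \<alpha>" "positive_op UNIV K" "compact_op UNIV K"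
    "self_adjoint_op UNIV F" "finite_rank UNIV F" "op_abs UNIV UNIV T = (\<lambda>x. \<alpha> *\<^sub>R x + K x + F x)" and p: "0 < p"
  shows "abs_pk_norming p k UNIV UNIV T"
  unfolding abs_pk_norming_def
  using ess_scalar_imp_pk_norming[OF _ closed_csubspace_UNIV restrict_bounded_ops[OF T] _ p
      scalar_plus_compact_plus_finite_imp_ess_scalar[OF assms(1-7)] assms(2)] T
  by blast

theorem theorem11p1:
  fixes T U :: "'h::complex_hilbert \<Rightarrow> 'k::complex_hilbert"
  assumes "T \<in> bounded_ops UNIV UNIV"
    and "polar_decomposition UNIV UNIV T U"
  shows "((\<forall>p::real. \<forall>k::nat. 1 \<le> p \<and> 1 \<le> k \<longrightarrow> abs_pk_norming p k UNIV UNIV T) \<longleftrightarrow>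
          (\<exists>(p::real) (k::nat). 1 \<le> p \<and> 1 \<le> k \<and> abs_pk_norming p k UNIV UNIV T)) \<and>
         ((\<exists>(p::real) (k::nat). 1 \<le> p \<and> 1 \<le> k \<and> abs_pk_norming p k UNIV UNIV T) \<longleftrightarrow>
          (\<exists>\<alpha>::real. \<exists>K F. 0 \<le> \<alpha> \<and>
             positive_op UNIV K \<and> compact_op UNIV K \<and>
             self_adjoint_op UNIV F \<and> finite_rank UNIV F \<and>
             op_abs UNIV UNIV T = (\<lambda>x. \<alpha> *\<^sub>R x + K x + F x)))"
proof -
  let ?all = "\<forall>p::real. \<forall>k::nat. 1 \<le> p \<and> 1 \<le> k \<longrightarrow> abs_pk_norming p k UNIV UNIV T"
  let ?some = "\<exists>(p::real) (k::nat). 1 \<le> p \<and> 1 \<le> k \<and> abs_pk_norming p k UNIV UNIV T"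
  let ?form = "\<exists>\<alpha>::real. \<exists>K F. 0 \<le> \<alpha> \<and> positive_op UNIV K \<and> compact_op UNIV K \<and>
    self_adjoint_op UNIV F \<and> finite_rank UNIV F \<and> op_abs UNIV UNIV T = (\<lambda>x. \<alpha> *\<^sub>R x + K x + F x)"
  note T = assms(1)
  have "?all \<Longrightarrow> ?some"
    by (intro exI[of _ 1]) simp
  moreover have ?form if ?some
  proof -
    obtain p :: real and k :: nat where "1 \<le> p" "1 \<le> k" "abs_pk_norming p k UNIV UNIV T"
      using \<open>?some\<close> by blast
    then have "abs_norm_attaining (op_abs UNIV UNIV T)"
      by (intro abs_pk_norming_imp_abs_norm_attaining[OF T, of p k]) auto
    with op_abs_positive[OF closed_csubspace_UNIV closed_csubspace_UNIV T] show ?form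
      by (rule abs_norm_attaining_imp_scalar_plus_compact_plus_finite)
  qed
  moreover have ?all if ?form
  proof -
    obtain \<alpha> K F where "0 \<le> \<alpha>" "positive_op UNIV K" "compact_op UNIV K"
      "self_adjoint_op UNIV F" "finite_rank UNIV F" "op_abs UNIV UNIV T = (\<lambda>x. \<alpha> *\<^sub>R x + K x + F x)"
      using \<open>?form\<close> by blast
    from scalar_plus_compact_plus_finite_imp_abs_pk_norming[OF T this] show ?all
      by simp
  qed
  ultimately show ?thesis
    by blast
qed

end
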